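(* Let $Q$ be a Leibniz conformal algebra and $(M,l_Q,r_Q)$ a representation of $Q$, where both $Q$ and $M$ are finite and free as $\mathbf{k}[\partial]$-modules. Let $T\in\mathrm{Chom}(M,Q)$ and regard $\eta(T)\in M^{*c}\otimes Q\subset(Q\ltimes_{l_Q^*,-l_Q^*-r_Q^*}M^{*c})\otimes(Q\ltimes_{l_Q^*,-l_Q^*-r_Q^*}M^{*c})$. Then $r=\eta(T)+\tau\eta(T)$ is a symmetric solution of the classical Leibniz conformal Yang-Baxter equation (CLCYBE) in the Leibniz conformal algebra $Q\ltimes_{l_Q^*,-l_Q^*-r_Q^*}M^{*c}$ if and only if $T_0=T_\lambda|_{\lambda=0}$ is an $\mathcal{O}$-operator on $Q$ associated to $(M,l_Q,r_Q)$.
   Context: $\mathbf{k}$ is a field of characteristic zero; tensors are over $\mathbf{k}$; $\tau(a\otimes b)=b\otimes a$; an element $r$ of a tensor square is symmetric if $\tau(r)=r$. A Leibniz conformal algebra is a $\mathbf{k}[\partial]$-module $Q$ with a $\mathbf{k}$-bilinear map $[\cdot_\lambda\cdot]:Q\times Q\to Q[\lambda]$ with $[\partial a_\lambda b]=-\lambda[a_\lambda b]$, $[a_\lambda\partial b]=(\lambda+\partial)[a_\lambda b]$, $[a_\lambda[b_\mu c]]=[[a_\lambda b]_{\lambda+\mu}c]+[b_\mu[a_\lambda c]]$. Finite means finitely generated over $\mathbf{k}[\partial]$. Substitution convention: when a formal variable in a polynomial with module coefficients is replaced by an expression containing $\partial$ or $\partial_i$, one first computes the polynomial and then lets the expression act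 on its coefficients. For $\mathbf{k}[\partial]$-modules $U,V$, $\mathrm{Chom}(U,V)$ is the $\mathbf{k}[\partial]$-module of conformal linear maps: $\mathbf{k}$-linear $a_\lambda:U\to V[\lambda]$ with $a_\lambda(\partial u)=(\lambda+\partial)a_\lambda u$, where $(\partial a)_\lambda u=-\lambda a_\lambda u$; $\mathrm{Cend}(V)=\mathrm{Chom}(V,V)$; $U^{*c}=\mathrm{Chom}(U,\mathbf{k})$ with $\mathbf{k}$ the trivial module; for $f\in U^{*c}$, $u\in U$: $\langle f,u\rangle_\lambda=f_\lambda u$ and $\langle u,f\rangle_{-\lambda}:=-\langle f,u\rangle_\lambda$. A representation of $Q$ is $(M,l,r)$ with $M$ a $\mathbf{k}[\partial]$-module and $l,r:Q\to\mathrm{Cend}(M)$ $\mathbf{k}[\partial]$-module homomorphisms such that $l(a)_\lambda(l(b)_\mu v)=l([a_\lambda b])_{\lambda+\mu}v+l(b)_\mu(l(a)_\lambda v)$; $l(a)_\lambda(r(b)_{-\mu-\partial}v)=r(b)_{-\lambda-\mu-\partial}(l(a)_\lambda v)+r([a_\lambda b])_{-\mu-\partial}v$; $r(b)_{-\lambda-\mu-\partial}(r(a)_{-\mu-\partial}v)=-r(b)_{-\lambda-\mu-\partial}(l(a)_\lambda v)$ for all $a,b\in Q$, $v\in M$. Its dual representation is $(M^{*c},l^*,-l^*-r^* )$, where $\langle l^*(a)_\lambda f,v\rangle_\mu=-\langle f,l(a)_\lambda v\rangle_{\mu-\lambda}$, $\langle r^*(a)_\lambda f,v\rangle_\mu=-\langle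 f,r(a)_\lambda v\rangle_{\mu-\lambda}$. For a representation $(N,l,r)$ the semi-direct product $Q\ltimes_{l,r}N$ is $Q\oplus N$ with $[(a+x)_\lambda(b+y)]=[a_\lambda b]+l(a)_\lambda y+r(b)_{-\lambda-\partial}x$. An $\mathcal{O}$-operator on $Q$ associated to $(M,l,r)$ is a $\mathbf{k}[\partial]$-module homomorphism $T:M\to Q$ with $[T(x)_\lambda T(y)]=T\big(l(T(x))_\lambda y+r(T(y))_{-\lambda-\partial}x\big)$ for all $x,y\in M$. $\eta:\mathrm{Chom}(M,Q)\to M^{*c}\otimes Q$ is the $\mathbf{k}[\partial]$-module isomorphism inverse to $\varphi:M^{*c}\otimes Q\to\mathrm{Chom}(M,Q)$, $\varphi(f\otimes a)_\lambda v=\langle v,f\rangle_{-\lambda-\partial}\,a$ with $\partial$ acting on $a$; that is, $\langle x\otimes g,\eta(T)\rangle_{\lambda,\mu}=\langle g,T_{-\lambda-\mu}(x)\rangle_\mu$ for $x\in M$, $g\in Q^{*c}$, where $\langle x\otimes g,f\otimes a\rangle_{\lambda,\mu}=\langle x,f\rangle_\lambda\langle g,a\rangle_\mu$. CLCYBE in a Leibniz conformal algebra $P$: let $\partial_1,\partial_2,\partial_3$ be $\partial$ acting on the factors of $P^{\otimes3}$ and $\partial^{\otimes^3}=\partial_1+\partial_2+\partial_3$. For $r=\sum_ia_i\otimes b_i\in P\otimes P$ put $$[[r,r]]=\sum_{i,j}[{a_i}_\mu a_j]\otimes b_i\otimes b_j|_{\mu=\partial_2}+\sum_{i,j}a_i\otimes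 a_j\otimes[{b_j}_\mu b_i]|_{\mu=\partial_2}-\sum_{i,j}a_i\otimes[{b_i}_\mu a_j]\otimes b_j|_{\mu=\partial_1}-\sum_{i,j}a_i\otimes[{a_j}_\mu b_i]\otimes b_j|_{\mu=-\partial_1-\partial_2}.$$ $r$ is a solution of the CLCYBE in $P$ if $[[r,r]]\in\partial^{\otimes^3}(P\otimes P\otimes P)$. *)

theory Defs
  imports
    "HOL-Computational_Algebra.Polynomial"
    "HOL-Library.Poly_Mapping"
    "HOL-Library.Function_Algebras"
    "HOL-Library.Product_Plus"
begin

section \<open>Polynomials with module coefficients\<close>

text \<open>
  \<open>V[\<lambda>]\<close> is \<^typ>\<open>'v poly\<close> and \<open>V[\<lambda>,\<mu>]\<close> is \<^typ>\<open>'v poly poly\<close>, where \<open>\<lambda>\<close> is always the outer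
  and \<open>\<mu>\<close> the inner variable.  Variables and \<open>\<partial>\<close> are operators on these groups; operators are added
  pointwise (theory \<^theory>\<open>HOL-Library.Function_Algebras\<close>), so that for example \<open>- lam2 - mu2\<close>
  is multiplication by \<open>-\<lambda>-\<mu>\<close>.

  \<open>subst_op X E p\<close> is \<open>\<Sum>\<^sub>n X\<^sup>n (E p\<^sub>n)\<close> for \<open>p = \<Sum>\<^sub>n p\<^sub>n x\<^sup>n\<close>: the variable of \<open>p\<close> is replaced by the
  operator \<open>X\<close>, which acts on the already computed coefficients \<open>p\<^sub>n\<close>, mapped into the target by
  the additive map \<open>E\<close>.
\<close>

definition subst_op :: "('w \<Rightarrow> 'w) \<Rightarrow> ('v \<Rightarrow> 'w) \<Rightarrow> 'v::zero poly \<Rightarrow> 'w::comm_monoid_add" where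
  "subst_op X E p = (\<Sum>n\<le>Polynomial.degree p. (X ^^ n) (E (coeff p n)))"

definition const1 :: "'v::zero \<Rightarrow> 'v poly" where
  "const1 v = [:v:]"

definition lam1 :: "'v::zero poly \<Rightarrow> 'v poly" where
  "lam1 = pCons 0"

definition const2 :: "'v::zero \<Rightarrow> 'v poly poly" where
  "const2 v = [:[:v:]:]"

definition lam2 :: "'v::zero poly poly \<Rightarrow> 'v poly poly" where
  "lam2 = pCons 0"

definition mu2 :: "'v::zero poly poly \<Rightarrow> 'v poly poly" where
  "mu2 = map_poly (pCons 0)"


section \<open>Modules over \<open>k[\<partial>]\<close>\<close>

text \<open>
  A \<open>k[\<partial>]\<close>-module is a submodule \<open>carr\<close> of an ambient module over \<^typ>\<open>'k poly\<close> that fills a type;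
  the polynomial variable acts as \<open>\<partial>\<close>.
\<close>

record (overloaded) ('k, 'v) kd_module =
  carr :: "'v set"
  scal :: "'k poly \<Rightarrow> 'v \<Rightarrow> 'v"

definition kd_module :: "('k::field_char_0, 'v::ab_group_add, 'z) kd_module_scheme \<Rightarrow> bool" where
  "kd_module V \<longleftrightarrow> module (scal V) \<and> module.subspace (scal V) (carr V)"

definition kd_finite :: "('k::field_char_0, 'v::ab_group_add, 'z) kd_module_scheme \<Rightarrow> bool" where
  "kd_finite V \<longleftrightarrow> (\<exists>B. finite B \<and> module.span (scal V) B = carr V)"

definition kd_free :: "('k::field_char_0, 'v::ab_group_add, 'z) kd_module_scheme \<Rightarrow> bool" where
  "kd_free V \<longleftrightarrow> (\<exists>B. \<not> module.dependent (scal V) B \<and> module.span (scal V) B = carr V)"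

definition kscal :: "('k::field_char_0, 'v, 'z) kd_module_scheme \<Rightarrow> 'k \<Rightarrow> 'v \<Rightarrow> 'v" where
  "kscal V c = scal V [:c:]"

definition del :: "('k::field_char_0, 'v, 'z) kd_module_scheme \<Rightarrow> 'v \<Rightarrow> 'v" where
  "del V = scal V [:0, 1:]"

definition del1 :: "('k::field_char_0, 'v::zero, 'z) kd_module_scheme \<Rightarrow> 'v poly \<Rightarrow> 'v poly" where
  "del1 V = map_poly (del V)"

definition del2 :: "('k::field_char_0, 'v::zero, 'z) kd_module_scheme
    \<Rightarrow> 'v poly poly \<Rightarrow> 'v poly poly" where
  "del2 V = map_poly (map_poly (del V))"

definition poly_over :: "'v::zero set \<Rightarrow> 'v poly set" where
  "poly_over S = {p. \<forall>n. coeff p n \<in> S}"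

definition kd_hom :: "('k::field_char_0, 'u::ab_group_add, 'y) kd_module_scheme
    \<Rightarrow> ('k, 'v::ab_group_add, 'z) kd_module_scheme \<Rightarrow> ('u \<Rightarrow> 'v) \<Rightarrow> bool" where
  "kd_hom U V f \<longleftrightarrow>
     (\<forall>u\<in>carr U. f u \<in> carr V) \<and>
     (\<forall>u\<in>carr U. \<forall>u'\<in>carr U. f (u + u') = f u + f u') \<and>
     (\<forall>p. \<forall>u\<in>carr U. f (scal U p u) = scal V p (f u))"

text \<open>The field with \<open>\<partial> = 0\<close>.\<close>

definition trivial_module :: "('k::field_char_0, 'k) kd_module" where
  "trivial_module = \<lparr>carr = UNIV, scal = (\<lambda>p c. coeff p 0 * c)\<rparr>"


section \<open>Conformal linear maps\<close>

text \<open>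
  A map on the carrier of \<open>U\<close> is represented by the function that vanishes outside of it, so that
  equality in \<open>Chom\<close> is equality of functions.  The scalar action is given by \<open>\<partial> \<mapsto> -\<lambda>\<close>.
\<close>

definition Chom :: "('k::field_char_0, 'u::ab_group_add, 'y) kd_module_scheme
    \<Rightarrow> ('k, 'v::ab_group_add, 'z) kd_module_scheme \<Rightarrow> ('k, 'u \<Rightarrow> 'v poly) kd_module" where
  "Chom U V = \<lparr>
     carr = {a.
       (\<forall>u. u \<notin> carr U \<longrightarrow> a u = 0) \<and>
       (\<forall>u\<in>carr U. a u \<in> poly_over (carr V)) \<and>
       (\<forall>u\<in>carr U. \<forall>u'\<in>carr U. a (u + u') = a u + a u') \<and>
       (\<forall>c. \<forall>u\<in>carr U. a (kscal U c u) = map_poly (kscal V c) (a u)) \<and>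
       (\<forall>u\<in>carr U. a (del U u) = lam1 (a u) + del1 V (a u))},
     scal = (\<lambda>p a u. subst_op (- lam1) (\<lambda>c. map_poly (kscal V c) (a u)) p)\<rparr>"

abbreviation "Cend V \<equiv> Chom V V"

abbreviation "conf_dual U \<equiv> Chom U trivial_module"

text \<open>
  \<open>\<langle>f,u\<rangle>\<^sub>\<lambda>\<close> is \<open>f u\<close>.  From \<open>\<langle>u,f\<rangle>\<^sub>-\<^sub>\<lambda> = -\<langle>f,u\<rangle>\<^sub>\<lambda>\<close>, the polynomial \<open>\<langle>u,f\<rangle>\<^sub>\<nu>\<close> in \<open>\<nu>\<close> is obtained by
  replacing \<open>\<lambda>\<close> by \<open>-\<nu>\<close>.
\<close>

definition pair_flip :: "'u \<Rightarrow> ('u \<Rightarrow> 'k::field_char_0 poly) \<Rightarrow> 'k poly" where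
  "pair_flip u f = - pcompose (f u) [:0, - 1:]"


section \<open>Leibniz conformal algebras and representations\<close>

record (overloaded) ('k, 'v) conf_alg = "('k, 'v) kd_module" +
  br :: "'v \<Rightarrow> 'v \<Rightarrow> 'v poly"

definition leibniz_conformal_algebra ::
    "('k::field_char_0, 'v::ab_group_add, 'z) conf_alg_scheme \<Rightarrow> bool" where
  "leibniz_conformal_algebra Q \<longleftrightarrow>
     kd_module Q \<and>
     (\<forall>a\<in>carr Q. \<forall>b\<in>carr Q. br Q a b \<in> poly_over (carr Q)) \<and>
     (\<forall>a\<in>carr Q. \<forall>a'\<in>carr Q. \<forall>b\<in>carr Q. br Q (a + a') b = br Q a b + br Q a' b) \<and>
     (\<forall>a\<in>carr Q. \<forall>b\<in>carr Q. \<forall>b'\<in>carr Q. br Q a (b + b') = br Q a b + br Q a b') \<and>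
     (\<forall>c. \<forall>a\<in>carr Q. \<forall>b\<in>carr Q. br Q (kscal Q c a) b = map_poly (kscal Q c) (br Q a b)) \<and>
     (\<forall>c. \<forall>a\<in>carr Q. \<forall>b\<in>carr Q. br Q a (kscal Q c b) = map_poly (kscal Q c) (br Q a b)) \<and>
     (\<forall>a\<in>carr Q. \<forall>b\<in>carr Q. br Q (del Q a) b = - lam1 (br Q a b)) \<and>
     (\<forall>a\<in>carr Q. \<forall>b\<in>carr Q. br Q a (del Q b) = lam1 (br Q a b) + del1 Q (br Q a b)) \<and>
     (\<forall>a\<in>carr Q. \<forall>b\<in>carr Q. \<forall>c\<in>carr Q.
        subst_op mu2 (\<lambda>u. subst_op lam2 const2 (br Q a u)) (br Q b c) =
        subst_op lam2 (\<lambda>u. subst_op (lam2 + mu2) const2 (br Q u c)) (br Q a b) +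
        subst_op lam2 (\<lambda>u. subst_op mu2 const2 (br Q b u)) (br Q a c))"

text \<open>\<open>r(b)\<^sub>-\<^sub>\<lambda>\<^sub>-\<^sub>\<partial> v\<close> as a polynomial in \<open>\<lambda>\<close>.\<close>

definition flip_act :: "('k::field_char_0, 'v::ab_group_add, 'z) kd_module_scheme
    \<Rightarrow> ('q \<Rightarrow> 'v \<Rightarrow> 'v poly) \<Rightarrow> 'q \<Rightarrow> 'v \<Rightarrow> 'v poly" where
  "flip_act N r b v = subst_op (- lam1 - del1 N) const1 (r b v)"

text \<open>In the last two axioms the inner \<open>r(b)\<^sub>-\<^sub>\<mu>\<^sub>-\<^sub>\<partial> v\<close> is first computed in \<open>M[\<mu>]\<close>.\<close>

definition lca_representation :: "('k::field_char_0, 'q::ab_group_add, 'y) conf_alg_scheme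
    \<Rightarrow> ('k, 'm::ab_group_add, 'z) kd_module_scheme
    \<Rightarrow> ('q \<Rightarrow> 'm \<Rightarrow> 'm poly) \<Rightarrow> ('q \<Rightarrow> 'm \<Rightarrow> 'm poly) \<Rightarrow> bool" where
  "lca_representation Q M l r \<longleftrightarrow>
     kd_module M \<and> kd_hom Q (Cend M) l \<and> kd_hom Q (Cend M) r \<and>
     (\<forall>a\<in>carr Q. \<forall>b\<in>carr Q. \<forall>v\<in>carr M.
        subst_op mu2 (\<lambda>u. subst_op lam2 const2 (l a u)) (l b v) =
        subst_op lam2 (\<lambda>d. subst_op (lam2 + mu2) const2 (l d v)) (br Q a b) +
        subst_op lam2 (\<lambda>u. subst_op mu2 const2 (l b u)) (l a v)) \<and>
     (\<forall>a\<in>carr Q. \<forall>b\<in>carr Q. \<forall>v\<in>carr M.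
        subst_op mu2 (\<lambda>u. subst_op lam2 const2 (l a u)) (flip_act M r b v) =
        subst_op lam2 (\<lambda>u. subst_op (- lam2 - mu2 - del2 M) const2 (r b u)) (l a v) +
        subst_op lam2 (\<lambda>d. subst_op (- mu2 - del2 M) const2 (r d v)) (br Q a b)) \<and>
     (\<forall>a\<in>carr Q. \<forall>b\<in>carr Q. \<forall>v\<in>carr M.
        subst_op mu2 (\<lambda>u. subst_op (- lam2 - mu2 - del2 M) const2 (r b u)) (flip_act M r a v) =
        - subst_op lam2 (\<lambda>u. subst_op (- lam2 - mu2 - del2 M) const2 (r b u)) (l a v))"

text \<open>
  \<open>dual_act M l a f\<close> is \<open>l\<^sup>*(a)\<^sub>\<lambda> f\<close>, the polynomial in \<open>\<lambda>\<close> over the conformal dual determined by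
  \<open>\<langle>l\<^sup>*(a)\<^sub>\<lambda> f, v\<rangle>\<^sub>\<mu> = -\<langle>f, l(a)\<^sub>\<lambda> v\<rangle>\<^sub>\<mu>\<^sub>-\<^sub>\<lambda>\<close>; it exists whenever \<open>M\<close> is finite.
\<close>

definition dual_act :: "('k::field_char_0, 'm::ab_group_add, 'z) kd_module_scheme
    \<Rightarrow> ('q \<Rightarrow> 'm \<Rightarrow> 'm poly) \<Rightarrow> 'q \<Rightarrow> ('m \<Rightarrow> 'k poly) \<Rightarrow> ('m \<Rightarrow> 'k poly) poly" where
  "dual_act M l a f =
     (if f \<in> carr (conf_dual M)
      then THE g. g \<in> poly_over (carr (conf_dual M)) \<and>
             (\<forall>v\<in>carr M. map_poly (\<lambda>h. h v) g =
                - subst_op lam2 (\<lambda>u. subst_op (mu2 - lam2) const2 (f u)) (l a v))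
      else 0)"

definition semidirect :: "('k::field_char_0, 'q::ab_group_add, 'y) conf_alg_scheme
    \<Rightarrow> ('k, 'n::ab_group_add, 'z) kd_module_scheme
    \<Rightarrow> ('q \<Rightarrow> 'n \<Rightarrow> 'n poly) \<Rightarrow> ('q \<Rightarrow> 'n \<Rightarrow> 'n poly) \<Rightarrow> ('k, 'q \<times> 'n) conf_alg" where
  "semidirect Q N l r = \<lparr>
     carr = carr Q \<times> carr N,
     scal = (\<lambda>p (a, x). (scal Q p a, scal N p x)),
     br = (\<lambda>(a, x) (b, y).
       map_poly (\<lambda>d. (d, 0)) (br Q a b) +
       map_poly (\<lambda>z. (0, z)) (l a y + flip_act N r b x))\<rparr>"

text \<open>The semi-direct product with the dual representation \<open>(M\<^sup>*\<^sup>c, l\<^sup>*, -l\<^sup>*-r\<^sup>*)\<close>.\<close>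

definition dual_semidirect :: "('k::field_char_0, 'q::ab_group_add, 'y) conf_alg_scheme
    \<Rightarrow> ('k, 'm::ab_group_add, 'z) kd_module_scheme
    \<Rightarrow> ('q \<Rightarrow> 'm \<Rightarrow> 'm poly) \<Rightarrow> ('q \<Rightarrow> 'm \<Rightarrow> 'm poly)
    \<Rightarrow> ('k, 'q \<times> ('m \<Rightarrow> 'k poly)) conf_alg" where
  "dual_semidirect Q M l r =
     semidirect Q (conf_dual M) (dual_act M l) (- dual_act M l - dual_act M r)"

definition O_operator :: "('k::field_char_0, 'q::ab_group_add, 'y) conf_alg_scheme
    \<Rightarrow> ('k, 'm::ab_group_add, 'z) kd_module_scheme
    \<Rightarrow> ('q \<Rightarrow> 'm \<Rightarrow> 'm poly) \<Rightarrow> ('q \<Rightarrow> 'm \<Rightarrow> 'm poly) \<Rightarrow> ('m \<Rightarrow> 'q) \<Rightarrow> bool" where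
  "O_operator Q M l r T \<longleftrightarrow>
     kd_hom M Q T \<and>
     (\<forall>x\<in>carr M. \<forall>y\<in>carr M.
        br Q (T x) (T y) = map_poly T (l (T x) y + flip_act M r (T y) x))"


section \<open>Tensor products over the field\<close>

text \<open>
  Tensor products are quotients of the space \<^typ>\<open>'p \<Rightarrow>\<^sub>0 'k\<close> of formal linear combinations of pairs
  (triples) by the multilinearity relations; their elements are equivalence classes.
\<close>

definition fscal :: "'k::field_char_0 \<Rightarrow> ('p \<Rightarrow>\<^sub>0 'k) \<Rightarrow> ('p \<Rightarrow>\<^sub>0 'k)" where
  "fscal c t = Poly_Mapping.map (\<lambda>d. c * d) t"

definition pure :: "'p \<Rightarrow> ('p \<Rightarrow>\<^sub>0 'k::field_char_0)" where
  "pure p = Poly_Mapping.single p 1"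

text \<open>Linear extension of \<open>F\<close> to formal combinations, \<open>sc\<close> being the scalar action in the target.\<close>

definition lin_ext :: "('k \<Rightarrow> 'w \<Rightarrow> 'w) \<Rightarrow> ('p \<Rightarrow> 'w) \<Rightarrow> ('p \<Rightarrow>\<^sub>0 'k::field_char_0)
    \<Rightarrow> 'w::comm_monoid_add" where
  "lin_ext sc F t = (\<Sum>p\<in>Poly_Mapping.keys t. sc (Poly_Mapping.lookup t p) (F p))"

definition tensor2_null :: "('k::field_char_0, 'a::ab_group_add, 'y) kd_module_scheme
    \<Rightarrow> ('k, 'b::ab_group_add, 'z) kd_module_scheme \<Rightarrow> ('a \<times> 'b \<Rightarrow>\<^sub>0 'k) set" where
  "tensor2_null A B = module.span fscal
     ({pure (a + a', b) - pure (a, b) - pure (a', b) |a a' b.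
         a \<in> carr A \<and> a' \<in> carr A \<and> b \<in> carr B} \<union>
      {pure (a, b + b') - pure (a, b) - pure (a, b') |a b b'.
         a \<in> carr A \<and> b \<in> carr B \<and> b' \<in> carr B} \<union>
      {pure (kscal A c a, b) - fscal c (pure (a, b)) |c a b. a \<in> carr A \<and> b \<in> carr B} \<union>
      {pure (a, kscal B c b) - fscal c (pure (a, b)) |c a b. a \<in> carr A \<and> b \<in> carr B})"

definition tensor2_free :: "('k::field_char_0, 'a, 'y) kd_module_scheme
    \<Rightarrow> ('k, 'b, 'z) kd_module_scheme \<Rightarrow> ('a \<times> 'b \<Rightarrow>\<^sub>0 'k) set" where
  "tensor2_free A B = {t. Poly_Mapping.keys t \<subseteq> carr A \<times> carr B}"

definition tensor2_rel :: "('k::field_char_0, 'a::ab_group_add, 'y) kd_module_scheme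
    \<Rightarrow> ('k, 'b::ab_group_add, 'z) kd_module_scheme
    \<Rightarrow> (('a \<times> 'b \<Rightarrow>\<^sub>0 'k) \<times> ('a \<times> 'b \<Rightarrow>\<^sub>0 'k)) set" where
  "tensor2_rel A B =
     {(s, t). s \<in> tensor2_free A B \<and> t \<in> tensor2_free A B \<and> s - t \<in> tensor2_null A B}"

definition tensor2 :: "('k::field_char_0, 'a::ab_group_add, 'y) kd_module_scheme
    \<Rightarrow> ('k, 'b::ab_group_add, 'z) kd_module_scheme \<Rightarrow> ('a \<times> 'b \<Rightarrow>\<^sub>0 'k) set set" where
  "tensor2 A B = tensor2_free A B // tensor2_rel A B"

definition tensor3_null :: "('k::field_char_0, 'p::ab_group_add, 'z) kd_module_scheme
    \<Rightarrow> ('p \<times> 'p \<times> 'p \<Rightarrow>\<^sub>0 'k) set" where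
  "tensor3_null P = module.span fscal
     ({pure (a + a', b, c) - pure (a, b, c) - pure (a', b, c) |a a' b c.
         a \<in> carr P \<and> a' \<in> carr P \<and> b \<in> carr P \<and> c \<in> carr P} \<union>
      {pure (a, b + b', c) - pure (a, b, c) - pure (a, b', c) |a b b' c.
         a \<in> carr P \<and> b \<in> carr P \<and> b' \<in> carr P \<and> c \<in> carr P} \<union>
      {pure (a, b, c + c') - pure (a, b, c) - pure (a, b, c') |a b c c'.
         a \<in> carr P \<and> b \<in> carr P \<and> c \<in> carr P \<and> c' \<in> carr P} \<union>
      {pure (kscal P k a, b, c) - fscal k (pure (a, b, c)) |k a b c.
         a \<in> carr P \<and> b \<in> carr P \<and> c \<in> carr P} \<union>
      {pure (a, kscal P k b, c) - fscal k (pure (a, b, c)) |k a b c.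
         a \<in> carr P \<and> b \<in> carr P \<and> c \<in> carr P} \<union>
      {pure (a, b, kscal P k c) - fscal k (pure (a, b, c)) |k a b c.
         a \<in> carr P \<and> b \<in> carr P \<and> c \<in> carr P})"

definition tensor3_free :: "('k::field_char_0, 'p, 'z) kd_module_scheme
    \<Rightarrow> ('p \<times> 'p \<times> 'p \<Rightarrow>\<^sub>0 'k) set" where
  "tensor3_free P = {t. Poly_Mapping.keys t \<subseteq> carr P \<times> carr P \<times> carr P}"

definition tensor3_rel :: "('k::field_char_0, 'p::ab_group_add, 'z) kd_module_scheme
    \<Rightarrow> (('p \<times> 'p \<times> 'p \<Rightarrow>\<^sub>0 'k) \<times> ('p \<times> 'p \<times> 'p \<Rightarrow>\<^sub>0 'k)) set" where
  "tensor3_rel P = {(s, t). s \<in> tensor3_free P \<and> t \<in> tensor3_free P \<and> s - t \<in> tensor3_null P}"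

definition tensor3 :: "('k::field_char_0, 'p::ab_group_add, 'z) kd_module_scheme
    \<Rightarrow> ('p \<times> 'p \<times> 'p \<Rightarrow>\<^sub>0 'k) set set" where
  "tensor3 P = tensor3_free P // tensor3_rel P"

text \<open>
  \<open>on_classes R F\<close> is the map induced on classes by a map \<open>F\<close> of representatives, \<open>R\<close> being the
  equivalence relation of the target.
\<close>

definition on_classes :: "('t \<times> 't) set \<Rightarrow> ('s \<Rightarrow> 't) \<Rightarrow> 's set \<Rightarrow> 't set" where
  "on_classes R F X = (\<Union>x\<in>X. R `` {F x})"

definition tensor2_add :: "('k::field_char_0, 'a::ab_group_add, 'y) kd_module_scheme
    \<Rightarrow> ('k, 'b::ab_group_add, 'z) kd_module_scheme
    \<Rightarrow> ('a \<times> 'b \<Rightarrow>\<^sub>0 'k) set \<Rightarrow> ('a \<times> 'b \<Rightarrow>\<^sub>0 'k) set \<Rightarrow> ('a \<times> 'b \<Rightarrow>\<^sub>0 'k) set" where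
  "tensor2_add A B X Y = on_classes (tensor2_rel A B) (\<lambda>(x, y). x + y) (X \<times> Y)"

definition tensor_flip :: "('k::field_char_0, 'p::ab_group_add, 'z) kd_module_scheme
    \<Rightarrow> ('p \<times> 'p \<Rightarrow>\<^sub>0 'k) set \<Rightarrow> ('p \<times> 'p \<Rightarrow>\<^sub>0 'k) set" where
  "tensor_flip P = on_classes (tensor2_rel P P) (lin_ext fscal (\<lambda>(a, b). pure (b, a)))"

definition tensor_symmetric :: "('k::field_char_0, 'p::ab_group_add, 'z) kd_module_scheme
    \<Rightarrow> ('p \<times> 'p \<Rightarrow>\<^sub>0 'k) set \<Rightarrow> bool" where
  "tensor_symmetric P X \<longleftrightarrow> tensor_flip P X = X"


section \<open>The classical Leibniz conformal Yang-Baxter equation\<close>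

definition d1 :: "('k::field_char_0, 'p, 'z) kd_module_scheme
    \<Rightarrow> ('p \<times> 'p \<times> 'p \<Rightarrow>\<^sub>0 'k) \<Rightarrow> ('p \<times> 'p \<times> 'p \<Rightarrow>\<^sub>0 'k)" where
  "d1 P = lin_ext fscal (\<lambda>(a, b, c). pure (del P a, b, c))"

definition d2 :: "('k::field_char_0, 'p, 'z) kd_module_scheme
    \<Rightarrow> ('p \<times> 'p \<times> 'p \<Rightarrow>\<^sub>0 'k) \<Rightarrow> ('p \<times> 'p \<times> 'p \<Rightarrow>\<^sub>0 'k)" where
  "d2 P = lin_ext fscal (\<lambda>(a, b, c). pure (a, del P b, c))"

definition d3 :: "('k::field_char_0, 'p, 'z) kd_module_scheme
    \<Rightarrow> ('p \<times> 'p \<times> 'p \<Rightarrow>\<^sub>0 'k) \<Rightarrow> ('p \<times> 'p \<times> 'p \<Rightarrow>\<^sub>0 'k)" where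
  "d3 P = lin_ext fscal (\<lambda>(a, b, c). pure (a, b, del P c))"

definition yb_term :: "('k::field_char_0, 'p::ab_group_add, 'z) conf_alg_scheme
    \<Rightarrow> 'p \<times> 'p \<Rightarrow> 'p \<times> 'p \<Rightarrow> ('p \<times> 'p \<times> 'p \<Rightarrow>\<^sub>0 'k)" where
  "yb_term P = (\<lambda>(ai, bi) (aj, bj).
       subst_op (d2 P) (\<lambda>u. pure (u, bi, bj)) (br P ai aj)
     + subst_op (d2 P) (\<lambda>u. pure (ai, aj, u)) (br P bj bi)
     - subst_op (d1 P) (\<lambda>u. pure (ai, u, bj)) (br P bi aj)
     - subst_op (- d1 P - d2 P) (\<lambda>u. pure (ai, u, bj)) (br P aj bi))"

definition yb_formal :: "('k::field_char_0, 'p::ab_group_add, 'z) conf_alg_scheme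
    \<Rightarrow> ('p \<times> 'p \<Rightarrow>\<^sub>0 'k) \<Rightarrow> ('p \<times> 'p \<times> 'p \<Rightarrow>\<^sub>0 'k)" where
  "yb_formal P t = lin_ext fscal (\<lambda>p. lin_ext fscal (\<lambda>q. yb_term P p q) t) t"

definition yb_bracket :: "('k::field_char_0, 'p::ab_group_add, 'z) conf_alg_scheme
    \<Rightarrow> ('p \<times> 'p \<Rightarrow>\<^sub>0 'k) set \<Rightarrow> ('p \<times> 'p \<times> 'p \<Rightarrow>\<^sub>0 'k) set" where
  "yb_bracket P = on_classes (tensor3_rel P) (yb_formal P)"

definition CLCYBE_solution :: "('k::field_char_0, 'p::ab_group_add, 'z) conf_alg_scheme
    \<Rightarrow> ('p \<times> 'p \<Rightarrow>\<^sub>0 'k) set \<Rightarrow> bool" where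
  "CLCYBE_solution P X \<longleftrightarrow>
     X \<in> tensor2 P P \<and>
     yb_bracket P X \<in> on_classes (tensor3_rel P) (d1 P + d2 P + d3 P) ` tensor3 P"


section \<open>The tensor attached to a conformal linear map\<close>

text \<open>\<open>\<phi>(f \<otimes> a)\<^sub>\<lambda> v = \<langle>v,f\<rangle>\<^sub>-\<^sub>\<lambda>\<^sub>-\<^sub>\<partial> a\<close>, extended linearly.\<close>

definition phi_formal :: "('k::field_char_0, 'q::ab_group_add, 'y) kd_module_scheme
    \<Rightarrow> (('m \<Rightarrow> 'k poly) \<times> 'q \<Rightarrow>\<^sub>0 'k) \<Rightarrow> 'm \<Rightarrow> 'q poly" where
  "phi_formal Q t v =
     lin_ext (\<lambda>c. map_poly (kscal Q c))
       (\<lambda>(f, a). subst_op (- lam1 - del1 Q) (\<lambda>c. const1 (kscal Q c a)) (pair_flip v f)) t"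

definition phi :: "('k::field_char_0, 'q::ab_group_add, 'y) kd_module_scheme
    \<Rightarrow> (('m \<Rightarrow> 'k poly) \<times> 'q \<Rightarrow>\<^sub>0 'k) set \<Rightarrow> 'm \<Rightarrow> 'q poly" where
  "phi Q X = the_elem (phi_formal Q ` X)"

definition eta :: "('k::field_char_0, 'm::ab_group_add, 'z) kd_module_scheme
    \<Rightarrow> ('k, 'q::ab_group_add, 'y) kd_module_scheme
    \<Rightarrow> ('m \<Rightarrow> 'q poly) \<Rightarrow> (('m \<Rightarrow> 'k poly) \<times> 'q \<Rightarrow>\<^sub>0 'k) set" where
  "eta M Q = the_inv_into (tensor2 (conf_dual M) Q) (phi Q)"

text \<open>The inclusion \<open>N \<otimes> Q \<subseteq> P \<otimes> P\<close> for a module structure \<open>P\<close> on \<open>Q \<oplus> N\<close>.\<close>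

definition tensor_incl :: "('k::field_char_0, 'q::ab_group_add \<times> 'n::ab_group_add, 'z) kd_module_scheme
    \<Rightarrow> ('n \<times> 'q \<Rightarrow>\<^sub>0 'k) set \<Rightarrow> (('q \<times> 'n) \<times> ('q \<times> 'n) \<Rightarrow>\<^sub>0 'k) set" where
  "tensor_incl P =
     on_classes (tensor2_rel P P) (lin_ext fscal (\<lambda>(x, a). pure ((0, x), (a, 0))))"

end

theory Submission
  imports Defs
begin

text \<open>
  Everything is reduced to identities between scalars.  A \<^emph>\<open>point functional\<close> of weight \<open>w\<close> on a
  \<open>k[\<partial>]\<close>-module \<open>V\<close> is a \<open>k\<close>-linear map \<open>h : V \<rightarrow> k\<close> with \<open>h(\<partial>v) = w h(v)\<close>, that is, a functional on the
  fibre of \<open>V\<close> at the point \<open>w\<close> of the line.  After a point functional is applied and the variables are given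
  scalar values, sesquilinearity says that brackets, actions and conformal maps are themselves point
  functionals of their arguments: \<open>h([a\<^sub>\<mu> b])\<close> has weight \<open>-\<mu>\<close> in \<open>a\<close> and \<open>\<mu> + w\<close> in \<open>b\<close>.  As \<open>k\<close> is
  infinite, point functionals separate the elements of a free module.  The same holds for tensors: an
  element of \<open>P \<otimes> P \<otimes> P\<close> over a free module \<open>P\<close> is zero if all products of three point functionals vanish
  on it (\<open>tensor3_null_of_eval\<close>), and it is a total derivative if and only if those products vanish
  whose weights have sum zero (\<open>exact3_of_eval\<close> and \<open>eval3_exact3\<close>).

  Let \<open>P\<close> be the semi-direct product of \<open>Q\<close> with the dual representation.  As \<open>M\<close> is free of finite rank,
  a point functional on \<open>M\<^sup>*\<^sup>c\<close> of weight \<open>w\<close> is the evaluation \<open>f \<mapsto> f\<^sub>-\<^sub>w(x)\<close> at some \<open>x\<close> in \<open>M\<close>, so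
  one on \<open>P\<close> is given by a pair \<open>\<theta> = (h, x)\<close>.  Write \<open>r = \<eta>(T) + \<tau>\<eta>(T)\<close> and contract one factor of
  \<open>r\<close> with \<open>\<theta>\<close>.  On the other factor, all functionals of the opposite weight \<open>-w\<close> see the same element
  \<open>\<rho>\<^sub>\<theta> = (-T\<^sub>0 x, S h)\<close> of \<open>P\<close>, where \<open>(S h)\<^sub>w(u) = -h(T\<^sub>0 u)\<close> (lemma \<open>contract\<close>); this is where
  \<open>T\<^sub>\<lambda>\<close> is replaced by its value at \<open>\<lambda> = 0\<close>.  If \<open>w\<^sub>1 + w\<^sub>2 + w\<^sub>3 = 0\<close>, then every contraction that occurs in
  \<open>[[r,r]]\<close> is of this kind, and
  \<open>(\<theta>\<^sub>1 \<otimes> \<theta>\<^sub>2 \<otimes> \<theta>\<^sub>3)[[r,r]]\<close> is the sum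
  \<open>\<theta>\<^sub>1[\<rho>\<^sub>2 \<rho>\<^sub>3] + \<theta>\<^sub>3[\<rho>\<^sub>2 \<rho>\<^sub>1] - \<theta>\<^sub>2[\<rho>\<^sub>1 \<rho>\<^sub>3] - \<theta>\<^sub>2[\<rho>\<^sub>3 \<rho>\<^sub>1]\<close>, where the variable of a bracket is
  the weight that belongs to its first argument.  Inserting the bracket of \<open>P\<close> and collecting the terms with the
  same \<open>h\<^sub>i\<close> gives
  \<open>h\<^sub>1(O(x\<^sub>2, x\<^sub>3)) + h\<^sub>3(O(x\<^sub>2, x\<^sub>1)) - h\<^sub>2(O(x\<^sub>1, x\<^sub>3)) - h\<^sub>2(O(x\<^sub>3, x\<^sub>1))\<close>, where \<open>O(x, y)\<close> is
  the difference of the two sides of the defining identity of an \<open>O\<close>-operator for \<open>T\<^sub>0\<close>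
  (\<open>yb_symmetrised_eval\<close>).  If \<open>T\<^sub>0\<close> is an \<open>O\<close>-operator, this vanishes; conversely, \<open>h\<^sub>2 = h\<^sub>3 = 0\<close> and
  \<open>x\<^sub>1 = 0\<close> isolate the first summand.
\<close>



section \<open>Evaluating polynomials with module coefficients at scalars\<close>

definition additive_on :: "'a::monoid_add set \<Rightarrow> ('a \<Rightarrow> 'b::monoid_add) \<Rightarrow> bool" where
  "additive_on S \<Phi> \<longleftrightarrow> 0 \<in> S \<and> (\<forall>s\<in>S. \<forall>t\<in>S. s + t \<in> S \<and> \<Phi> (s + t) = \<Phi> s + \<Phi> t)"

text \<open>For linear \<open>h\<close> this is \<open>h\<close> applied to the value of \<open>y\<close> at \<open>a\<close>.  The powers of \<open>a\<close> act after \<open>h\<close>, so that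
  the coefficients of \<open>y\<close> may come from a type without scalars.\<close>

definition peval :: "('v::zero \<Rightarrow> 'k::comm_semiring_1) \<Rightarrow> 'k \<Rightarrow> 'v poly \<Rightarrow> 'k" where
  "peval h a y = (\<Sum>n\<le>Polynomial.degree y. a ^ n * h (coeff y n))"

text \<open>The functionals on the fibre \<open>V/(\<partial>-w)V\<close>.\<close>

definition point_functional ::
    "('k::field_char_0, 'v::ab_group_add, 'z) kd_module_scheme \<Rightarrow> 'k \<Rightarrow> ('v \<Rightarrow> 'k) \<Rightarrow> bool" where
  "point_functional V w h \<longleftrightarrow>
     (\<forall>u\<in>carr V. \<forall>u'\<in>carr V. h (u + u') = h u + h u') \<and>
     (\<forall>p. \<forall>u\<in>carr V. h (scal V p u) = poly p w * h u)"

text \<open>On \<open>S\<close> the functional \<open>\<Phi>\<close> turns the operator \<open>X\<close> into the scalar \<open>c\<close>.  Hence it turns the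
  substitution of \<open>X\<close> for a variable into the substitution of \<open>c\<close>.\<close>

definition eigen_on :: "'a::monoid_add set \<Rightarrow> ('a \<Rightarrow> 'a) \<Rightarrow> 'k::semiring_1 \<Rightarrow> ('a \<Rightarrow> 'k) \<Rightarrow> bool" where
  "eigen_on S X c \<Phi> \<longleftrightarrow> additive_on S \<Phi> \<and> (\<forall>s\<in>S. X s \<in> S \<and> \<Phi> (X s) = c * \<Phi> s)"

lemma additive_on_zero:
  fixes \<Phi> :: "'a::monoid_add \<Rightarrow> 'b::ab_group_add"
  assumes "additive_on S \<Phi>" shows "\<Phi> 0 = 0"
proof -
  have "\<Phi> (0 + 0) = \<Phi> 0 + \<Phi> 0" using assms unfolding additive_on_def by blast
  then show ?thesis by simp
qed

lemma additive_on_sum: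
  fixes \<Phi> :: "'a::comm_monoid_add \<Rightarrow> 'b::ab_group_add"
  assumes "additive_on S \<Phi>" "\<And>i. i \<in> A \<Longrightarrow> f i \<in> S"
  shows "sum f A \<in> S \<and> \<Phi> (sum f A) = (\<Sum>i\<in>A. \<Phi> (f i))"
proof (cases "finite A")
  case True
  then show ?thesis using assms(2)
    by (induction A) (use assms(1) additive_on_zero[OF assms(1)] in \<open>auto simp: additive_on_def\<close>)
next
  case False
  then show ?thesis using assms(1) additive_on_zero[OF assms(1)] by (auto simp: additive_on_def)
qed

lemma subst_op_eval:
  fixes \<Phi> :: "'w::comm_monoid_add \<Rightarrow> 'k::field"
  assumes X: "eigen_on S X c \<Phi>" and E: "\<forall>n. E (coeff p n) \<in> S"
  shows "subst_op X E p \<in> S" "\<Phi> (subst_op X E p) = peval (\<lambda>u. \<Phi> (E u)) c p"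
proof -
  have \<Phi>: "additive_on S \<Phi>" using X by (simp add: eigen_on_def)
  have *: "(X ^^ n) s \<in> S \<and> \<Phi> ((X ^^ n) s) = c ^ n * \<Phi> s" if "s \<in> S" for n s
    by (induction n) (use that X in \<open>auto simp: eigen_on_def\<close>)
  show "subst_op X E p \<in> S" "\<Phi> (subst_op X E p) = peval (\<lambda>u. \<Phi> (E u)) c p"
    unfolding subst_op_def peval_def
    using additive_on_sum[OF \<Phi>, of "{..Polynomial.degree p}" "\<lambda>n. (X ^^ n) (E (coeff p n))"] * E
    by auto
qed

lemma peval_superset:
  fixes h :: "'v::zero \<Rightarrow> 'k::comm_ring_1"
  assumes "h 0 = 0" "Polynomial.degree y \<le> N"
  shows "peval h a y = (\<Sum>n\<le>N. a ^ n * h (coeff y n))"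
  unfolding peval_def
  by (rule sum.mono_neutral_left) (use assms in \<open>auto simp: coeff_eq_0 not_le\<close>)

lemma peval_poly: "h 0 = 0 \<Longrightarrow> peval h a y = poly (map_poly h y) (a::'k::comm_ring_1)"
proof -
  assume h: "h 0 = 0"
  have "poly (map_poly h y) a = (\<Sum>n\<le>Polynomial.degree y. coeff (map_poly h y) n * a ^ n)"
    unfolding poly_altdef
    by (rule sum.mono_neutral_left) (use h in \<open>auto simp: map_poly_degree_leq coeff_eq_0\<close>)
  then show ?thesis by (simp add: peval_def coeff_map_poly h mult.commute)
qed

text \<open>Over an infinite field the values of a polynomial determine its coefficients.\<close>

lemma coeff_eq_of_peval:
  fixes h :: "'v::zero \<Rightarrow> 'k::field_char_0"
  assumes "h 0 = 0" "\<And>a. peval h a y = peval h a z"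
  shows "h (coeff y n) = h (coeff z n)"
proof -
  have "map_poly h y = map_poly h z"
    using assms by (subst poly_eq_poly_eq_iff[symmetric]) (auto simp: peval_poly)
  then have "coeff (map_poly h y) n = coeff (map_poly h z) n" by simp
  then show ?thesis by (simp add: coeff_map_poly assms(1))
qed

lemma peval_cong:
  "(\<And>n. h (coeff y n) = h' (coeff y n)) \<Longrightarrow> peval h a y = peval h' a y"
  by (simp add: peval_def)

lemma peval_add_fun: "peval (\<lambda>u. h u + h' u) a y = peval h a y + peval h' a y"
  by (simp add: peval_def algebra_simps sum.distrib)

lemma peval_cmult_fun: "peval (\<lambda>u. c * h u) a y = c * peval h a y"
  by (simp add: peval_def algebra_simps sum_distrib_left)

lemma peval_mult_const_fun: "peval (\<lambda>u. h u * c) a y = peval h a y * c"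
  by (simp add: peval_def algebra_simps sum_distrib_left)

lemma peval_map_poly:
  assumes "E 0 = 0" "h 0 = (0::'k::comm_ring_1)"
  shows "peval h a (map_poly E y) = peval (\<lambda>u. h (E u)) a y"
  using peval_superset[of h "map_poly E y" "Polynomial.degree y" a] assms
  by (simp add: map_poly_degree_leq coeff_map_poly peval_def)

lemma peval_0 [simp]: "h 0 = (0::'k::comm_ring_1) \<Longrightarrow> peval h a 0 = 0"
  by (simp add: peval_def)

lemma coeff_0_const_eval: "h 0 = 0 \<Longrightarrow> peval h (0::'k::comm_ring_1) y = h (coeff y 0)"
  by (simp add: peval_poly poly_0_coeff_0 coeff_map_poly)

lemma additive_on_peval:
  fixes h :: "'v::ab_group_add \<Rightarrow> 'k::field"
  assumes h: "additive_on S h"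
  shows "additive_on (poly_over S) (peval h a)"
  unfolding additive_on_def
proof (intro conjI ballI)
  show "0 \<in> poly_over S" using h by (simp add: poly_over_def additive_on_def)
next
  fix s t assume st: "s \<in> poly_over S" "t \<in> poly_over S"
  then show "s + t \<in> poly_over S" using h by (simp add: poly_over_def additive_on_def)
  let ?N = "max (Polynomial.degree s) (Polynomial.degree t)"
  have h0: "h 0 = 0" by (rule additive_on_zero[OF h])
  have "Polynomial.degree (s + t) \<le> ?N" by (rule degree_add_le_max)
  then show "peval h a (s + t) = peval h a s + peval h a t"
    using peval_superset[of h "s + t" ?N a, OF h0] peval_superset[of h s ?N a, OF h0]
      peval_superset[of h t ?N a, OF h0] st h
    by (simp add: additive_on_def poly_over_def sum.distrib algebra_simps)
qed

lemma additive_on_diff: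
  fixes \<Phi> :: "'a::ab_group_add \<Rightarrow> 'b::ab_group_add"
  assumes "additive_on S \<Phi>" "s - t \<in> S" "t \<in> S"
  shows "\<Phi> (s - t) = \<Phi> s - \<Phi> t"
proof -
  have "\<Phi> (s - t + t) = \<Phi> (s - t) + \<Phi> t" using assms unfolding additive_on_def by blast
  then show ?thesis by simp
qed

lemma peval_lam1:
  fixes h :: "'v::ab_group_add \<Rightarrow> 'k::field"
  assumes "h 0 = 0" shows "peval h a (lam1 y) = a * peval h a y"
  using assms by (simp add: peval_poly lam1_def map_poly_pCons)

lemma lam1_poly_over: "0 \<in> S \<Longrightarrow> y \<in> poly_over S \<Longrightarrow> lam1 y \<in> poly_over S"
  by (auto simp: poly_over_def lam1_def coeff_pCons split: nat.split)

lemma const1_poly_over: "0 \<in> S \<Longrightarrow> v \<in> S \<Longrightarrow> const1 v \<in> poly_over S"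
  by (auto simp: poly_over_def const1_def coeff_pCons split: nat.split)

lemma peval_const1: "peval h a (const1 v) = h v"
  by (simp add: peval_def const1_def)


section \<open>Modules over the polynomial ring and their point functionals\<close>

lemma kd_moduleD:
  assumes "kd_module V"
  shows "0 \<in> carr V" "\<And>u v. u \<in> carr V \<Longrightarrow> v \<in> carr V \<Longrightarrow> u + v \<in> carr V"
    "\<And>u p. u \<in> carr V \<Longrightarrow> scal V p u \<in> carr V"
    "\<And>p u v. scal V p (u + v) = scal V p u + scal V p v"
    "\<And>p q u. scal V (p + q) u = scal V p u + scal V q u"
    "\<And>p q u. scal V p (scal V q u) = scal V (p * q) u"
    "\<And>u. scal V 1 u = u" "\<And>p. scal V p 0 = 0" "\<And>u. scal V 0 u = 0"
    "\<And>p u. scal V (- p) u = - scal V p u"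
    "\<And>p u. scal V p (- u) = - scal V p u"
    "\<And>u. u \<in> carr V \<Longrightarrow> - u \<in> carr V"
    "\<And>u v. u \<in> carr V \<Longrightarrow> v \<in> carr V \<Longrightarrow> u - v \<in> carr V"
    "\<And>u. u \<in> carr V \<Longrightarrow> del V u \<in> carr V"
    "\<And>u c. u \<in> carr V \<Longrightarrow> kscal V c u \<in> carr V"
    "del V 0 = 0" "\<And>c. kscal V c 0 = 0"
proof -
  interpret m: module "scal V" using assms by (simp add: kd_module_def)
  have s: "m.subspace (carr V)" using assms by (simp add: kd_module_def)
  show "0 \<in> carr V" "\<And>u v. u \<in> carr V \<Longrightarrow> v \<in> carr V \<Longrightarrow> u + v \<in> carr V"
    "\<And>u p. u \<in> carr V \<Longrightarrow> scal V p u \<in> carr V"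
    "\<And>p u v. scal V p (u + v) = scal V p u + scal V p v"
    "\<And>p q u. scal V (p + q) u = scal V p u + scal V q u"
    "\<And>p q u. scal V p (scal V q u) = scal V (p * q) u"
    "\<And>u. scal V 1 u = u" "\<And>p. scal V p 0 = 0" "\<And>u. scal V 0 u = 0"
    "\<And>p u. scal V (- p) u = - scal V p u"
    "\<And>p u. scal V p (- u) = - scal V p u"
    "\<And>u. u \<in> carr V \<Longrightarrow> - u \<in> carr V"
    "\<And>u v. u \<in> carr V \<Longrightarrow> v \<in> carr V \<Longrightarrow> u - v \<in> carr V"
    "\<And>u. u \<in> carr V \<Longrightarrow> del V u \<in> carr V"
    "\<And>u c. u \<in> carr V \<Longrightarrow> kscal V c u \<in> carr V"
    "del V 0 = 0" "\<And>c. kscal V c 0 = 0"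
    using s by (auto simp: m.subspace_0 m.subspace_add m.subspace_scale m.scale_right_distrib
        m.scale_left_distrib m.subspace_neg m.subspace_diff del_def kscal_def)
qed

lemma scal_pCons:
  assumes "kd_module V"
  shows "scal V (pCons c p) u = kscal V c u + del V (scal V p u)"
proof -
  have "pCons c p = [:c:] + [:0, 1:] * p" by simp
  then show ?thesis using kd_moduleD[OF assms] unfolding kscal_def del_def by metis
qed

lemma point_functionalI:
  assumes V: "kd_module V"
    and add: "\<And>u u'. u \<in> carr V \<Longrightarrow> u' \<in> carr V \<Longrightarrow> h (u + u') = h u + h u'"
    and ks: "\<And>c u. u \<in> carr V \<Longrightarrow> h (kscal V c u) = c * h u"
    and dl: "\<And>u. u \<in> carr V \<Longrightarrow> h (del V u) = w * h u"
  shows "point_functional V w h"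
proof -
  note D = kd_moduleD[OF V]
  have h0: "h 0 = 0" using ks[of 0 0] D(1,17) by simp
  have "h (scal V p u) = poly p w * h u" if "u \<in> carr V" for p u
  proof (induction p)
    case 0 then show ?case using h0 D by simp
  next
    case (pCons c p)
    have "scal V p u \<in> carr V" using D that by blast
    then have "h (scal V (pCons c p) u) = h (kscal V c u) + h (del V (scal V p u))"
      using D that add by (simp add: scal_pCons[OF V])
    then show ?case using pCons ks[OF that] dl[OF \<open>scal V p u \<in> carr V\<close>]
      by (simp add: algebra_simps)
  qed
  then show ?thesis using add by (simp add: point_functional_def)
qed

lemma point_functionalD:
  assumes "point_functional V w h"
  shows "\<And>u u'. u \<in> carr V \<Longrightarrow> u' \<in> carr V \<Longrightarrow> h (u + u') = h u + h u'"
    "\<And>c u. u \<in> carr V \<Longrightarrow> h (kscal V c u) = c * h u"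
    "\<And>u. u \<in> carr V \<Longrightarrow> h (del V u) = w * h u"
    "\<And>p u. u \<in> carr V \<Longrightarrow> h (scal V p u) = poly p w * h u"
  using assms by (auto simp: point_functional_def kscal_def del_def)

lemma additive_on_point_functional:
  "kd_module V \<Longrightarrow> point_functional V w h \<Longrightarrow> additive_on (carr V) h"
  by (auto simp: additive_on_def point_functional_def kd_moduleD)

lemma point_functional_0:
  "kd_module V \<Longrightarrow> point_functional V w h \<Longrightarrow> h 0 = 0"
  using additive_on_point_functional additive_on_zero by blast

lemma peval_del1:
  assumes V: "kd_module V" and h: "point_functional V w h" and y: "y \<in> poly_over (carr V)"
  shows "peval h a (del1 V y) = w * peval h a y"
proof -
  have "peval h a (del1 V y) = peval (\<lambda>u. h (del V u)) a y"
    unfolding del1_def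
    by (rule peval_map_poly) (use kd_moduleD[OF V] point_functional_0[OF V h] in auto)
  also have "\<dots> = peval (\<lambda>u. w * h u) a y"
    by (rule peval_cong) (use point_functionalD(3)[OF h] y in \<open>auto simp: poly_over_def\<close>)
  finally show ?thesis by (simp add: peval_cmult_fun)
qed

lemma peval_kscal:
  assumes V: "kd_module V" and h: "point_functional V w h" and y: "y \<in> poly_over (carr V)"
  shows "peval h a (map_poly (kscal V c) y) = c * peval h a y"
proof -
  have "peval h a (map_poly (kscal V c) y) = peval (\<lambda>u. h (kscal V c u)) a y"
    by (rule peval_map_poly) (use kd_moduleD[OF V] point_functional_0[OF V h] in auto)
  also have "\<dots> = peval (\<lambda>u. c * h u) a y"
    by (rule peval_cong) (use point_functionalD(2)[OF h] y in \<open>auto simp: poly_over_def\<close>)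
  finally show ?thesis by (simp add: peval_cmult_fun)
qed

lemma map_poly_poly_over:
  "f 0 = 0 \<Longrightarrow> (\<And>u. u \<in> S \<Longrightarrow> f u \<in> S') \<Longrightarrow> y \<in> poly_over S \<Longrightarrow> map_poly f y \<in> poly_over S'"
  by (auto simp: poly_over_def coeff_map_poly)

lemma poly_over_add:
  "kd_module V \<Longrightarrow> y \<in> poly_over (carr V) \<Longrightarrow> z \<in> poly_over (carr V) \<Longrightarrow> y + z \<in> poly_over (carr V)"
  by (auto simp: poly_over_def kd_moduleD)

lemma poly_over_minus:
  "kd_module V \<Longrightarrow> y \<in> poly_over (carr V) \<Longrightarrow> - y \<in> poly_over (carr V)"
  by (auto simp: poly_over_def kd_moduleD)

lemma poly_over_diff:
  "kd_module V \<Longrightarrow> y \<in> poly_over (carr V) \<Longrightarrow> z \<in> poly_over (carr V) \<Longrightarrow> y - z \<in> poly_over (carr V)"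
  by (auto simp: poly_over_def kd_moduleD)

lemma del1_poly_over:
  "kd_module V \<Longrightarrow> y \<in> poly_over (carr V) \<Longrightarrow> del1 V y \<in> poly_over (carr V)"
  unfolding del1_def by (rule map_poly_poly_over) (auto simp: kd_moduleD)

lemma peval_minus:
  assumes V: "kd_module V" and h: "point_functional V w h" and y: "y \<in> poly_over (carr V)"
  shows "peval h a (- y) = - peval h a y"
  using additive_on_diff[OF additive_on_peval[OF additive_on_point_functional[OF V h]], of 0 y a]
    y poly_over_minus[OF V y] point_functional_0[OF V h] by simp

lemma peval_add:
  assumes "kd_module V" "point_functional V w h" "y \<in> poly_over (carr V)" "z \<in> poly_over (carr V)"
  shows "peval h a (y + z) = peval h a y + peval h a z"
  using additive_on_peval[OF additive_on_point_functional[OF assms(1,2)], of a] assms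
  by (simp add: additive_on_def)

text \<open>A point functional of weight \<open>w\<close> makes \<open>\<partial>\<close> the scalar \<open>w\<close>, and evaluation makes \<open>\<lambda>\<close> the scalar
  \<open>a\<close>; this evaluates the substitution \<open>\<lambda> \<mapsto> -\<lambda>-\<partial>\<close>.\<close>

lemma eigen_flip:
  assumes V: "kd_module V" and h: "point_functional V w h"
  shows "eigen_on (poly_over (carr V)) (- lam1 - del1 V) (- a - w) (peval h a)"
  unfolding eigen_on_def
proof (intro conjI ballI)
  note po = poly_over_diff[OF V] poly_over_minus[OF V] del1_poly_over[OF V]
    lam1_poly_over[OF kd_moduleD(1)[OF V]]
  show add: "additive_on (poly_over (carr V)) (peval h a)"
    by (rule additive_on_peval[OF additive_on_point_functional[OF V h]])
  fix s assume s: "s \<in> poly_over (carr V)"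
  show "(- lam1 - del1 V) s \<in> poly_over (carr V)" using po s by simp
  have "peval h a (- lam1 s - del1 V s) = peval h a (- lam1 s) - peval h a (del1 V s)"
    by (rule additive_on_diff[OF add]) (use po s in auto)
  then show "peval h a ((- lam1 - del1 V) s) = (- a - w) * peval h a s"
    using s po by (simp add: peval_minus[OF V h] peval_lam1 point_functional_0[OF V h]
        peval_del1[OF V h] algebra_simps)
qed

lemma peval_subst_flip:
  assumes V: "kd_module V" and h: "point_functional V w h" and y: "y \<in> poly_over (carr V)"
  shows "subst_op (- lam1 - del1 V) const1 y \<in> poly_over (carr V)"
    and "peval h a (subst_op (- lam1 - del1 V) const1 y) = peval h (- a - w) y"
proof -
  note X = eigen_flip[OF V h, of a]
  have E: "\<forall>n. const1 (coeff y n) \<in> poly_over (carr V)"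
    using const1_poly_over y kd_moduleD(1)[OF V] by (auto simp: poly_over_def)
  show "subst_op (- lam1 - del1 V) const1 y \<in> poly_over (carr V)"
    by (rule subst_op_eval(1)[OF X E])
  show "peval h a (subst_op (- lam1 - del1 V) const1 y) = peval h (- a - w) y"
    using subst_op_eval(2)[OF X E] by (simp add: peval_const1)
qed


section \<open>Formal linear combinations\<close>

lemma lookup_fscal [simp]: "Poly_Mapping.lookup (fscal c t) p = c * Poly_Mapping.lookup t p"
  by (simp add: fscal_def Poly_Mapping.map.rep_eq when_def)

interpretation formal: module "fscal :: 'k::field_char_0 \<Rightarrow> ('p \<Rightarrow>\<^sub>0 'k) \<Rightarrow> _"
  by unfold_locales (auto intro!: poly_mapping_eqI simp: lookup_add algebra_simps)

lemma keys_fscal: "Poly_Mapping.keys (fscal c t) \<subseteq> Poly_Mapping.keys t"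
  by (auto simp: in_keys_iff)

lemma keys_pure [simp]: "Poly_Mapping.keys (pure p :: 'p \<Rightarrow>\<^sub>0 'k::field_char_0) = {p}"
  by (simp add: pure_def)

lemma module_times: "module ((*) :: 'k::field \<Rightarrow> 'k \<Rightarrow> 'k)"
  by unfold_locales (auto simp: algebra_simps)

context
  fixes sc :: "'k::field_char_0 \<Rightarrow> 'w::ab_group_add \<Rightarrow> 'w"
  assumes sc: "module sc"
begin

interpretation s: module sc by (rule sc)

lemma lin_ext_superset:
  "finite A \<Longrightarrow> Poly_Mapping.keys t \<subseteq> A \<Longrightarrow>
     lin_ext sc F t = (\<Sum>p\<in>A. sc (Poly_Mapping.lookup t p) (F p))"
  unfolding lin_ext_def
  by (rule sum.mono_neutral_left) (auto simp: in_keys_iff)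

lemma lin_ext_add: "lin_ext sc F (s + t) = lin_ext sc F s + lin_ext sc F t"
proof -
  let ?A = "Poly_Mapping.keys s \<union> Poly_Mapping.keys t"
  have "Poly_Mapping.keys (s + t) \<subseteq> ?A" by (rule keys_add)
  then show ?thesis
    by (simp add: lin_ext_superset[of ?A] lookup_add s.scale_left_distrib sum.distrib)
qed

lemma lin_ext_fscal: "lin_ext sc F (fscal c t) = sc c (lin_ext sc F t)"
  using keys_fscal[of c t]
  by (simp add: lin_ext_superset[of "Poly_Mapping.keys t"] s.scale_sum_right)

lemma lin_ext_pure: "lin_ext sc F (pure p) = F p"
  by (simp add: lin_ext_def pure_def)

lemma lin_ext_0: "lin_ext sc F 0 = 0"
  by (simp add: lin_ext_def)

lemma lin_ext_minus: "lin_ext sc F (- t) = - lin_ext sc F t"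
  using lin_ext_add[of F t "- t"] by (simp add: lin_ext_0 eq_neg_iff_add_eq_0 add.commute)

lemma lin_ext_diff: "lin_ext sc F (s - t) = lin_ext sc F s - lin_ext sc F t"
  using lin_ext_add[of F s "- t"] by (simp add: lin_ext_minus)

lemma lin_ext_sum: "lin_ext sc F (sum f A) = (\<Sum>i\<in>A. lin_ext sc F (f i))"
  by (induction A rule: infinite_finite_induct) (auto simp: lin_ext_0 lin_ext_add)

lemma lin_ext_span:
  assumes "t \<in> formal.span G" "\<And>g. g \<in> G \<Longrightarrow> lin_ext sc F g = 0"
  shows "lin_ext sc F t = 0"
  using assms(1)
  by (induction rule: formal.span_induct_alt)
    (auto simp: lin_ext_0 lin_ext_add lin_ext_fscal assms(2))

end

lemma lin_ext_cong:
  "(\<And>p. p \<in> Poly_Mapping.keys t \<Longrightarrow> F p = G p) \<Longrightarrow> lin_ext sc F t = lin_ext sc G t"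
  by (simp add: lin_ext_def)

lemma lin_ext_pure_id: "lin_ext fscal pure t = t"
proof (rule poly_mapping_eqI)
  fix q
  have "Poly_Mapping.lookup (lin_ext fscal pure t) q =
      (\<Sum>p\<in>Poly_Mapping.keys t. Poly_Mapping.lookup t p * (1 when p = q))"
    by (simp add: lin_ext_def lookup_sum pure_def lookup_single)
  also have "\<dots> = Poly_Mapping.lookup t q"
  proof -
    have "(\<Sum>p\<in>Poly_Mapping.keys t. Poly_Mapping.lookup t p * (1 when p = q)) =
        (\<Sum>p\<in>Poly_Mapping.keys t. if p = q then Poly_Mapping.lookup t q else 0)"
      by (rule sum.cong) (auto simp: when_def)
    then show ?thesis by (simp add: in_keys_iff)
  qed
  finally show "Poly_Mapping.lookup (lin_ext fscal pure t) q = Poly_Mapping.lookup t q" .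
qed

lemma lin_ext_add_fun:
  "lin_ext (*) (\<lambda>p. F p + G p) t = lin_ext (*) F t + lin_ext (*) G (t :: _ \<Rightarrow>\<^sub>0 'k::field_char_0)"
  by (simp add: lin_ext_def sum.distrib algebra_simps)

lemma lin_ext_diff_fun:
  "lin_ext (*) (\<lambda>p. F p - G p) t = lin_ext (*) F t - lin_ext (*) G (t :: _ \<Rightarrow>\<^sub>0 'k::field_char_0)"
  by (simp add: lin_ext_def sum_subtractf algebra_simps)

lemma lin_ext_cmult_fun:
  "lin_ext (*) (\<lambda>p. c * F p) t = c * lin_ext (*) F (t :: _ \<Rightarrow>\<^sub>0 'k::field_char_0)"
  by (simp add: lin_ext_def sum_distrib_left algebra_simps)

lemma lin_ext_hom:
  fixes \<Phi> :: "'w::ab_group_add \<Rightarrow> 'k::field_char_0"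
  assumes \<Phi>: "additive_on S \<Phi>" "\<And>c s. s \<in> S \<Longrightarrow> sc c s \<in> S \<and> \<Phi> (sc c s) = c * \<Phi> s"
    and F: "\<And>p. p \<in> Poly_Mapping.keys t \<Longrightarrow> F p \<in> S"
  shows "lin_ext sc F t \<in> S" "\<Phi> (lin_ext sc F t) = lin_ext (*) (\<lambda>p. \<Phi> (F p)) t"
proof -
  have *: "sc (Poly_Mapping.lookup t p) (F p) \<in> S"
    "\<Phi> (sc (Poly_Mapping.lookup t p) (F p)) = Poly_Mapping.lookup t p * \<Phi> (F p)"
    if "p \<in> Poly_Mapping.keys t" for p
    using \<Phi>(2)[OF F[OF that]] by auto
  note sm = additive_on_sum[OF \<Phi>(1), where A = "Poly_Mapping.keys t"
      and f = "\<lambda>p. sc (Poly_Mapping.lookup t p) (F p)", OF *(1)]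
  show "lin_ext sc F t \<in> S"
    unfolding lin_ext_def using sm by simp
  have "\<Phi> (lin_ext sc F t) = (\<Sum>p\<in>Poly_Mapping.keys t. \<Phi> (sc (Poly_Mapping.lookup t p) (F p)))"
    unfolding lin_ext_def using sm by simp
  then show "\<Phi> (lin_ext sc F t) = lin_ext (*) (\<lambda>p. \<Phi> (F p)) t"
    using *(2) by (simp add: lin_ext_def)
qed

lemma lin_ext_lin_ext:
  "lin_ext (*) \<theta> (lin_ext fscal F t) =
     lin_ext (*) (\<lambda>p. lin_ext (*) \<theta> (F p)) (t :: _ \<Rightarrow>\<^sub>0 'k::field_char_0)"
  by (rule lin_ext_hom(2)[where S = UNIV])
    (auto simp: additive_on_def lin_ext_add[OF module_times] lin_ext_fscal[OF module_times])

definition supported :: "'p set \<Rightarrow> ('p \<Rightarrow>\<^sub>0 'k::field_char_0) set" where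
  "supported S = {t. Poly_Mapping.keys t \<subseteq> S}"

lemma tensor2_free_supported: "tensor2_free A B = supported (carr A \<times> carr B)"
  by (simp add: tensor2_free_def supported_def)

lemma tensor3_free_supported: "tensor3_free P = supported (carr P \<times> carr P \<times> carr P)"
  by (simp add: tensor3_free_def supported_def)

lemma subspace_supported:
  "formal.subspace (supported S :: ('p \<Rightarrow>\<^sub>0 'k::field_char_0) set)"
  unfolding formal.subspace_def supported_def
proof (intro conjI allI ballI)
  show "0 \<in> {t. Poly_Mapping.keys t \<subseteq> S}" by simp
  fix x y :: "'p \<Rightarrow>\<^sub>0 'k" assume x: "x \<in> {t. Poly_Mapping.keys t \<subseteq> S}"
  show "fscal c x \<in> {t. Poly_Mapping.keys t \<subseteq> S}" for c using keys_fscal[of c x] x by blast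
  assume "y \<in> {t. Poly_Mapping.keys t \<subseteq> S}"
  then show "x + y \<in> {t. Poly_Mapping.keys t \<subseteq> S}" using keys_add[of x y] x by blast
qed

lemma pure_supported [simp]: "pure p \<in> supported S \<longleftrightarrow> p \<in> S"
  by (simp add: supported_def)

lemma supported_keys: "t \<in> supported S \<Longrightarrow> p \<in> Poly_Mapping.keys t \<Longrightarrow> p \<in> S"
  by (auto simp: supported_def)

lemma lin_ext_in_subspace:
  assumes "formal.subspace N" "\<And>p. p \<in> Poly_Mapping.keys t \<Longrightarrow> F p \<in> N"
  shows "lin_ext fscal F t \<in> N"
  unfolding lin_ext_def
proof (rule formal.subspace_sum[OF assms(1)])
  show "fscal (Poly_Mapping.lookup t p) (F p) \<in> N" if "p \<in> Poly_Mapping.keys t" for p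
    by (rule formal.subspace_scale[OF assms(1) assms(2)[OF that]])
qed

lemmas supported_add = formal.subspace_add[OF subspace_supported]
  and supported_scale = formal.subspace_scale[OF subspace_supported]
  and supported_0 = formal.subspace_0[OF subspace_supported]

lemma lin_ext_supported:
  assumes "t \<in> supported S" "\<And>p. p \<in> S \<Longrightarrow> F p \<in> supported S'"
  shows "lin_ext fscal F t \<in> supported S'"
proof (rule lin_ext_in_subspace[OF subspace_supported])
  show "F p \<in> supported S'" if "p \<in> Poly_Mapping.keys t" for p
    by (rule assms(2)[OF supported_keys[OF assms(1) that]])
qed


section \<open>Free modules: coordinates and interpolation\<close>

text \<open>A basis \<open>e\<close> together with its coordinate functions \<open>x\<close>, of which only the values on the carrier matter.
  Unlike a basis as a set, this form passes directly to direct sums and duals.\<close>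

definition coordinates :: "('k::field_char_0, 'v::ab_group_add, 'z) kd_module_scheme
    \<Rightarrow> 'i set \<Rightarrow> ('i \<Rightarrow> 'v \<Rightarrow> 'k poly) \<Rightarrow> ('i \<Rightarrow> 'v) \<Rightarrow> bool" where
  "coordinates V I x e \<longleftrightarrow>
     (\<forall>i\<in>I. e i \<in> carr V) \<and>
     (\<forall>i\<in>I. \<forall>u\<in>carr V. \<forall>v\<in>carr V. x i (u + v) = x i u + x i v) \<and>
     (\<forall>i\<in>I. \<forall>p. \<forall>u\<in>carr V. x i (scal V p u) = p * x i u) \<and>
     (\<forall>i\<in>I. \<forall>j\<in>I. x i (e j) = (if i = j then 1 else 0)) \<and>
     (\<forall>u\<in>carr V. finite {i\<in>I. x i u \<noteq> 0} \<and>
        u = (\<Sum>i\<in>{i\<in>I. x i u \<noteq> 0}. scal V (x i u) (e i)))"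

lemma coordinates_of_free:
  assumes V: "kd_module V" and free: "kd_free V"
  obtains B :: "'v::ab_group_add set" and x where
    "coordinates (V :: ('k::field_char_0, 'v, 'z) kd_module_scheme) B x (\<lambda>b. b)"
    "module.span (scal V) B = carr V" "\<not> module.dependent (scal V) B"
proof -
  interpret m: module "scal V" using V by (simp add: kd_module_def)
  obtain B where B: "\<not> m.dependent B" "m.span B = carr V"
    using free by (auto simp: kd_free_def)
  have "coordinates V B (\<lambda>b u. m.representation B u b) (\<lambda>b. b)"
    unfolding coordinates_def
  proof (intro conjI ballI allI)
    fix u assume u: "u \<in> carr V"
    have *: "{b \<in> B. m.representation B u b \<noteq> 0} = {b. m.representation B u b \<noteq> 0}"
      using m.representation_ne_zero by blast
    show "finite {b \<in> B. m.representation B u b \<noteq> 0}"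
      using m.finite_representation unfolding * .
    show "u = (\<Sum>b\<in>{b \<in> B. m.representation B u b \<noteq> 0}. scal V (m.representation B u b) b)"
      using m.sum_nonzero_representation_eq[OF B(1)] u B(2) unfolding * by simp
  next
    fix b assume b: "b \<in> B"
    then show "b \<in> carr V" using B(2) m.span_base by blast
    show "m.representation B (u + v) b = m.representation B u b + m.representation B v b"
      if "u \<in> carr V" "v \<in> carr V" for u v
      using m.representation_add[OF B(1), of v u] that B(2) by simp
    show "m.representation B (scal V p u) b = p * m.representation B u b" if "u \<in> carr V" for p u
      using m.representation_scale[OF B(1), of u p] that B(2) by simp
    show "m.representation B b' b = (if b = b' then 1 else 0)" if "b' \<in> B" for b'
      using m.representation_basis[OF B(1) that] by simp
  qed
  with B that show ?thesis by blast
qed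

text \<open>Every finite generating set involves only finitely many elements of a basis, and these already
  span all others.\<close>

lemma finite_basis:
  assumes V: "kd_module V" and fin: "kd_finite V"
    and B: "module.span (scal V) B = carr V" "\<not> module.dependent (scal V) B"
  shows "finite B"
proof -
  interpret m: module "scal V" using V by (simp add: kd_module_def)
  obtain G where G: "finite G" "m.span G = carr V" using fin by (auto simp: kd_finite_def)
  define B0 where "B0 = (\<Union>g\<in>G. {b. m.representation B g b \<noteq> 0})"
  have "finite B0" unfolding B0_def using G(1) m.finite_representation by blast
  have sub: "B0 \<subseteq> B" unfolding B0_def using m.representation_ne_zero by blast
  have "g \<in> m.span B0" if g: "g \<in> G" for g
  proof -
    have "g \<in> m.span B" using g G(2) B(1) m.span_base by blast
    then have "g = (\<Sum>b\<in>{b. m.representation B g b \<noteq> 0}. scal V (m.representation B g b) b)"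
      using m.sum_nonzero_representation_eq[OF B(2)] by simp
    also have "\<dots> \<in> m.span B0"
      by (intro m.span_sum m.span_scale m.span_base) (use g in \<open>auto simp: B0_def\<close>)
    finally show ?thesis .
  qed
  then have span: "m.span B0 = carr V"
    using m.span_minimal[OF _ m.subspace_span, of G B0] m.span_mono[OF sub] G(2) B(1) by blast
  have "b \<in> B0" if b: "b \<in> B" for b
  proof (rule ccontr)
    assume "b \<notin> B0"
    have "b \<in> m.span B0" using span B(1) b m.span_base by blast
    then have "m.representation B b = m.representation B0 b"
      by (rule m.representation_extend[OF B(2) _ sub])
    then have "m.representation B0 b b \<noteq> 0"
      using m.representation_basis[OF B(2) b] by (metis zero_neq_one)
    then have "b \<in> B0" using m.representation_ne_zero by blast
    with \<open>b \<notin> B0\<close> show False by blast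
  qed
  then have "B \<subseteq> B0" by blast
  then show ?thesis using \<open>finite B0\<close> by (rule finite_subset)
qed

lemma coordinates_point_functional:
  assumes "kd_module V" "coordinates V I x e" "i \<in> I"
  shows "point_functional V w (\<lambda>u. poly (x i u) w)"
  using assms by (simp add: coordinates_def point_functional_def)

lemma coordinates_superset:
  assumes V: "kd_module V" and C: "coordinates V I x e" and u: "u \<in> carr V"
    and J: "finite J" "J \<subseteq> I" "{i\<in>I. x i u \<noteq> 0} \<subseteq> J"
  shows "u = (\<Sum>i\<in>J. scal V (x i u) (e i))"
proof -
  have "u = (\<Sum>i\<in>{i\<in>I. x i u \<noteq> 0}. scal V (x i u) (e i))"
    using C u unfolding coordinates_def by blast
  also have "\<dots> = (\<Sum>i\<in>J. scal V (x i u) (e i))"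
    by (rule sum.mono_neutral_left) (use J in \<open>auto simp: kd_moduleD[OF V]\<close>)
  finally show ?thesis .
qed

text \<open>The nodes \<open>0, \<dots>, N\<close> are distinct in characteristic zero, so that a polynomial of degree at most
  \<open>N\<close> which vanishes at all of them is zero.\<close>

lemma lagrange_interpolation:
  "\<exists>L :: nat \<Rightarrow> 'k::field_char_0 poly.
     \<forall>p. Polynomial.degree p \<le> N \<longrightarrow> p = (\<Sum>s\<le>N. smult (poly p (of_nat s)) (L s))"
proof -
  define W where "W s = (\<Prod>t\<in>{..N} - {s}. [:- of_nat t, 1 :: 'k:])" for s
  define L where "L s = smult (inverse (poly (W s) (of_nat s))) (W s)" for s
  have nz: "poly (W s) (of_nat s) \<noteq> 0" for s by (auto simp: W_def poly_prod)
  have val: "poly (L s) (of_nat t) = (if s = t then 1 else 0)" if "t \<le> N" for s t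
  proof (cases "s = t")
    case True
    then show ?thesis using nz[of s] by (simp add: L_def)
  next
    case False
    then have "t \<in> {..N} - {s}" using that by simp
    then have "poly (W s) (of_nat t) = 0"
      unfolding W_def poly_prod by (intro prod_zero bexI[of _ t]) simp_all
    then show ?thesis using False by (simp add: L_def)
  qed
  have deg: "Polynomial.degree (L s) \<le> N" if "s \<le> N" for s
  proof -
    have "Polynomial.degree (W s) \<le> sum (Polynomial.degree \<circ> (\<lambda>t. [:- of_nat t, 1 :: 'k:])) ({..N} - {s})"
      unfolding W_def by (rule degree_prod_sum_le) simp
    then show ?thesis using that by (simp add: L_def le_trans[OF degree_smult_le])
  qed
  have "p = (\<Sum>s\<le>N. smult (poly p (of_nat s)) (L s))" if p: "Polynomial.degree p \<le> N" for p
  proof -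
    let ?d = "p - (\<Sum>s\<le>N. smult (poly p (of_nat s)) (L s))"
    have "?d = 0"
    proof (rule ccontr)
      assume "?d \<noteq> 0"
      have "Polynomial.degree ?d \<le> N"
        by (intro degree_diff_le p degree_sum_le le_trans[OF degree_smult_le] deg) auto
      moreover have "of_nat ` {..N} \<subseteq> {a. poly ?d a = 0}"
        by (auto simp: poly_sum val sum.delta' if_distrib cong: if_cong)
      then have "card (of_nat ` {..N} :: 'k set) \<le> card {a. poly ?d a = 0}"
        by (rule card_mono[OF poly_roots_finite[OF \<open>?d \<noteq> 0\<close>]])
      then have "Suc N \<le> card {a. poly ?d a = 0}"
        by (simp add: card_image inj_on_def)
      moreover have "card {a. poly ?d a = 0} \<le> Polynomial.degree ?d"
        by (rule card_poly_roots_bound[OF \<open>?d \<noteq> 0\<close>])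
      ultimately show False by linarith
    qed
    then show ?thesis by simp
  qed
  then show ?thesis by blast
qed

text \<open>A finite set of elements is resolved by finitely many of the functionals \<open>poly (x i u) s\<close>:
  the coordinates of its elements are interpolated.\<close>

lemma interpolation:
  fixes V :: "('k::field_char_0, 'v::ab_group_add, 'z) kd_module_scheme"
  assumes V: "kd_module V" and C: "coordinates V I x e" and S: "finite S" "S \<subseteq> carr V"
  obtains A :: "('i \<times> nat) set" and b where
    "finite A" "A \<subseteq> I \<times> UNIV" "\<And>a. a \<in> A \<Longrightarrow> b a \<in> carr V"
    "\<And>u. u \<in> S \<Longrightarrow> u = (\<Sum>a\<in>A. kscal V (poly (x (fst a) u) (of_nat (snd a))) (b a))"
proof -
  note D = kd_moduleD[OF V]
  define J where "J = (\<Union>u\<in>S. {i\<in>I. x i u \<noteq> 0})"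
  have J: "finite J" "J \<subseteq> I" using S C unfolding J_def coordinates_def by blast+
  define N where "N = Max (insert 0 ((\<lambda>(u, i). Polynomial.degree (x i u)) ` (S \<times> J)))"
  have N: "Polynomial.degree (x i u) \<le> N" if "u \<in> S" "i \<in> J" for u i
    unfolding N_def by (rule Max_ge) (use that S J in auto)
  obtain L :: "nat \<Rightarrow> 'k poly" where
    L: "\<And>p. Polynomial.degree p \<le> N \<Longrightarrow> p = (\<Sum>s\<le>N. smult (poly p (of_nat s)) (L s))"
    using lagrange_interpolation[of N] by blast
  have e: "e i \<in> carr V" if "i \<in> J" for i using C J(2) that unfolding coordinates_def by blast
  show ?thesis
  proof (rule that[of "J \<times> {..N}" "\<lambda>(i, s). scal V (L s) (e i)"])
    show "finite (J \<times> {..N})" "J \<times> {..N} \<subseteq> I \<times> UNIV" using J by auto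
    show "(case a of (i, s) \<Rightarrow> scal V (L s) (e i)) \<in> carr V" if "a \<in> J \<times> {..N}" for a
      using that D(3) e by auto
    fix u assume u: "u \<in> S"
    interpret m: module "scal V" using V by (simp add: kd_module_def)
    have "u = (\<Sum>i\<in>J. scal V (x i u) (e i))"
      by (rule coordinates_superset[OF V C]) (use u S J in \<open>auto simp: J_def\<close>)
    also have "\<dots> = (\<Sum>i\<in>J. scal V (\<Sum>s\<le>N. smult (poly (x i u) (of_nat s)) (L s)) (e i))"
      by (intro sum.cong refl arg_cong2[where f = "scal V"] L N u)
    also have "\<dots> = (\<Sum>i\<in>J. \<Sum>s\<le>N. kscal V (poly (x i u) (of_nat s)) (scal V (L s) (e i)))"
      by (simp add: m.scale_sum_left kscal_def)
    also have "\<dots> = (\<Sum>a\<in>J \<times> {..N}. kscal V (poly (x (fst a) u) (of_nat (snd a)))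
        (case a of (i, s) \<Rightarrow> scal V (L s) (e i)))"
      by (simp add: sum.cartesian_product case_prod_unfold)
    finally show "u = (\<Sum>a\<in>J \<times> {..N}. kscal V (poly (x (fst a) u) (of_nat (snd a)))
        (case a of (i, s) \<Rightarrow> scal V (L s) (e i)))" .
  qed
qed

lemma point_functionals_separate:
  assumes V: "kd_module V" and C: "coordinates V I x e" and uv: "u \<in> carr V" "v \<in> carr V"
    and eq: "\<And>w h. point_functional V w h \<Longrightarrow> h u = h v"
  shows "u = v"
proof -
  have x: "x i u = x i v" if "i \<in> I" for i
    using eq[OF coordinates_point_functional[OF V C that]]
    by (subst poly_eq_poly_eq_iff[symmetric]) (auto simp: fun_eq_iff)
  have fin: "finite {i\<in>I. x i v \<noteq> 0}" using C uv by (simp add: coordinates_def)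
  have "u = (\<Sum>i\<in>{i\<in>I. x i v \<noteq> 0}. scal V (x i u) (e i))"
    by (rule coordinates_superset[OF V C uv(1) fin]) (use x in auto)
  also have "\<dots> = (\<Sum>i\<in>{i\<in>I. x i v \<noteq> 0}. scal V (x i v) (e i))"
    by (rule sum.cong) (use x in auto)
  also have "\<dots> = v"
    by (rule coordinates_superset[OF V C uv(2) fin, symmetric]) auto
  finally show ?thesis .
qed


section \<open>Separating tensors by point functionals\<close>

lemmas formal_eval_simps = lin_ext_add[OF module_times] lin_ext_diff[OF module_times]
  lin_ext_fscal[OF module_times] lin_ext_pure[OF module_times] lin_ext_0[OF module_times]
  lin_ext_minus[OF module_times] lin_ext_sum[OF module_times]

definition eval2 :: "('a \<Rightarrow> 'k::field_char_0) \<Rightarrow> ('b \<Rightarrow> 'k) \<Rightarrow> ('a \<times> 'b \<Rightarrow>\<^sub>0 'k) \<Rightarrow> 'k" where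
  "eval2 f g = lin_ext (*) (\<lambda>(a, b). f a * g b)"

definition eval3 :: "('a \<Rightarrow> 'k::field_char_0) \<Rightarrow> ('b \<Rightarrow> 'k) \<Rightarrow> ('c \<Rightarrow> 'k)
    \<Rightarrow> ('a \<times> 'b \<times> 'c \<Rightarrow>\<^sub>0 'k) \<Rightarrow> 'k" where
  "eval3 f g h = lin_ext (*) (\<lambda>(a, b, c). f a * g b * h c)"

lemma eval2_simps [simp]:
  "eval2 f g (s + t) = eval2 f g s + eval2 f g t" "eval2 f g (s - t) = eval2 f g s - eval2 f g t"
  "eval2 f g (fscal c t) = c * eval2 f g t" "eval2 f g (pure (a, b)) = f a * g b" "eval2 f g 0 = 0"
  "eval2 f g (- t) = - eval2 f g t"
  by (simp_all add: eval2_def formal_eval_simps)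

lemma eval2_sum: "eval2 f g (sum F A) = (\<Sum>i\<in>A. eval2 f g (F i))"
  by (simp add: eval2_def formal_eval_simps)

lemma eval3_simps [simp]:
  "eval3 f g h (s + t) = eval3 f g h s + eval3 f g h t"
  "eval3 f g h (s - t) = eval3 f g h s - eval3 f g h t"
  "eval3 f g h (fscal c t) = c * eval3 f g h t"
  "eval3 f g h (pure (a, b, d)) = f a * g b * h d" "eval3 f g h 0 = 0"
  "eval3 f g h (- t) = - eval3 f g h t"
  by (simp_all add: eval3_def formal_eval_simps)

text \<open>The null spaces are spanned by relations on which every product of linear functionals
  vanishes.\<close>

lemma lin_ext_null2:
  assumes t: "t \<in> tensor2_null A B"
    and add1: "\<And>a a' b. a \<in> carr A \<Longrightarrow> a' \<in> carr A \<Longrightarrow> b \<in> carr B \<Longrightarrow> F (a + a', b) = F (a, b) + F (a', b)"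
    and add2: "\<And>a b b'. a \<in> carr A \<Longrightarrow> b \<in> carr B \<Longrightarrow> b' \<in> carr B \<Longrightarrow> F (a, b + b') = F (a, b) + F (a, b')"
    and sc1: "\<And>c a b. a \<in> carr A \<Longrightarrow> b \<in> carr B \<Longrightarrow> F (kscal A c a, b) = c * F (a, b)"
    and sc2: "\<And>c a b. a \<in> carr A \<Longrightarrow> b \<in> carr B \<Longrightarrow> F (a, kscal B c b) = c * F (a, b)"
  shows "lin_ext (*) F t = (0 :: 'k::field_char_0)"
  using t unfolding tensor2_null_def
  by (rule lin_ext_span[OF module_times]) (auto simp: formal_eval_simps add1 add2 sc1 sc2)

lemma eval2_null:
  assumes f: "point_functional A v f" and g: "point_functional B w g" and t: "t \<in> tensor2_null A B"
  shows "eval2 f g t = 0"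
  unfolding eval2_def
  by (rule lin_ext_null2[OF t])
    (auto simp: point_functionalD[OF f] point_functionalD[OF g] algebra_simps)

lemma eval3_null:
  assumes f: "point_functional P u f" and g: "point_functional P v g"
    and h: "point_functional P w h" and t: "t \<in> tensor3_null P"
  shows "eval3 f g h t = 0"
  unfolding eval3_def
  by (rule lin_ext_span[OF module_times t[unfolded tensor3_null_def]])
    (auto simp: formal_eval_simps point_functionalD[OF f] point_functionalD[OF g]
      point_functionalD[OF h] distrib_left distrib_right mult_ac)

lemma subspace_null2: "formal.subspace (tensor2_null A B)"
  unfolding tensor2_null_def by (rule formal.subspace_span)

lemma subspace_null3: "formal.subspace (tensor3_null P)"
  unfolding tensor3_null_def by (rule formal.subspace_span)

lemma subspace_free2: "formal.subspace (tensor2_free A B)"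
  unfolding tensor2_free_supported by (rule subspace_supported)

lemma subspace_free3: "formal.subspace (tensor3_free P)"
  unfolding tensor3_free_supported by (rule subspace_supported)

lemma tensor2_null_gens:
  "a \<in> carr A \<Longrightarrow> a' \<in> carr A \<Longrightarrow> b \<in> carr B \<Longrightarrow>
     pure (a + a', b) - pure (a, b) - pure (a', b) \<in> tensor2_null A B"
  "a \<in> carr A \<Longrightarrow> b \<in> carr B \<Longrightarrow> b' \<in> carr B \<Longrightarrow>
     pure (a, b + b') - pure (a, b) - pure (a, b') \<in> tensor2_null A B"
  "a \<in> carr A \<Longrightarrow> b \<in> carr B \<Longrightarrow> pure (kscal A c a, b) - fscal c (pure (a, b)) \<in> tensor2_null A B"
  "a \<in> carr A \<Longrightarrow> b \<in> carr B \<Longrightarrow> pure (a, kscal B c b) - fscal c (pure (a, b)) \<in> tensor2_null A B"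
  by (simp_all only: tensor2_null_def) (rule formal.span_base, blast)+

lemma tensor3_null_gens:
  "a \<in> carr P \<Longrightarrow> a' \<in> carr P \<Longrightarrow> b \<in> carr P \<Longrightarrow> c \<in> carr P \<Longrightarrow>
     pure (a + a', b, c) - pure (a, b, c) - pure (a', b, c) \<in> tensor3_null P"
  "a \<in> carr P \<Longrightarrow> b \<in> carr P \<Longrightarrow> b' \<in> carr P \<Longrightarrow> c \<in> carr P \<Longrightarrow>
     pure (a, b + b', c) - pure (a, b, c) - pure (a, b', c) \<in> tensor3_null P"
  "a \<in> carr P \<Longrightarrow> b \<in> carr P \<Longrightarrow> c \<in> carr P \<Longrightarrow> c' \<in> carr P \<Longrightarrow>
     pure (a, b, c + c') - pure (a, b, c) - pure (a, b, c') \<in> tensor3_null P"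
  "a \<in> carr P \<Longrightarrow> b \<in> carr P \<Longrightarrow> c \<in> carr P \<Longrightarrow>
     pure (kscal P k a, b, c) - fscal k (pure (a, b, c)) \<in> tensor3_null P"
  "a \<in> carr P \<Longrightarrow> b \<in> carr P \<Longrightarrow> c \<in> carr P \<Longrightarrow>
     pure (a, kscal P k b, c) - fscal k (pure (a, b, c)) \<in> tensor3_null P"
  "a \<in> carr P \<Longrightarrow> b \<in> carr P \<Longrightarrow> c \<in> carr P \<Longrightarrow>
     pure (a, b, kscal P k c) - fscal k (pure (a, b, c)) \<in> tensor3_null P"
  by (simp_all only: tensor3_null_def) (rule formal.span_base, fast)+

text \<open>A map that is linear modulo \<open>N\<close> preserves linear combinations modulo \<open>N\<close>; it is used for one factor of
  a pure tensor at a time.\<close>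

lemma expand_mod:
  assumes N: "formal.subspace N" and V: "kd_module V"
    and add: "\<And>u v. u \<in> carr V \<Longrightarrow> v \<in> carr V \<Longrightarrow> g (u + v) - g u - g v \<in> N"
    and sc: "\<And>c u. u \<in> carr V \<Longrightarrow> g (kscal V c u) - fscal c (g u) \<in> N"
    and A: "finite A" "\<And>a. a \<in> A \<Longrightarrow> b a \<in> carr V"
  shows "g (\<Sum>a\<in>A. kscal V (c a) (b a)) - (\<Sum>a\<in>A. fscal (c a) (g (b a))) \<in> N"
  using A
proof (induction A)
  case empty
  show ?case using sc[of 0 0] kd_moduleD[OF V] by simp
next
  case (insert a A)
  note D = kd_moduleD[OF V]
  interpret m: module "scal V" using V by (simp add: kd_module_def)
  let ?s = "\<Sum>a\<in>A. kscal V (c a) (b a)" and ?t = "\<Sum>a\<in>A. fscal (c a) (g (b a))"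
  have s: "?s \<in> carr V"
    using V insert by (intro m.subspace_sum) (auto simp: kd_module_def D)
  have k: "kscal V (c a) (b a) \<in> carr V" using insert D by simp
  have "(g (kscal V (c a) (b a) + ?s) - g (kscal V (c a) (b a)) - g ?s)
      + (g (kscal V (c a) (b a)) - fscal (c a) (g (b a))) + (g ?s - ?t) \<in> N"
    by (intro formal.subspace_add[OF N] add sc k s insert) (use insert in auto)
  then show ?case using insert by (simp add: algebra_simps)
qed

text \<open>If \<open>pure p\<close> is congruent to \<open>\<Sum>\<^sub>k \<theta>\<^sub>k(p) X\<^sub>k\<close> with finitely many fixed \<open>X\<^sub>k\<close>, then \<open>u\<close> is congruent to
  \<open>\<Sum>\<^sub>k \<theta>\<^sub>k(u) X\<^sub>k\<close>, and only the vanishing of the scalars \<open>\<theta>\<^sub>k(u)\<close> matters.\<close>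

lemma mem_of_resolution:
  assumes N: "formal.subspace N"
    and res: "\<And>p. p \<in> Poly_Mapping.keys u \<Longrightarrow> pure p - (\<Sum>k\<in>K. fscal (\<theta> k p) (X k)) \<in> N"
    and 0: "\<And>k. k \<in> K \<Longrightarrow> lin_ext (*) (\<theta> k) u = 0"
  shows "u \<in> N"
proof -
  have "lin_ext fscal (\<lambda>p. pure p - (\<Sum>k\<in>K. fscal (\<theta> k p) (X k))) u \<in> N"
    by (rule lin_ext_in_subspace[OF N res])
  moreover have "lin_ext fscal (\<lambda>p. pure p - (\<Sum>k\<in>K. fscal (\<theta> k p) (X k))) u =
      lin_ext fscal pure u - (\<Sum>k\<in>K. fscal (lin_ext (*) (\<theta> k) u) (X k))"
  proof -
    have "(\<Sum>k\<in>K. fscal (lin_ext (*) (\<theta> k) u) (X k)) =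
        (\<Sum>p\<in>Poly_Mapping.keys u. \<Sum>k\<in>K. fscal (Poly_Mapping.lookup u p * \<theta> k p) (X k))"
      unfolding lin_ext_def formal.scale_sum_left by (rule sum.swap)
    then show ?thesis
      by (simp add: lin_ext_def formal.scale_right_diff_distrib sum_subtractf formal.scale_sum_right)
  qed
  ultimately show ?thesis using 0 by (simp add: lin_ext_pure_id)
qed

text \<open>The first (second) components that occur in \<open>u\<close> form a finite set, which by interpolation is resolved by finitely
  many point functionals; products of these resolve the pure tensors in \<open>u\<close>.\<close>

lemma tensor2_null_of_eval:
  assumes A: "kd_module A" "coordinates A I x e" and B: "kd_module B" "coordinates B J y f"
    and u: "u \<in> tensor2_free A B"
    and 0: "\<And>v w g h. point_functional A v g \<Longrightarrow> point_functional B w h \<Longrightarrow> eval2 g h u = 0"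
  shows "u \<in> tensor2_null A B"
proof -
  note N = subspace_null2[of A B]
  have keys: "p \<in> Poly_Mapping.keys u \<Longrightarrow> fst p \<in> carr A \<and> snd p \<in> carr B" for p
    using u by (auto simp: tensor2_free_def)
  obtain K b where K: "finite K" "K \<subseteq> I \<times> (UNIV :: nat set)" "\<And>k. k \<in> K \<Longrightarrow> b k \<in> carr A"
    "\<And>p. p \<in> fst ` Poly_Mapping.keys u \<Longrightarrow>
       p = (\<Sum>k\<in>K. kscal A (poly (x (fst k) p) (of_nat (snd k))) (b k))"
    by (rule interpolation[OF A, of "fst ` Poly_Mapping.keys u"]) (use keys in auto)
  obtain L c where L: "finite L" "L \<subseteq> J \<times> (UNIV :: nat set)" "\<And>k. k \<in> L \<Longrightarrow> c k \<in> carr B"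
    "\<And>p. p \<in> snd ` Poly_Mapping.keys u \<Longrightarrow>
       p = (\<Sum>k\<in>L. kscal B (poly (y (fst k) p) (of_nat (snd k))) (c k))"
    by (rule interpolation[OF B, of "snd ` Poly_Mapping.keys u"]) (use keys in auto)
  let ?g = "\<lambda>k a. poly (x (fst k) a) (of_nat (snd k))"
  let ?h = "\<lambda>l b. poly (y (fst l) b) (of_nat (snd l))"
  show ?thesis
  proof (rule mem_of_resolution[OF N, where K = "K \<times> L" and X = "\<lambda>(k, l). pure (b k, c l)"
        and \<theta> = "\<lambda>(k, l) (a, b). ?g k a * ?h l b"])
    show "lin_ext (*) (case kl of (k, l) \<Rightarrow> \<lambda>(a, b). ?g k a * ?h l b) u = 0"
      if "kl \<in> K \<times> L" for kl
    proof -
      obtain k l where kl: "kl = (k, l)" "k \<in> K" "l \<in> L" using \<open>kl \<in> K \<times> L\<close> by blast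
      then have "fst k \<in> I" "fst l \<in> J" using K(2) L(2) by auto
      then show ?thesis
        using 0[OF coordinates_point_functional[OF A] coordinates_point_functional[OF B]]
        unfolding eval2_def kl by simp
    qed
  next
    fix p assume p: "p \<in> Poly_Mapping.keys u"
    obtain a a' where p_eq: "p = (a, a')" by fastforce
    have mem: "a \<in> carr A" "a' \<in> carr B" using keys[OF p] p_eq by auto
    have a: "a = (\<Sum>k\<in>K. kscal A (?g k a) (b k))" by (rule K(4)) (use p p_eq in force)
    have a': "a' = (\<Sum>l\<in>L. kscal B (?h l a') (c l))" by (rule L(4)) (use p p_eq in force)
    have 1: "pure (\<Sum>k\<in>K. kscal A (?g k a) (b k), a') - (\<Sum>k\<in>K. fscal (?g k a) (pure (b k, a')))
        \<in> tensor2_null A B"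
      by (rule expand_mod[OF N A(1), where g = "\<lambda>a. pure (a, a')"])
        (auto simp: mem K intro: tensor2_null_gens)
    have 2: "pure (b k, \<Sum>l\<in>L. kscal B (?h l a') (c l)) - (\<Sum>l\<in>L. fscal (?h l a') (pure (b k, c l)))
        \<in> tensor2_null A B" if "k \<in> K" for k
      by (rule expand_mod[OF N B(1), where g = "\<lambda>a'. pure (b k, a')"])
        (auto simp: mem that K L intro: tensor2_null_gens)
    have "(pure (a, a') - (\<Sum>k\<in>K. fscal (?g k a) (pure (b k, a')))) +
        (\<Sum>k\<in>K. fscal (?g k a) (pure (b k, a') - (\<Sum>l\<in>L. fscal (?h l a') (pure (b k, c l)))))
        \<in> tensor2_null A B"
      by (intro formal.subspace_add[OF N] formal.subspace_sum[OF N] formal.subspace_scale[OF N])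
        (use 1 2 a a' in auto)
    also have "(pure (a, a') - (\<Sum>k\<in>K. fscal (?g k a) (pure (b k, a')))) +
        (\<Sum>k\<in>K. fscal (?g k a) (pure (b k, a') - (\<Sum>l\<in>L. fscal (?h l a') (pure (b k, c l))))) =
        pure (a, a') - (\<Sum>k\<in>K. \<Sum>l\<in>L. fscal (?g k a * ?h l a') (pure (b k, c l)))"
      by (simp add: formal.scale_right_diff_distrib sum_subtractf formal.scale_sum_right)
    finally show "pure p - (\<Sum>kl\<in>K \<times> L. fscal ((case kl of (k, l) \<Rightarrow> \<lambda>(a, b). ?g k a * ?h l b) p)
        (case kl of (k, l) \<Rightarrow> pure (b k, c l))) \<in> tensor2_null A B"
      by (simp add: p_eq sum.cartesian_product case_prod_unfold)
  qed
qed

text \<open>The argument is the one for two factors.  Only products of coordinate functionals are needed, and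
  the lemma on total derivatives below depends on that.\<close>

lemma tensor3_null_of_eval:
  assumes P: "kd_module P" "coordinates P I x e" and u: "u \<in> tensor3_free P"
    and 0: "\<And>i j k r s t. i \<in> I \<Longrightarrow> j \<in> I \<Longrightarrow> k \<in> I \<Longrightarrow>
       eval3 (\<lambda>a. poly (x i a) r) (\<lambda>a. poly (x j a) s) (\<lambda>a. poly (x k a) t) u = 0"
  shows "u \<in> tensor3_null P"
proof -
  note N = subspace_null3[of P]
  define S where "S = (\<Union>(a, b, c)\<in>Poly_Mapping.keys u. {a, b, c})"
  have S: "finite S" "S \<subseteq> carr P" using u by (auto simp: tensor3_free_def S_def)
  obtain K b where K: "finite K" "K \<subseteq> I \<times> (UNIV :: nat set)" "\<And>k. k \<in> K \<Longrightarrow> b k \<in> carr P"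
    "\<And>a. a \<in> S \<Longrightarrow> a = (\<Sum>k\<in>K. kscal P (poly (x (fst k) a) (of_nat (snd k))) (b k))"
    by (rule interpolation[OF P S]) auto
  let ?g = "\<lambda>k a. poly (x (fst k) a) (of_nat (snd k))"
  show ?thesis
  proof (rule mem_of_resolution[OF N, where K = "K \<times> K \<times> K"
        and X = "\<lambda>(k, l, m). pure (b k, b l, b m)"
        and \<theta> = "\<lambda>(k, l, m) (a, a', a''). ?g k a * ?g l a' * ?g m a''"])
    show "lin_ext (*) (case q of (k, l, m) \<Rightarrow> \<lambda>(a, a', a''). ?g k a * ?g l a' * ?g m a'') u = 0"
      if "q \<in> K \<times> K \<times> K" for q
    proof -
      obtain k l m where q: "q = (k, l, m)" "k \<in> K" "l \<in> K" "m \<in> K"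
        using \<open>q \<in> K \<times> K \<times> K\<close> by blast
      then have "fst k \<in> I" "fst l \<in> I" "fst m \<in> I" using K(2) by auto
      then show ?thesis using 0 unfolding eval3_def q by simp
    qed
  next
    fix p assume p: "p \<in> Poly_Mapping.keys u"
    obtain a a' a'' where p_eq: "p = (a, a', a'')" by (cases p)
    have aS: "a \<in> S" "a' \<in> S" "a'' \<in> S" using p p_eq unfolding S_def by force+
    have mem: "a \<in> carr P" "a' \<in> carr P" "a'' \<in> carr P" using aS S(2) by auto
    let ?s = "\<lambda>a. \<Sum>k\<in>K. kscal P (?g k a) (b k)"
    have 1: "pure (?s a, a', a'') - (\<Sum>k\<in>K. fscal (?g k a) (pure (b k, a', a''))) \<in> tensor3_null P"
      by (rule expand_mod[OF N P(1), where g = "\<lambda>a. pure (a, a', a'')"])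
        (auto simp: mem K intro: tensor3_null_gens)
    have 2: "pure (b k, ?s a', a'') - (\<Sum>l\<in>K. fscal (?g l a') (pure (b k, b l, a''))) \<in> tensor3_null P"
      if "k \<in> K" for k
      by (rule expand_mod[OF N P(1), where g = "\<lambda>a'. pure (b k, a', a'')"])
        (auto simp: mem that K intro: tensor3_null_gens)
    have 3: "pure (b k, b l, ?s a'') - (\<Sum>m\<in>K. fscal (?g m a'') (pure (b k, b l, b m)))
        \<in> tensor3_null P" if "k \<in> K" "l \<in> K" for k l
      by (rule expand_mod[OF N P(1), where g = "\<lambda>a''. pure (b k, b l, a'')"])
        (auto simp: mem that K intro: tensor3_null_gens)
    note eq = K(4)[OF aS(1), symmetric] K(4)[OF aS(2), symmetric] K(4)[OF aS(3), symmetric]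
    let ?X1 = "pure (a, a', a'') - (\<Sum>k\<in>K. fscal (?g k a) (pure (b k, a', a'')))"
    let ?X2 = "\<lambda>k. pure (b k, a', a'') - (\<Sum>l\<in>K. fscal (?g l a') (pure (b k, b l, a'')))"
    let ?X3 = "\<lambda>k l. pure (b k, b l, a'') - (\<Sum>m\<in>K. fscal (?g m a'') (pure (b k, b l, b m)))"
    have "?X1 + (\<Sum>k\<in>K. fscal (?g k a) (?X2 k + (\<Sum>l\<in>K. fscal (?g l a') (?X3 k l))))
        \<in> tensor3_null P"
      by (intro formal.subspace_add[OF N] formal.subspace_sum[OF N] formal.subspace_scale[OF N]
          1[unfolded eq] 2[unfolded eq] 3[unfolded eq])
    also have "?X1 + (\<Sum>k\<in>K. fscal (?g k a) (?X2 k + (\<Sum>l\<in>K. fscal (?g l a') (?X3 k l)))) =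
        pure (a, a', a'') - (\<Sum>k\<in>K. \<Sum>l\<in>K. \<Sum>m\<in>K.
          fscal (?g k a * ?g l a' * ?g m a'') (pure (b k, b l, b m)))"
      by (simp add: formal.scale_right_diff_distrib formal.scale_right_distrib sum_subtractf
          sum.distrib formal.scale_sum_right mult.assoc)
    finally show "pure p - (\<Sum>q\<in>K \<times> K \<times> K.
        fscal ((case q of (k, l, m) \<Rightarrow> \<lambda>(a, a', a''). ?g k a * ?g l a' * ?g m a'') p)
        (case q of (k, l, m) \<Rightarrow> pure (b k, b l, b m))) \<in> tensor3_null P"
      by (simp add: p_eq sum.cartesian_product case_prod_unfold)
  qed
qed

lemma d_pure:
  "d1 P (pure (a, b, c)) = pure (del P a, b, c)" "d2 P (pure (a, b, c)) = pure (a, del P b, c)"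
  "d3 P (pure (a, b, c)) = pure (a, b, del P c)"
  by (simp_all add: d1_def d2_def d3_def lin_ext_pure[OF formal.module_axioms])

lemma eval3_additive: "additive_on (tensor3_free P) (eval3 f g h)"
  by (simp add: additive_on_def tensor3_free_supported supported_0 supported_add)

lemma d_free:
  assumes "kd_module P" "t \<in> tensor3_free P"
  shows "d1 P t \<in> tensor3_free P" "d2 P t \<in> tensor3_free P" "d3 P t \<in> tensor3_free P"
  using assms unfolding tensor3_free_supported d1_def d2_def d3_def
  by (auto intro!: lin_ext_supported[OF assms(2)[unfolded tensor3_free_supported]] simp: kd_moduleD)

lemma eigen_d:
  assumes P: "kd_module P"
    and f: "point_functional P u f" and g: "point_functional P v g" and h: "point_functional P w h"
  shows "eigen_on (tensor3_free P) (d1 P) u (eval3 f g h)"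
    "eigen_on (tensor3_free P) (d2 P) v (eval3 f g h)"
    "eigen_on (tensor3_free P) (d3 P) w (eval3 f g h)"
proof -
  have "eval3 f g h (d1 P t) = u * eval3 f g h t" "eval3 f g h (d2 P t) = v * eval3 f g h t"
    "eval3 f g h (d3 P t) = w * eval3 f g h t" if "t \<in> tensor3_free P" for t
    unfolding eval3_def d1_def d2_def d3_def lin_ext_lin_ext lin_ext_cmult_fun[symmetric]
    by (rule lin_ext_cong, use that in \<open>auto simp: tensor3_free_def formal_eval_simps
        point_functionalD[OF f] point_functionalD[OF g] point_functionalD[OF h]\<close>)+
  then show "eigen_on (tensor3_free P) (d1 P) u (eval3 f g h)"
    "eigen_on (tensor3_free P) (d2 P) v (eval3 f g h)"
    "eigen_on (tensor3_free P) (d3 P) w (eval3 f g h)"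
    using d_free[OF P] by (auto simp: eigen_on_def eval3_additive)
qed

text \<open>The representatives of the classes in the image of the total derivative.\<close>

definition exact3 :: "('k::field_char_0, 'p::ab_group_add, 'z) kd_module_scheme
    \<Rightarrow> ('p \<times> 'p \<times> 'p \<Rightarrow>\<^sub>0 'k) set" where
  "exact3 P = {u. \<exists>s\<in>tensor3_free P. u - (d1 P + d2 P + d3 P) s \<in> tensor3_null P}"

lemma total_d_linear:
  "(d1 P + d2 P + d3 P) (s + t) = (d1 P + d2 P + d3 P) s + (d1 P + d2 P + d3 P) t"
  "(d1 P + d2 P + d3 P) (fscal c t) = fscal c ((d1 P + d2 P + d3 P) t)"
  "(d1 P + d2 P + d3 P) 0 = 0"
  by (simp_all add: d1_def d2_def d3_def lin_ext_add[OF formal.module_axioms]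
      lin_ext_fscal[OF formal.module_axioms] lin_ext_0[OF formal.module_axioms]
      formal.scale_right_distrib)

lemma subspace_exact3: "formal.subspace (exact3 P)"
  unfolding formal.subspace_def
proof (intro conjI allI ballI)
  note N = subspace_null3[of P]
  note S = subspace_free3[of P]
  let ?D = "d1 P + d2 P + d3 P"
  show "0 \<in> exact3 P"
    unfolding exact3_def
    by (intro CollectI bexI[of _ 0])
      (simp_all only: total_d_linear diff_self formal.subspace_0[OF N] formal.subspace_0[OF S])
  fix u assume "u \<in> exact3 P"
  then obtain s where s: "s \<in> tensor3_free P" "u - ?D s \<in> tensor3_null P" by (auto simp: exact3_def)
  show "fscal c u \<in> exact3 P" for c
    unfolding exact3_def
  proof (intro CollectI bexI)
    show "fscal c s \<in> tensor3_free P" by (rule formal.subspace_scale[OF S s(1)])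
    show "fscal c u - ?D (fscal c s) \<in> tensor3_null P"
      using formal.subspace_scale[OF N s(2), of c]
      by (simp only: total_d_linear formal.scale_right_diff_distrib)
  qed
  fix v assume "v \<in> exact3 P"
  then obtain t where t: "t \<in> tensor3_free P" "v - ?D t \<in> tensor3_null P" by (auto simp: exact3_def)
  show "u + v \<in> exact3 P"
    unfolding exact3_def
  proof (intro CollectI bexI)
    show "s + t \<in> tensor3_free P" by (rule formal.subspace_add[OF S s(1) t(1)])
    have "u + v - ?D (s + t) = (u - ?D s) + (v - ?D t)"
      by (simp only: total_d_linear) (simp add: algebra_simps)
    then show "u + v - ?D (s + t) \<in> tensor3_null P"
      using formal.subspace_add[OF N s(2) t(2)] by (simp only:)
  qed
qed

lemma null3_exact3: "tensor3_null P \<subseteq> exact3 P"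
  unfolding exact3_def
proof (intro subsetI CollectI bexI)
  show "u - (d1 P + d2 P + d3 P) 0 \<in> tensor3_null P" if "u \<in> tensor3_null P" for u
    using that by (simp only: total_d_linear diff_0_right)
  show "0 \<in> tensor3_free P" by (simp add: tensor3_free_supported supported_0)
qed

lemma eval3_exact3:
  assumes P: "kd_module P"
    and f: "point_functional P u f" and g: "point_functional P v g" and h: "point_functional P w h"
    and sum: "u + v + w = 0" and t: "t \<in> exact3 P"
  shows "eval3 f g h t = 0"
proof -
  obtain s where s: "s \<in> tensor3_free P" "t - (d1 P + d2 P + d3 P) s \<in> tensor3_null P"
    using t by (auto simp: exact3_def)
  have "eval3 f g h t = eval3 f g h (t - (d1 P + d2 P + d3 P) s) +
      eval3 f g h ((d1 P + d2 P + d3 P) s)" by simp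
  also have "\<dots> = (u + v + w) * eval3 f g h s"
    using eval3_null[OF f g h s(2)] eigen_d[OF P f g h] s(1)
    by (simp add: eigen_on_def algebra_simps)
  finally show ?thesis using sum by simp
qed

text \<open>Modulo total derivatives, \<open>\<partial>\<close> can be moved from the third factor to the other two, which leaves
  basis elements in the third factor.  A coordinate functional is constant on these, so that its
  weight is free to be chosen, and the weights sum to zero for the right choice.\<close>

lemma exact3_of_eval:
  assumes P: "kd_module P" "coordinates P I x e" and u: "u \<in> tensor3_free P"
    and 0: "\<And>r s t f g h. point_functional P r f \<Longrightarrow> point_functional P s g \<Longrightarrow>
       point_functional P t h \<Longrightarrow> r + s + t = 0 \<Longrightarrow> eval3 f g h u = 0"
  shows "u \<in> exact3 P"
proof -
  note X = subspace_exact3[of P] and D = kd_moduleD[OF P(1)]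
  let ?E = "supported (carr P \<times> carr P \<times> e ` I)"
  have e: "e i \<in> carr P" if "i \<in> I" for i using P(2) that unfolding coordinates_def by blast
  have E: "?E \<subseteq> tensor3_free P" using e by (fastforce simp: tensor3_free_supported supported_def)
  define K where "K = {t. \<exists>t'\<in>?E. t - t' \<in> exact3 P}"
  have K: "formal.subspace K"
    unfolding formal.subspace_def
  proof (intro conjI allI ballI)
    show "0 \<in> K" unfolding K_def
      by (intro CollectI bexI[of _ 0]) (simp_all add: formal.subspace_0[OF X] supported_0)
    fix s assume "s \<in> K"
    then obtain s' where s: "s' \<in> ?E" "s - s' \<in> exact3 P" by (auto simp: K_def)
    show "fscal c s \<in> K" for c unfolding K_def
      by (intro CollectI bexI[of _ "fscal c s'"] supported_scale s)
        (use formal.subspace_scale[OF X s(2), of c] in \<open>simp add: formal.scale_right_diff_distrib\<close>)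
    fix t assume "t \<in> K"
    then obtain t' where t: "t' \<in> ?E" "t - t' \<in> exact3 P" by (auto simp: K_def)
    have "s + t - (s' + t') = (s - s') + (t - t')" by simp
    then have "s + t - (s' + t') \<in> exact3 P"
      using formal.subspace_add[OF X s(2) t(2)] by (simp only:)
    then show "s + t \<in> K" unfolding K_def
      using supported_add[OF s(1) t(1)] by blast
  qed
  have K_mod: "s \<in> K" if st: "s - t \<in> exact3 P" "t \<in> K" for s t
  proof -
    obtain t' where t: "t' \<in> ?E" "t - t' \<in> exact3 P" using st(2) unfolding K_def by blast
    have "s - t' \<in> exact3 P" using formal.subspace_add[OF X st(1) t(2)] by simp
    then show ?thesis unfolding K_def using t(1) by blast
  qed
  have base: "pure (a, b, scal P p (e i)) \<in> K" if "i \<in> I" "a \<in> carr P" "b \<in> carr P" for i p a b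
    using that
  proof (induction p arbitrary: a b)
    case 0
    have "pure (a, b, kscal P 0 0) - fscal 0 (pure (a, b, 0)) \<in> tensor3_null P"
      by (rule tensor3_null_gens) (use 0 D in auto)
    then have "pure (a, b, scal P 0 (e i)) - 0 \<in> exact3 P"
      using null3_exact3 D by auto
    then show ?case using K_mod formal.subspace_0[OF K] by blast
  next
    case (pCons c p)
    let ?z = "scal P p (e i)"
    have z: "?z \<in> carr P" using e[OF \<open>i \<in> I\<close>] D by simp
    have 1: "pure (a, b, kscal P c (e i) + del P ?z) - pure (a, b, kscal P c (e i))
        - pure (a, b, del P ?z) \<in> exact3 P"
      by (rule subsetD[OF null3_exact3], rule tensor3_null_gens) (use pCons e z D in auto)
    have 2: "pure (a, b, kscal P c (e i)) - fscal c (pure (a, b, e i)) \<in> exact3 P"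
      by (rule subsetD[OF null3_exact3], rule tensor3_null_gens) (use pCons e z D in auto)
    have 3: "pure (del P a, b, ?z) + pure (a, del P b, ?z) + pure (a, b, del P ?z) \<in> exact3 P"
      unfolding exact3_def
      by (intro CollectI bexI[of _ "pure (a, b, ?z)"])
        (use pCons z in \<open>simp_all add: d_pure tensor3_free_supported
           formal.subspace_0[OF subspace_null3]\<close>)
    show ?case
    proof (rule K_mod)
      show "fscal c (pure (a, b, e i)) - pure (del P a, b, ?z) - pure (a, del P b, ?z) \<in> K"
      proof (intro formal.subspace_diff[OF K] formal.subspace_scale[OF K])
        have "pure (a, b, e i) \<in> ?E" using pCons by simp
        then show "pure (a, b, e i) \<in> K"
          unfolding K_def using formal.subspace_0[OF X]
          by (intro CollectI bexI[of _ "pure (a, b, e i)"]) simp_all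
        show "pure (del P a, b, ?z) \<in> K" "pure (a, del P b, ?z) \<in> K"
          using pCons D by auto
      qed
      show "pure (a, b, scal P (pCons c p) (e i)) - (fscal c (pure (a, b, e i))
          - pure (del P a, b, ?z) - pure (a, del P b, ?z)) \<in> exact3 P"
        using formal.subspace_add[OF X formal.subspace_add[OF X 1 2] 3]
        by (simp add: scal_pCons[OF P(1)] algebra_simps)
    qed
  qed
  have pure_K: "pure (a, b, c) \<in> K" if "a \<in> carr P" "b \<in> carr P" "c \<in> carr P" for a b c
  proof -
    let ?J = "{i\<in>I. x i c \<noteq> 0}"
    have J: "finite ?J" "c = (\<Sum>i\<in>?J. kscal P 1 (scal P (x i c) (e i)))"
      using P(2) that D unfolding coordinates_def kscal_def by (auto simp: one_pCons[symmetric])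
    have "pure (a, b, \<Sum>i\<in>?J. kscal P 1 (scal P (x i c) (e i))) -
        (\<Sum>i\<in>?J. fscal 1 (pure (a, b, scal P (x i c) (e i)))) \<in> tensor3_null P"
      by (rule expand_mod[OF subspace_null3 P(1), where g = "\<lambda>c. pure (a, b, c)"])
        (auto simp: that J(1) e D intro: tensor3_null_gens)
    then have "pure (a, b, c) - (\<Sum>i\<in>?J. fscal 1 (pure (a, b, scal P (x i c) (e i)))) \<in> exact3 P"
      unfolding J(2)[symmetric] using null3_exact3 by blast
    moreover have "(\<Sum>i\<in>?J. fscal 1 (pure (a, b, scal P (x i c) (e i)))) \<in> K"
      by (intro formal.subspace_sum[OF K] formal.subspace_scale[OF K] base) (use that in auto)
    ultimately show ?thesis by (rule K_mod)
  qed
  have "lin_ext fscal pure u \<in> K"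
    by (rule lin_ext_in_subspace[OF K]) (use u pure_K in \<open>auto simp: tensor3_free_def\<close>)
  then obtain t where t: "t \<in> ?E" "u - t \<in> exact3 P"
    by (auto simp: K_def lin_ext_pure_id)
  have "t \<in> tensor3_null P"
  proof (rule tensor3_null_of_eval[OF P])
    show "t \<in> tensor3_free P" using t E by blast
    fix i j k and r s w :: 'a assume ijk: "i \<in> I" "j \<in> I" "k \<in> I"
    let ?f = "\<lambda>i r a. poly (x i a) r"
    note pf = coordinates_point_functional[OF P]
    have "eval3 (?f i r) (?f j s) (?f k w) t = eval3 (?f i r) (?f j s) (?f k (- r - s)) t"
      unfolding eval3_def
    proof (rule lin_ext_cong)
      fix p assume "p \<in> Poly_Mapping.keys t"
      then obtain a b l where p: "p = (a, b, e l)" "l \<in> I" using t(1) by (auto simp: supported_def)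
      have "x k (e l) = (if k = l then 1 else 0)"
        using P(2) p ijk unfolding coordinates_def by blast
      then show "(case p of (a, b, c) \<Rightarrow> ?f i r a * ?f j s b * ?f k w c) =
          (case p of (a, b, c) \<Rightarrow> ?f i r a * ?f j s b * ?f k (- r - s) c)"
        by (simp add: p)
    qed
    also have "\<dots> = eval3 (?f i r) (?f j s) (?f k (- r - s)) u -
        eval3 (?f i r) (?f j s) (?f k (- r - s)) (u - t)" by simp
    also have "\<dots> = 0"
      using 0[OF pf[OF ijk(1)] pf[OF ijk(2)] pf[OF ijk(3)]]
        eval3_exact3[OF P(1) pf[OF ijk(1)] pf[OF ijk(2)] pf[OF ijk(3)] _ t(2)] by simp
    finally show "eval3 (?f i r) (?f j s) (?f k w) t = 0" .
  qed
  then have "(u - t) + t \<in> exact3 P"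
    using null3_exact3 by (intro formal.subspace_add[OF X t(2)]) blast
  then show ?thesis by simp
qed


section \<open>Classes of tensors\<close>

text \<open>The common form of \<^const>\<open>tensor2_rel\<close> and \<^const>\<open>tensor3_rel\<close>.\<close>

definition quot_rel :: "'t::ab_group_add set \<Rightarrow> 't set \<Rightarrow> ('t \<times> 't) set" where
  "quot_rel S N = {(s, t). s \<in> S \<and> t \<in> S \<and> s - t \<in> N}"

lemma tensor2_rel_quot_rel: "tensor2_rel A B = quot_rel (tensor2_free A B) (tensor2_null A B)"
  by (simp add: tensor2_rel_def quot_rel_def)

lemma tensor3_rel_quot_rel: "tensor3_rel P = quot_rel (tensor3_free P) (tensor3_null P)"
  by (simp add: tensor3_rel_def quot_rel_def)

lemma equiv_quot_rel:
  fixes N :: "('p \<Rightarrow>\<^sub>0 'k::field_char_0) set"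
  assumes N: "formal.subspace N"
  shows "equiv S (quot_rel S N)"
proof (rule equivI)
  show "quot_rel S N \<subseteq> S \<times> S" by (auto simp: quot_rel_def)
  show "refl_on S (quot_rel S N)"
    using formal.subspace_0[OF N] by (auto simp: refl_on_def quot_rel_def)
  show "sym (quot_rel S N)"
    using formal.subspace_neg[OF N] by (force simp: sym_def quot_rel_def)
  show "trans (quot_rel S N)"
  proof (rule transI)
    fix x y z assume "(x, y) \<in> quot_rel S N" "(y, z) \<in> quot_rel S N"
    then show "(x, z) \<in> quot_rel S N"
      using formal.subspace_add[OF N, of "x - y" "y - z"] by (auto simp: quot_rel_def)
  qed
qed

lemma class_eq_iff:
  fixes N :: "('p \<Rightarrow>\<^sub>0 'k::field_char_0) set"
  assumes "formal.subspace N" "s \<in> S" "t \<in> S"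
  shows "quot_rel S N `` {s} = quot_rel S N `` {t} \<longleftrightarrow> s - t \<in> N"
  using eq_equiv_class_iff[OF equiv_quot_rel[OF assms(1)] assms(2,3)] assms(2,3)
  by (auto simp: quot_rel_def)

lemma class_mem:
  fixes N :: "('p \<Rightarrow>\<^sub>0 'k::field_char_0) set"
  assumes "formal.subspace N" "s \<in> S"
  shows "s \<in> quot_rel S N `` {s}"
  using assms formal.subspace_0[OF assms(1)] by (auto simp: quot_rel_def)

lemma on_classes_class:
  fixes N' :: "('p \<Rightarrow>\<^sub>0 'k::field_char_0) set" and N :: "('r \<Rightarrow>\<^sub>0 'k) set"
  assumes N: "formal.subspace N" and N': "formal.subspace N'" and x: "x \<in> S"
    and F: "\<And>y. y \<in> S \<Longrightarrow> F y \<in> S'" "\<And>y. y \<in> S \<Longrightarrow> x - y \<in> N \<Longrightarrow> F x - F y \<in> N'"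
  shows "on_classes (quot_rel S' N') F (quot_rel S N `` {x}) = quot_rel S' N' `` {F x}"
proof -
  have "quot_rel S' N' `` {F y} = quot_rel S' N' `` {F x}" if "y \<in> quot_rel S N `` {x}" for y
    using that x F by (subst eq_commute, subst class_eq_iff[OF N']) (auto simp: quot_rel_def)
  then show ?thesis
    unfolding on_classes_def using class_mem[OF N x] by blast
qed


section \<open>Conformal linear maps and the conformal dual\<close>

lemma trivial_module_simps [simp]:
  "carr trivial_module = UNIV" "kscal trivial_module = (*)" "del trivial_module = (\<lambda>c. 0)"
  by (simp_all add: trivial_module_def kscal_def del_def fun_eq_iff)

lemma peval_id: "peval (\<lambda>c. c) a q = poly q (a :: 'k::comm_ring_1)"
  by (simp add: peval_poly map_poly_id[unfolded id_def])

lemma sum_fun_apply: "sum f A u = (\<Sum>i\<in>A. f i u)"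
  by (induction A rule: infinite_finite_induct) auto

text \<open>The rule \<open>a\<^sub>\<lambda>(\<partial>u) = (\<lambda>+\<partial>)(a\<^sub>\<lambda> u)\<close> at \<open>\<lambda> = \<alpha>\<close>, where \<open>h\<close> makes \<open>\<partial>\<close> the scalar \<open>w\<close>.\<close>

lemma Chom_point_functional:
  assumes U: "kd_module U" and V: "kd_module V" and a: "a \<in> carr (Chom U V)"
    and h: "point_functional V w h"
  shows "point_functional U (\<alpha> + w) (\<lambda>u. peval h \<alpha> (a u))"
proof (rule point_functionalI[OF U])
  have po: "a u \<in> poly_over (carr V)" if "u \<in> carr U" for u
    using a that by (simp add: Chom_def)
  note po0 = lam1_poly_over[OF kd_moduleD(1)[OF V]] del1_poly_over[OF V]
  fix u assume u: "u \<in> carr U"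
  show "peval h \<alpha> (a (u + u')) = peval h \<alpha> (a u) + peval h \<alpha> (a u')" if "u' \<in> carr U" for u'
  proof -
    have "a (u + u') = a u + a u'" using a u that by (simp add: Chom_def)
    then show ?thesis by (simp add: peval_add[OF V h po[OF u] po[OF that]])
  qed
  show "peval h \<alpha> (a (kscal U c u)) = c * peval h \<alpha> (a u)" for c
  proof -
    have "a (kscal U c u) = map_poly (kscal V c) (a u)" using a u by (simp add: Chom_def)
    then show ?thesis by (simp add: peval_kscal[OF V h po[OF u]])
  qed
  have "a (del U u) = lam1 (a u) + del1 V (a u)" using a u by (simp add: Chom_def)
  then show "peval h \<alpha> (a (del U u)) = (\<alpha> + w) * peval h \<alpha> (a u)"
    using po[OF u] po0 by (simp add: peval_add[OF V h] peval_lam1 point_functional_0[OF V h]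
        peval_del1[OF V h] algebra_simps)
qed

lemma Chom_scal_eval:
  assumes V: "kd_module V" and h: "point_functional V w h" and y: "a u \<in> poly_over (carr V)"
  shows "peval h \<alpha> (scal (Chom U V) p a u) = poly p (- \<alpha>) * peval h \<alpha> (a u)"
proof -
  have add: "additive_on (poly_over (carr V)) (peval h \<alpha>)"
    by (rule additive_on_peval[OF additive_on_point_functional[OF V h]])
  have X: "eigen_on (poly_over (carr V)) (- lam1) (- \<alpha>) (peval h \<alpha>)"
    unfolding eigen_on_def
    using add lam1_poly_over[OF kd_moduleD(1)[OF V]] poly_over_minus[OF V]
    by (auto simp: peval_minus[OF V h] peval_lam1 point_functional_0[OF V h])
  have E: "\<forall>n. map_poly (kscal V (coeff p n)) (a u) \<in> poly_over (carr V)"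
    by (auto intro!: map_poly_poly_over[OF _ _ y] simp: kd_moduleD[OF V])
  have "peval h \<alpha> (scal (Chom U V) p a u) =
      peval (\<lambda>c. peval h \<alpha> (map_poly (kscal V c) (a u))) (- \<alpha>) p"
    by (simp add: Chom_def subst_op_eval(2)[OF X E])
  also have "\<dots> = peval (\<lambda>c. c * peval h \<alpha> (a u)) (- \<alpha>) p"
    by (simp add: peval_kscal[OF V h y])
  also have "\<dots> = poly p (- \<alpha>) * peval h \<alpha> (a u)"
    by (simp add: peval_mult_const_fun peval_id)
  finally show ?thesis .
qed

lemma kd_hom_Cend_point_functional:
  assumes Q: "kd_module Q" and M: "kd_module M" and l: "kd_hom Q (Cend M) l"
    and h: "point_functional M w h"
  shows "v \<in> carr M \<Longrightarrow> point_functional Q (- \<alpha>) (\<lambda>a. peval h \<alpha> (l a v))"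
    and "a \<in> carr Q \<Longrightarrow> point_functional M (\<alpha> + w) (\<lambda>v. peval h \<alpha> (l a v))"
    and "a \<in> carr Q \<Longrightarrow> v \<in> carr M \<Longrightarrow> l a v \<in> poly_over (carr M)"
proof -
  have la: "l a \<in> carr (Cend M)" if "a \<in> carr Q" for a using l that by (simp add: kd_hom_def)
  show po: "l a v \<in> poly_over (carr M)" if "a \<in> carr Q" "v \<in> carr M" for a v
    using la[OF that(1)] that(2) by (simp add: Chom_def)
  show "point_functional M (\<alpha> + w) (\<lambda>v. peval h \<alpha> (l a v))" if "a \<in> carr Q"
    by (rule Chom_point_functional[OF M M la[OF that] h])
  show "point_functional Q (- \<alpha>) (\<lambda>a. peval h \<alpha> (l a v))" if v: "v \<in> carr M"
    unfolding point_functional_def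
  proof (intro conjI ballI allI)
    show "peval h \<alpha> (l (a + b) v) = peval h \<alpha> (l a v) + peval h \<alpha> (l b v)"
      if "a \<in> carr Q" "b \<in> carr Q" for a b
      using l that by (simp add: kd_hom_def peval_add[OF M h po[OF _ v] po[OF _ v]])
    show "peval h \<alpha> (l (scal Q p a) v) = poly p (- \<alpha>) * peval h \<alpha> (l a v)" if "a \<in> carr Q" for p a
      using l that by (simp add: kd_hom_def Chom_scal_eval[OF M h, of "l _" v] po v)
  qed
qed

lemma bracket_point_functional:
  assumes Q: "leibniz_conformal_algebra Q" and h: "point_functional Q w h"
  shows "b \<in> carr Q \<Longrightarrow> point_functional Q (- \<mu>) (\<lambda>a. peval h \<mu> (br Q a b))"
    and "a \<in> carr Q \<Longrightarrow> point_functional Q (\<mu> + w) (\<lambda>b. peval h \<mu> (br Q a b))"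
proof -
  have V: "kd_module Q" using Q by (simp add: leibniz_conformal_algebra_def)
  have po: "br Q a b \<in> poly_over (carr Q)" if "a \<in> carr Q" "b \<in> carr Q" for a b
    using Q that by (simp add: leibniz_conformal_algebra_def)
  note po0 = po lam1_poly_over[OF kd_moduleD(1)[OF V]] del1_poly_over[OF V] poly_over_minus[OF V]
  have ev: "peval h \<mu> (br Q (a + a') b) = peval h \<mu> (br Q a b) + peval h \<mu> (br Q a' b)"
    "peval h \<mu> (br Q b (a + a')) = peval h \<mu> (br Q b a) + peval h \<mu> (br Q b a')"
    "peval h \<mu> (br Q (kscal Q c a) b) = c * peval h \<mu> (br Q a b)"
    "peval h \<mu> (br Q b (kscal Q c a)) = c * peval h \<mu> (br Q b a)"
    "peval h \<mu> (br Q (del Q a) b) = - \<mu> * peval h \<mu> (br Q a b)"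
    "peval h \<mu> (br Q b (del Q a)) = (\<mu> + w) * peval h \<mu> (br Q b a)"
    if "a \<in> carr Q" "a' \<in> carr Q" "b \<in> carr Q" for a a' b c
    using Q that
    by (simp_all add: leibniz_conformal_algebra_def po0 peval_add[OF V h] peval_kscal[OF V h]
        peval_minus[OF V h] peval_lam1 point_functional_0[OF V h] peval_del1[OF V h] algebra_simps)
  show "b \<in> carr Q \<Longrightarrow> point_functional Q (- \<mu>) (\<lambda>a. peval h \<mu> (br Q a b))"
    by (rule point_functionalI[OF V]) (use ev in auto)
  show "a \<in> carr Q \<Longrightarrow> point_functional Q (\<mu> + w) (\<lambda>b. peval h \<mu> (br Q a b))"
    by (rule point_functionalI[OF V]) (use ev in auto)
qed

lemma poly_ext_eval: "(\<And>a. poly p a = poly q a) \<Longrightarrow> p = (q :: 'k::field_char_0 poly)"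
  using poly_eq_poly_eq_iff by blast

text \<open>On conformal functionals \<open>\<partial>\<close> acts as multiplication by \<open>-\<lambda>\<close>.\<close>

lemma conf_dual_scal:
  fixes M :: "('k::field_char_0, 'u::ab_group_add, 'z) kd_module_scheme"
  shows "scal (conf_dual M) p f = (\<lambda>u. pcompose p [:0, - 1:] * f u)"
proof (intro ext poly_ext_eval)
  fix u :: 'u and a :: 'k
  have X: "eigen_on UNIV (- lam1) (- a) (\<lambda>q. poly q a)"
    by (simp add: eigen_on_def additive_on_def lam1_def)
  have "poly (scal (conf_dual M) p f u) a =
      peval (\<lambda>c. poly (map_poly ((*) c) (f u)) a) (- a) p"
    by (simp add: Chom_def subst_op_eval(2)[OF X])
  also have "\<dots> = peval (\<lambda>c. c * poly (f u) a) (- a) p"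
    by (simp add: smult_conv_map_poly[symmetric])
  also have "\<dots> = poly p (- a) * poly (f u) a"
    by (simp add: peval_mult_const_fun peval_id)
  finally show "poly (scal (conf_dual M) p f u) a = poly (pcompose p [:0, - 1:] * f u) a"
    by (simp add: poly_pcompose)
qed

text \<open>As \<open>\<partial>\<close> is zero on the trivial module, a conformal functional is a linear map over \<open>k[\<partial>]\<close> into
  polynomials, where \<open>\<partial>\<close> acts by multiplication by \<open>\<lambda>\<close>.\<close>

lemma conf_dual_carr:
  assumes M: "kd_module M"
  shows "f \<in> carr (conf_dual M) \<longleftrightarrow>
    (\<forall>u. u \<notin> carr M \<longrightarrow> f u = 0) \<and> (\<forall>u\<in>carr M. \<forall>u'\<in>carr M. f (u + u') = f u + f u') \<and>
    (\<forall>p. \<forall>u\<in>carr M. f (scal M p u) = p * f u)" (is "_ \<longleftrightarrow> ?R")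
proof
  assume f: "f \<in> carr (conf_dual M)"
  have "f (scal M p u) = p * f u" if u: "u \<in> carr M" for p u
  proof (rule poly_ext_eval)
    fix a :: 'a
    have id: "point_functional trivial_module 0 (\<lambda>c::'a. c)"
      by (simp add: point_functional_def trivial_module_def poly_0_coeff_0)
    have triv: "kd_module (trivial_module :: ('a, 'a) kd_module)"
    proof -
      have "module (\<lambda>p c. coeff p 0 * c :: 'a)"
        by unfold_locales (auto simp: algebra_simps coeff_mult_0)
      then show ?thesis
        by (simp add: kd_module_def trivial_module_def module.subspace_UNIV)
    qed
    have "point_functional M (a + 0) (\<lambda>u. peval (\<lambda>c. c) a (f u))"
      by (rule Chom_point_functional[OF M triv f id])
    then show "poly (f (scal M p u)) a = poly (p * f u) a"
      using u by (simp add: point_functional_def peval_id)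
  qed
  with f show ?R by (simp add: Chom_def)
next
  assume f: ?R
  have d: "del1 trivial_module = (\<lambda>q. 0 :: 'a poly)"
    by (auto simp: del1_def fun_eq_iff intro!: poly_eqI simp: coeff_map_poly)
  show "f \<in> carr (conf_dual M)"
    using f by (simp add: Chom_def poly_over_def kscal_def[of M] del_def[of M] lam1_def d
        smult_conv_map_poly[symmetric])
qed

lemma kd_module_conf_dual:
  assumes M: "kd_module M"
  shows "kd_module (conf_dual M)"
proof -
  have m: "module (scal (conf_dual M))"
    unfolding conf_dual_scal
    by unfold_locales (auto simp: fun_eq_iff algebra_simps pcompose_add pcompose_mult pcompose_1)
  interpret m: module "scal (conf_dual M)" by (rule m)
  have "m.subspace (carr (conf_dual M))"
    unfolding m.subspace_def conf_dual_scal
    by (auto simp: conf_dual_carr[OF M] algebra_simps)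
  with m show ?thesis by (simp add: kd_module_def)
qed

lemma eval_point_functional:
  assumes M: "kd_module M"
  shows "x \<in> carr M \<Longrightarrow> point_functional (conf_dual M) w (\<lambda>f. poly (f x) (- w))"
    and "f \<in> carr (conf_dual M) \<Longrightarrow> point_functional M w (\<lambda>x. poly (f x) w)"
  by (auto simp: point_functional_def conf_dual_carr[OF M] conf_dual_scal poly_pcompose)

lemma peval_dual_point_functional:
  "point_functional (conf_dual M) (- \<beta>) (\<lambda>f. peval (\<lambda>u. poly (f u) \<beta>) \<alpha> y)"
  by (simp add: point_functional_def conf_dual_scal poly_pcompose peval_add_fun peval_cmult_fun)

text \<open>The basis of \<open>M\<^sup>*\<^sup>c\<close> is dual to \<open>e\<close>.  The coordinate of \<open>f\<close> at \<open>b\<close> is the polynomial \<open>f\<^sub>\<lambda>(e\<^sub>b)\<close> with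
  \<open>\<lambda>\<close> replaced by \<open>-\<partial>\<close>, as \<open>\<partial>\<close> acts on \<open>M\<^sup>*\<^sup>c\<close> as \<open>-\<lambda>\<close>.\<close>

lemma conf_dual_coordinates:
  assumes M: "kd_module M" "coordinates M B x e" and B: "finite B"
  shows "coordinates (conf_dual M) B (\<lambda>b f. pcompose (f (e b)) [:0, - 1:])
    (\<lambda>b u. if u \<in> carr M then x b u else 0)"
  unfolding coordinates_def
proof (intro conjI ballI allI)
  note D = kd_moduleD[OF M(1)]
  fix b assume b: "b \<in> B"
  show "(\<lambda>u. if u \<in> carr M then x b u else 0) \<in> carr (conf_dual M)"
    using M(2) b D by (auto simp: conf_dual_carr[OF M(1)] coordinates_def)
  show "pcompose ((f + g) (e b)) [:0, - 1:] = pcompose (f (e b)) [:0, - 1:] + pcompose (g (e b)) [:0, - 1:]"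
    for f g by (simp add: pcompose_add)
  show "pcompose (scal (conf_dual M) p f (e b)) [:0, - 1:] = p * pcompose (f (e b)) [:0, - 1:]" for p f
    by (simp add: conf_dual_scal pcompose_mult pcompose_assoc[symmetric] pcompose_pCons)
  show "pcompose ((\<lambda>u. if u \<in> carr M then x c u else 0) (e b)) [:0, - 1:] = (if b = c then 1 else 0)"
    if "c \<in> B" for c
    using M(2) b that by (auto simp: coordinates_def pcompose_1)
next
  fix f assume f: "f \<in> carr (conf_dual M)"
  let ?c = "\<lambda>b. pcompose (f (e b)) [:0, - 1:]"
  let ?e = "\<lambda>b u. if u \<in> carr M then x b u else 0"
  show "finite {b \<in> B. ?c b \<noteq> 0}" using B by simp
  have "f = (\<Sum>b\<in>B. scal (conf_dual M) (?c b) (?e b))"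
  proof
    fix u
    show "f u = (\<Sum>b\<in>B. scal (conf_dual M) (?c b) (?e b)) u"
    proof (cases "u \<in> carr M")
      case False
      then show ?thesis using f
        by (simp add: sum_fun_apply conf_dual_scal conf_dual_carr[OF M(1)])
    next
      case True
      have e: "e b \<in> carr M" if "b \<in> B" for b using M(2) that unfolding coordinates_def by blast
      have add: "additive_on (carr M) f"
        using f kd_moduleD[OF M(1)] by (simp add: additive_on_def conf_dual_carr[OF M(1)])
      have "f u = f (\<Sum>b\<in>B. scal M (x b u) (e b))"
        using coordinates_superset[OF M True B] by auto
      also have "\<dots> = (\<Sum>b\<in>B. f (scal M (x b u) (e b)))"
        using additive_on_sum[OF add, of B "\<lambda>b. scal M (x b u) (e b)"] e kd_moduleD[OF M(1)] by simp
      also have "\<dots> = (\<Sum>b\<in>B. x b u * f (e b))"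
        using f e by (intro sum.cong) (simp_all add: conf_dual_carr[OF M(1)])
      finally show ?thesis using True
        by (simp add: sum_fun_apply conf_dual_scal pcompose_assoc[symmetric] pcompose_pCons
            mult.commute)
    qed
  qed
  also have "\<dots> = (\<Sum>b\<in>{b \<in> B. ?c b \<noteq> 0}. scal (conf_dual M) (?c b) (?e b))"
    by (rule sum.mono_neutral_right) (use B in \<open>auto simp: kd_moduleD[OF kd_module_conf_dual[OF M(1)]]\<close>)
  finally show "f = (\<Sum>b\<in>{b \<in> B. ?c b \<noteq> 0}. scal (conf_dual M) (?c b) (?e b))" .
qed

text \<open>A point functional is determined by its values on the dual basis; the element \<open>v\<close> of \<open>M\<close> has these
  values as its coordinates.\<close>

lemma conf_dual_functional:
  assumes M: "kd_module M" "coordinates M B x e" and B: "finite B"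
    and \<theta>: "point_functional (conf_dual M) w \<theta>"
  obtains v where "v \<in> carr M" "\<And>f. f \<in> carr (conf_dual M) \<Longrightarrow> \<theta> f = poly (f v) (- w)"
proof
  let ?N = "conf_dual M" and ?e = "\<lambda>b u. if u \<in> carr M then x b u else 0"
  note N = kd_module_conf_dual[OF M(1)] and C = conf_dual_coordinates[OF M B]
  define v where "v = (\<Sum>b\<in>B. kscal M (\<theta> (?e b)) (e b))"
  have e: "e b \<in> carr M" "?e b \<in> carr ?N" if "b \<in> B" for b
    using M(2) C that unfolding coordinates_def by blast+
  interpret m: module "scal M" using M(1) by (simp add: kd_module_def)
  show "v \<in> carr M"
    unfolding v_def using M(1) e kd_moduleD[OF M(1)]
    by (intro m.subspace_sum) (auto simp: kd_module_def)
  fix f assume f: "f \<in> carr ?N"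
  have pf: "point_functional M (- w) (\<lambda>x. poly (f x) (- w))" by (rule eval_point_functional(2)[OF M(1) f])
  have "f = (\<Sum>b\<in>B. scal ?N (pcompose (f (e b)) [:0, - 1:]) (?e b))"
    by (rule coordinates_superset[OF N C f B]) auto
  then have "\<theta> f = \<theta> (\<Sum>b\<in>B. scal ?N (pcompose (f (e b)) [:0, - 1:]) (?e b))" by simp
  also have "\<dots> = (\<Sum>b\<in>B. \<theta> (scal ?N (pcompose (f (e b)) [:0, - 1:]) (?e b)))"
    using additive_on_sum[OF additive_on_point_functional[OF N \<theta>], of B
        "\<lambda>b. scal ?N (pcompose (f (e b)) [:0, - 1:]) (?e b)"] e kd_moduleD[OF N] by simp
  also have "\<dots> = (\<Sum>b\<in>B. poly (f (e b)) (- w) * \<theta> (?e b))"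
    using e by (intro sum.cong) (simp_all add: point_functionalD[OF \<theta>] poly_pcompose)
  also have "\<dots> = (\<Sum>b\<in>B. poly (f (kscal M (\<theta> (?e b)) (e b))) (- w))"
    using e by (intro sum.cong) (simp_all add: point_functionalD(2)[OF pf] mult.commute)
  also have "\<dots> = poly (f v) (- w)"
    unfolding v_def
    using additive_on_sum[OF additive_on_point_functional[OF M(1) pf], of B
        "\<lambda>b. kscal M (\<theta> (?e b)) (e b)"] e kd_moduleD[OF M(1)] by simp
  finally show "\<theta> f = poly (f v) (- w)" .
qed


section \<open>The dual representation\<close>

text \<open>Values of polynomials in two variables at \<open>\<lambda> = \<alpha>\<close>, \<open>\<mu> = \<beta>\<close>.\<close>

abbreviation poly2 :: "'k::field_char_0 \<Rightarrow> 'k \<Rightarrow> 'k poly poly \<Rightarrow> 'k" where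
  "poly2 \<alpha> \<beta> \<equiv> peval (\<lambda>q. poly q \<beta>) \<alpha>"

lemma additive_on_poly2: "additive_on UNIV (poly2 \<alpha> \<beta>)"
proof -
  have "additive_on UNIV (\<lambda>q. poly q \<beta>)" by (simp add: additive_on_def)
  from additive_on_peval[OF this] show ?thesis by (simp add: poly_over_def)
qed

lemma poly2_simps:
  "poly2 \<alpha> \<beta> (G + H) = poly2 \<alpha> \<beta> G + poly2 \<alpha> \<beta> H"
  "poly2 \<alpha> \<beta> (G - H) = poly2 \<alpha> \<beta> G - poly2 \<alpha> \<beta> H"
  "poly2 \<alpha> \<beta> (- G) = - poly2 \<alpha> \<beta> G"
  "poly2 \<alpha> \<beta> (lam2 G) = \<alpha> * poly2 \<alpha> \<beta> G"
  "poly2 \<alpha> \<beta> (mu2 G) = \<beta> * poly2 \<alpha> \<beta> G"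
  "poly2 \<alpha> \<beta> (const2 c) = c"
  "poly2 \<alpha> \<beta> (smult p G) = poly p \<beta> * poly2 \<alpha> \<beta> G"
proof -
  note A = additive_on_poly2[where \<alpha> = \<alpha> and \<beta> = \<beta>]
  show "poly2 \<alpha> \<beta> (G + H) = poly2 \<alpha> \<beta> G + poly2 \<alpha> \<beta> H" for G H
    using A by (simp add: additive_on_def)
  show d: "poly2 \<alpha> \<beta> (G - H) = poly2 \<alpha> \<beta> G - poly2 \<alpha> \<beta> H" for G H
    using additive_on_diff[OF A] by simp
  show "poly2 \<alpha> \<beta> (- G) = - poly2 \<alpha> \<beta> G"
    using d[of 0 G] by simp
  show "poly2 \<alpha> \<beta> (lam2 G) = \<alpha> * poly2 \<alpha> \<beta> G"
    using peval_lam1[of "\<lambda>q. poly q \<beta>" \<alpha> G] by (simp add: lam1_def lam2_def)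
  show "poly2 \<alpha> \<beta> (mu2 G) = \<beta> * poly2 \<alpha> \<beta> G"
    by (simp add: mu2_def peval_map_poly peval_cmult_fun)
  show "poly2 \<alpha> \<beta> (const2 c) = c"
    using peval_const1[of "\<lambda>q. poly q \<beta>" \<alpha> "[:c:]"] by (simp add: const1_def const2_def)
  show "poly2 \<alpha> \<beta> (smult p G) = poly p \<beta> * poly2 \<alpha> \<beta> G"
    by (simp add: smult_conv_map_poly peval_map_poly peval_cmult_fun)
qed

lemma poly2_ext:
  assumes "\<And>\<alpha> \<beta>. poly2 \<alpha> \<beta> G = poly2 \<alpha> \<beta> H"
  shows "G = H"
proof -
  have "poly (coeff G n) \<beta> = poly (coeff H n) \<beta>" for n \<beta>
    by (rule coeff_eq_of_peval[where h = "\<lambda>q. poly q \<beta>"]) (simp_all add: assms)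
  then show ?thesis by (simp add: poly_eq_iff[of G] poly_ext_eval)
qed

text \<open>The right-hand side \<open>-\<langle>f, L\<^sub>\<lambda> v\<rangle>\<^sub>\<mu>\<^sub>-\<^sub>\<lambda>\<close> of the equation that defines the dual action of \<open>L\<close> on \<open>f\<close>.\<close>

definition dual_rhs :: "('m \<Rightarrow> 'm::zero poly) \<Rightarrow> ('m \<Rightarrow> 'k::field_char_0 poly) \<Rightarrow> 'm \<Rightarrow> 'k poly poly" where
  "dual_rhs L f v = - subst_op lam2 (\<lambda>u. subst_op (mu2 - lam2) const2 (f u)) (L v)"

lemma poly2_dual_rhs:
  "poly2 \<alpha> \<beta> (dual_rhs L f v) = - peval (\<lambda>u. poly (f u) (\<beta> - \<alpha>)) \<alpha> (L v)"
proof -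
  have X: "eigen_on UNIV (mu2 - lam2) (\<beta> - \<alpha>) (poly2 \<alpha> \<beta>)"
    and Y: "eigen_on UNIV lam2 \<alpha> (poly2 \<alpha> \<beta>)"
    by (simp_all add: eigen_on_def additive_on_poly2 poly2_simps algebra_simps)
  have "poly2 \<alpha> \<beta> (subst_op (mu2 - lam2) const2 q) = poly q (\<beta> - \<alpha>)" for q
    by (simp add: subst_op_eval(2)[OF X] poly2_simps peval_id)
  then show ?thesis
    by (simp add: dual_rhs_def poly2_simps subst_op_eval(2)[OF Y])
qed

lemma dual_rhs_linear:
  assumes M: "kd_module M" and L: "L \<in> carr (Cend M)" and f: "f \<in> carr (conf_dual M)"
  shows "u \<in> carr M \<Longrightarrow> v \<in> carr M \<Longrightarrow> dual_rhs L f (u + v) = dual_rhs L f u + dual_rhs L f v"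
    and "v \<in> carr M \<Longrightarrow> dual_rhs L f (scal M p v) = smult p (dual_rhs L f v)"
proof -
  have pf: "point_functional M \<beta> (\<lambda>v. peval (\<lambda>u. poly (f u) (\<beta> - \<alpha>)) \<alpha> (L v))" for \<alpha> \<beta>
    using Chom_point_functional[OF M M L eval_point_functional(2)[OF M f, of "\<beta> - \<alpha>"], of \<alpha>] by simp
  show "u \<in> carr M \<Longrightarrow> v \<in> carr M \<Longrightarrow> dual_rhs L f (u + v) = dual_rhs L f u + dual_rhs L f v"
    by (rule poly2_ext) (simp add: poly2_simps poly2_dual_rhs point_functionalD(1)[OF pf])
  show "v \<in> carr M \<Longrightarrow> dual_rhs L f (scal M p v) = smult p (dual_rhs L f v)"
    by (rule poly2_ext) (simp add: poly2_simps poly2_dual_rhs point_functionalD(4)[OF pf])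
qed

text \<open>Finiteness of \<open>M\<close> bounds the degree in \<open>\<lambda>\<close> uniformly, so that \<open>l\<^sup>*(a)\<^sub>\<lambda> f\<close> is a polynomial.\<close>

lemma dual_act_ex1:
  assumes M: "kd_module M" and fin: "kd_finite M"
    and L: "L \<in> carr (Cend M)" and f: "f \<in> carr (conf_dual M)"
  shows "\<exists>!g. g \<in> poly_over (carr (conf_dual M)) \<and>
    (\<forall>v\<in>carr M. map_poly (\<lambda>h. h v) g = dual_rhs L f v)"
proof (rule ex_ex1I)
  interpret m: module "scal M" using M by (simp add: kd_module_def)
  note D = kd_moduleD[OF M] and lin = dual_rhs_linear[OF M L f]
  obtain B where B: "finite B" "m.span B = carr M" using fin by (auto simp: kd_finite_def)
  define N where "N = Max (insert 0 ((\<lambda>b. Polynomial.degree (dual_rhs L f b)) ` B))"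
  have "carr M \<subseteq> {v \<in> carr M. Polynomial.degree (dual_rhs L f v) \<le> N}"
    unfolding B(2)[symmetric]
  proof (rule m.span_minimal)
    show "B \<subseteq> {v \<in> m.span B. Polynomial.degree (dual_rhs L f v) \<le> N}"
      using B m.span_base by (auto simp: N_def)
    have "dual_rhs L f 0 = 0" using lin(2)[of 0 0] D by simp
    then show "m.subspace {v \<in> m.span B. Polynomial.degree (dual_rhs L f v) \<le> N}"
      unfolding B(2) m.subspace_def using D lin
      by (auto intro: degree_add_le le_trans[OF degree_smult_le])
  qed
  then have N: "Polynomial.degree (dual_rhs L f v) \<le> N" if "v \<in> carr M" for v using that by blast
  define g where "g = (\<Sum>n\<le>N. monom (\<lambda>v. if v \<in> carr M then coeff (dual_rhs L f v) n else 0) n)"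
  have cg: "coeff g n = (if n \<le> N then (\<lambda>v. if v \<in> carr M then coeff (dual_rhs L f v) n else 0) else 0)" for n
    by (simp add: g_def coeff_sum)
  show "\<exists>g. g \<in> poly_over (carr (conf_dual M)) \<and>
      (\<forall>v\<in>carr M. map_poly (\<lambda>h. h v) g = dual_rhs L f v)"
  proof (intro exI conjI ballI)
    show "g \<in> poly_over (carr (conf_dual M))"
      unfolding poly_over_def using lin D by (auto simp: cg conf_dual_carr[OF M])
    fix v assume v: "v \<in> carr M"
    show "map_poly (\<lambda>h. h v) g = dual_rhs L f v"
      using N[OF v] v by (auto intro!: poly_eqI simp: coeff_map_poly cg coeff_eq_0)
  qed
next
  fix g g' assume g: "g \<in> poly_over (carr (conf_dual M)) \<and>
      (\<forall>v\<in>carr M. map_poly (\<lambda>h. h v) g = dual_rhs L f v)"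
    and g': "g' \<in> poly_over (carr (conf_dual M)) \<and>
      (\<forall>v\<in>carr M. map_poly (\<lambda>h. h v) g' = dual_rhs L f v)"
  have "coeff g n v = coeff g' n v" for n v
  proof (cases "v \<in> carr M")
    case True
    then have "map_poly (\<lambda>h. h v) g = map_poly (\<lambda>h. h v) g'" using g g' by simp
    then have "coeff (map_poly (\<lambda>h. h v) g) n = coeff (map_poly (\<lambda>h. h v) g') n" by simp
    then show ?thesis by (simp add: coeff_map_poly)
  next
    case False
    then show ?thesis using g g' by (simp add: poly_over_def conf_dual_carr[OF M])
  qed
  then show "g = g'" by (simp add: poly_eq_iff fun_eq_iff)
qed

lemma dual_act_props:
  assumes M: "kd_module M" and fin: "kd_finite M"
    and l: "l a \<in> carr (Cend M)" and f: "f \<in> carr (conf_dual M)"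
  shows "dual_act M l a f \<in> poly_over (carr (conf_dual M))"
    and "v \<in> carr M \<Longrightarrow> peval (\<lambda>h. poly (h v) \<beta>) \<alpha> (dual_act M l a f) =
           - peval (\<lambda>u. poly (f u) (\<beta> - \<alpha>)) \<alpha> (l a v)"
proof -
  let ?g = "dual_act M l a f"
  have g: "?g \<in> poly_over (carr (conf_dual M)) \<and> (\<forall>v\<in>carr M. map_poly (\<lambda>h. h v) ?g = dual_rhs (l a) f v)"
    using theI'[OF dual_act_ex1[OF M fin l f]] f by (simp add: dual_act_def dual_rhs_def)
  then show "?g \<in> poly_over (carr (conf_dual M))" by blast
  assume v: "v \<in> carr M"
  have "peval (\<lambda>h. poly (h v) \<beta>) \<alpha> ?g = poly2 \<alpha> \<beta> (map_poly (\<lambda>h. h v) ?g)"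
    by (simp add: peval_map_poly)
  then show "peval (\<lambda>h. poly (h v) \<beta>) \<alpha> ?g = - peval (\<lambda>u. poly (f u) (\<beta> - \<alpha>)) \<alpha> (l a v)"
    using g v by (simp add: poly2_dual_rhs)
qed


section \<open>The semi-direct product\<close>

lemma semidirect_simps:
  "carr (semidirect Q N l r) = carr Q \<times> carr N"
  "scal (semidirect Q N l r) p (a, x) = (scal Q p a, scal N p x)"
  by (simp_all add: semidirect_def)

lemma kd_module_semidirect:
  assumes Q: "kd_module Q" and N: "kd_module N"
  shows "kd_module (semidirect Q N l r)"
proof -
  have m: "module (scal (semidirect Q N l r))"
    using kd_moduleD[OF Q] kd_moduleD[OF N]
    by unfold_locales (auto simp: semidirect_simps)
  interpret m: module "scal (semidirect Q N l r)" by (rule m)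
  have "m.subspace (carr (semidirect Q N l r))"
    unfolding m.subspace_def using kd_moduleD[OF Q] kd_moduleD[OF N]
    by (auto simp: semidirect_simps zero_prod_def)
  with m show ?thesis by (simp add: kd_module_def)
qed

lemma semidirect_coordinates:
  assumes Q: "kd_module Q" "coordinates Q I x e" and N: "kd_module N" "coordinates N J y f"
  shows "coordinates (semidirect Q N l r) (I <+> J)
    (case_sum (\<lambda>i (a, u). x i a) (\<lambda>j (a, u). y j u)) (case_sum (\<lambda>i. (e i, 0)) (\<lambda>j. (0, f j)))"
proof -
  note DQ = kd_moduleD[OF Q(1)] and DN = kd_moduleD[OF N(1)]
  let ?P = "semidirect Q N l r"
  let ?x = "case_sum (\<lambda>i (a, u). x i a) (\<lambda>j (a, u). y j u)"
  let ?e = "case_sum (\<lambda>i. (e i, 0)) (\<lambda>j. (0, f j))"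
  have x0: "x i 0 = 0" if "i \<in> I" for i
    using Q(2) that DQ unfolding coordinates_def by (metis mult_zero_left)
  have y0: "y i 0 = 0" if "i \<in> J" for i
    using N(2) that DN unfolding coordinates_def by (metis mult_zero_left)
  have "finite {k\<in>I <+> J. ?x k (a, u) \<noteq> 0} \<and>
      (a, u) = (\<Sum>k\<in>{k\<in>I <+> J. ?x k (a, u) \<noteq> 0}. scal ?P (?x k (a, u)) (?e k))"
    if a: "a \<in> carr Q" and u: "u \<in> carr N" for a u
  proof -
    let ?I = "{i\<in>I. x i a \<noteq> 0}" and ?J = "{j\<in>J. y j u \<noteq> 0}"
    have eq: "{k\<in>I <+> J. ?x k (a, u) \<noteq> 0} = ?I <+> ?J" by auto
    have "finite ?I \<and> a = (\<Sum>i\<in>?I. scal Q (x i a) (e i))"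
      using Q(2) a unfolding coordinates_def by blast
    note I = conjunct1[OF this] conjunct2[OF this, symmetric]
    have "finite ?J \<and> u = (\<Sum>j\<in>?J. scal N (y j u) (f j))"
      using N(2) u unfolding coordinates_def by blast
    note J = conjunct1[OF this] conjunct2[OF this, symmetric]
    have "(\<Sum>k\<in>?I <+> ?J. scal ?P (?x k (a, u)) (?e k)) =
        (\<Sum>i\<in>?I. (scal Q (x i a) (e i), 0)) + (\<Sum>j\<in>?J. (0, scal N (y j u) (f j)))"
      using I J by (simp add: sum.Plus semidirect_simps DQ DN)
    also have "\<dots> = (\<Sum>i\<in>?I. scal Q (x i a) (e i), \<Sum>j\<in>?J. scal N (y j u) (f j))"
      by (simp add: prod_eq_iff fst_sum snd_sum)
    finally show ?thesis unfolding eq using I J by simp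
  qed
  note fin = this
  have xa: "x i (a + b) = x i a + x i b" "x i (scal Q p a) = p * x i a" "e i \<in> carr Q"
    "i' \<in> I \<Longrightarrow> x i (e i') = (if i = i' then 1 else 0)"
    if "i \<in> I" "a \<in> carr Q" "b \<in> carr Q" for i i' a b p
    using Q(2) that unfolding coordinates_def by blast+
  have ya: "y j (u + v) = y j u + y j v" "y j (scal N p u) = p * y j u" "f j \<in> carr N"
    "j' \<in> J \<Longrightarrow> y j (f j') = (if j = j' then 1 else 0)"
    if "j \<in> J" "u \<in> carr N" "v \<in> carr N" for j j' u v p
    using N(2) that unfolding coordinates_def by blast+
  show ?thesis
    unfolding coordinates_def
  proof (intro conjI ballI allI)
    fix k assume k: "k \<in> I <+> J"
    show "?e k \<in> carr ?P"
      using k xa(3)[OF _ DQ(1) DQ(1)] ya(3)[OF _ DN(1) DN(1)] DQ(1) DN(1)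
      by (auto simp: semidirect_simps)
    show "?x k (u + v) = ?x k u + ?x k v" if "u \<in> carr ?P" "v \<in> carr ?P" for u v
      using k that xa(1) ya(1) by (auto simp: semidirect_simps)
    show "?x k (scal ?P p u) = p * ?x k u" if "u \<in> carr ?P" for p u
      using k that xa(2) ya(2) DQ(1) DN(1) by (auto simp: semidirect_simps)
    show "?x k (?e k') = (if k = k' then 1 else 0)" if "k' \<in> I <+> J" for k'
      using k that xa(4)[OF _ DQ(1) DQ(1)] ya(4)[OF _ DN(1) DN(1)] x0 y0
      by (auto split: if_splits)
  next
    fix u assume "u \<in> carr ?P"
    then obtain a v where "u = (a, v)" "a \<in> carr Q" "v \<in> carr N"
      by (auto simp: semidirect_simps)
    then show "finite {k\<in>I <+> J. ?x k u \<noteq> 0}"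
      "u = (\<Sum>k\<in>{k\<in>I <+> J. ?x k u \<noteq> 0}. scal ?P (?x k u) (?e k))"
      using fin by blast+
  qed
qed

lemma semidirect_point_functional:
  assumes Q: "kd_module Q" and N: "kd_module N"
  shows "point_functional Q w h \<Longrightarrow> point_functional N w g \<Longrightarrow>
      point_functional (semidirect Q N l r) w (\<lambda>(a, u). h a + g u)"
    and "point_functional (semidirect Q N l r) w \<theta> \<Longrightarrow> point_functional Q w (\<lambda>a. \<theta> (a, 0))"
    and "point_functional (semidirect Q N l r) w \<theta> \<Longrightarrow> point_functional N w (\<lambda>u. \<theta> (0, u))"
    and "point_functional (semidirect Q N l r) w \<theta> \<Longrightarrow> a \<in> carr Q \<Longrightarrow> u \<in> carr N \<Longrightarrow>
      \<theta> (a, u) = \<theta> (a, 0) + \<theta> (0, u)"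
proof -
  note DQ = kd_moduleD[OF Q] and DN = kd_moduleD[OF N]
  show "point_functional Q w h \<Longrightarrow> point_functional N w g \<Longrightarrow>
      point_functional (semidirect Q N l r) w (\<lambda>(a, u). h a + g u)"
    by (auto simp: point_functional_def semidirect_simps algebra_simps)
  assume \<theta>: "point_functional (semidirect Q N l r) w \<theta>"
  have add: "\<theta> (a + b, u + v) = \<theta> (a, u) + \<theta> (b, v)"
    if "a \<in> carr Q" "b \<in> carr Q" "u \<in> carr N" "v \<in> carr N" for a b u v
    using point_functionalD(1)[OF \<theta>, of "(a, u)" "(b, v)"] that by (simp add: semidirect_simps)
  have sc: "\<theta> (scal Q p a, scal N p u) = poly p w * \<theta> (a, u)"
    if "a \<in> carr Q" "u \<in> carr N" for a u p
    using point_functionalD(4)[OF \<theta>, of "(a, u)" p] that by (simp add: semidirect_simps)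
  show "point_functional Q w (\<lambda>a. \<theta> (a, 0))"
    unfolding point_functional_def using add[of _ _ 0 0] sc[of _ 0] DQ DN by simp
  show "point_functional N w (\<lambda>u. \<theta> (0, u))"
    unfolding point_functional_def using add[of 0 0] sc[of 0] DQ DN by simp
  show "\<theta> (a, u) = \<theta> (a, 0) + \<theta> (0, u)" if "a \<in> carr Q" "u \<in> carr N"
    using add[of a 0 0 u] that DQ DN by simp
qed


section \<open>The tensor attached to a conformal linear map\<close>

lemma point_functional_cong:
  "kd_module V \<Longrightarrow> point_functional V w h \<Longrightarrow> (\<And>u. u \<in> carr V \<Longrightarrow> h' u = h u) \<Longrightarrow>
     point_functional V w h'"
  by (simp add: point_functional_def kd_moduleD)

lemma poly_over_ext:
  assumes V: "kd_module V" "coordinates V I x e"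
    and y: "y \<in> poly_over (carr V)" and z: "z \<in> poly_over (carr V)"
    and eq: "\<And>w h \<alpha>. point_functional V w h \<Longrightarrow> peval h \<alpha> y = peval h \<alpha> z"
  shows "y = z"
proof -
  have "coeff y n = coeff z n" for n
  proof (rule point_functionals_separate[OF V])
    show "coeff y n \<in> carr V" "coeff z n \<in> carr V" using y z by (auto simp: poly_over_def)
    show "h (coeff y n) = h (coeff z n)" if "point_functional V w h" for w h
      by (rule coeff_eq_of_peval[of h]) (use that eq point_functional_0[OF V(1)] in auto)
  qed
  then show ?thesis by (simp add: poly_eq_iff)
qed

text \<open>The substitution \<open>\<lambda> \<mapsto> -\<lambda>-\<partial>\<close> and the flip of the pairing combine to \<open>\<phi>(f \<otimes> a)\<^sub>\<lambda> v = -f\<^sub>\<lambda>\<^sub>+\<^sub>\<partial>(v) a\<close>.\<close>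

lemma phi_formal_eval:
  fixes t :: "(('m::ab_group_add \<Rightarrow> 'k::field_char_0 poly) \<times> 'q::ab_group_add) \<Rightarrow>\<^sub>0 'k"
  assumes Q: "kd_module Q" and t: "t \<in> tensor2_free N Q"
  shows "phi_formal Q t v \<in> poly_over (carr Q)"
    and "point_functional Q w h \<Longrightarrow>
      peval h \<alpha> (phi_formal Q t v) = - eval2 (\<lambda>f. poly (f v) (\<alpha> + w)) h t"
proof -
  let ?F = "\<lambda>(f, a). subst_op (- lam1 - del1 Q) (\<lambda>c. const1 (kscal Q c a)) (pair_flip v f)"
  note D = kd_moduleD[OF Q]
  have E: "\<forall>n. const1 (kscal Q (coeff p n) a) \<in> poly_over (carr Q)" if "a \<in> carr Q"
    for a and p :: "'k poly"
    using that D by (auto intro: const1_poly_over)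
  have key: "?F p \<in> poly_over (carr Q)"
    "peval h \<alpha> (?F p) = - (case p of (f, a) \<Rightarrow> poly (f v) (\<alpha> + w) * h a)"
    if h: "point_functional Q w h" and p: "p \<in> Poly_Mapping.keys t" for w h \<alpha> p
  proof -
    obtain f a where fa: "p = (f, a)" "a \<in> carr Q" using p t by (auto simp: tensor2_free_def)
    note X = eigen_flip[OF Q h, of \<alpha>]
    show "?F p \<in> poly_over (carr Q)"
      using subst_op_eval(1)[OF X E[OF fa(2)]] by (simp add: fa)
    have "peval h \<alpha> (?F p) = peval (\<lambda>c. peval h \<alpha> (const1 (kscal Q c a))) (- \<alpha> - w) (pair_flip v f)"
      using subst_op_eval(2)[OF X E[OF fa(2)]] by (simp add: fa)
    also have "\<dots> = peval (\<lambda>c. c * h a) (- \<alpha> - w) (pair_flip v f)"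
      by (simp add: peval_const1 point_functionalD(2)[OF h fa(2)])
    also have "\<dots> = - (poly (f v) (\<alpha> + w) * h a)"
      by (simp add: peval_mult_const_fun peval_id pair_flip_def poly_pcompose algebra_simps)
    finally show "peval h \<alpha> (?F p) = - (case p of (f, a) \<Rightarrow> poly (f v) (\<alpha> + w) * h a)"
      by (simp add: fa)
  qed
  have sc: "map_poly (kscal Q c) s \<in> poly_over (carr Q) \<and>
      peval h \<alpha> (map_poly (kscal Q c) s) = c * peval h \<alpha> s"
    if "s \<in> poly_over (carr Q)" "point_functional Q w h" for c s w h \<alpha>
    using peval_kscal[OF Q that(2,1)] map_poly_poly_over[OF _ _ that(1), of "kscal Q c" "carr Q"] D
    by auto
  note lh = lin_ext_hom[where S = "poly_over (carr Q)" and sc = "\<lambda>c. map_poly (kscal Q c)" and F = ?F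
      and t = t]
  have zero: "point_functional Q 0 (\<lambda>_. 0 :: 'k)" by (simp add: point_functional_def)
  show "phi_formal Q t v \<in> poly_over (carr Q)"
    unfolding phi_formal_def
    by (rule lh(1)[OF additive_on_peval[OF additive_on_point_functional[OF Q zero], of 0]])
      (use sc[OF _ zero] key(1)[OF zero] in auto)
  assume h: "point_functional Q w h"
  have "peval h \<alpha> (phi_formal Q t v) = lin_ext (*) (\<lambda>p. peval h \<alpha> (?F p)) t"
    unfolding phi_formal_def
    by (rule lh(2)[OF additive_on_peval[OF additive_on_point_functional[OF Q h]]])
      (use sc[OF _ h] key(1)[OF h] in auto)
  also have "\<dots> = lin_ext (*) (\<lambda>p. (- 1) * (case p of (f, a) \<Rightarrow> poly (f v) (\<alpha> + w) * h a)) t"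
    by (rule lin_ext_cong) (use key(2)[OF h] in simp)
  also have "\<dots> = - eval2 (\<lambda>f. poly (f v) (\<alpha> + w)) h t"
    unfolding lin_ext_cmult_fun eval2_def by simp
  finally show "peval h \<alpha> (phi_formal Q t v) = - eval2 (\<lambda>f. poly (f v) (\<alpha> + w)) h t" .
qed

lemma phi_formal_outside:
  assumes Q: "kd_module Q" and M: "kd_module M" and t: "t \<in> tensor2_free (conf_dual M) Q"
    and v: "v \<notin> carr M"
  shows "phi_formal Q t v = 0"
proof -
  have fv: "f v = 0" if "(f, a) \<in> Poly_Mapping.keys t" for f a
    using t that v by (auto simp: tensor2_free_def conf_dual_carr[OF M])
  then show ?thesis
    unfolding phi_formal_def lin_ext_def
  proof (intro sum.neutral ballI)
    fix p assume p: "p \<in> Poly_Mapping.keys t"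
    obtain f a where fa: "p = (f, a)" by fastforce
    then have "pair_flip v f = 0" using fv[of f a] p by (simp add: pair_flip_def)
    then show "map_poly (kscal Q (Poly_Mapping.lookup t p)) (case p of (f, a) \<Rightarrow>
        subst_op (- lam1 - del1 Q) (\<lambda>c. const1 (kscal Q c a)) (pair_flip v f)) = 0"
      by (simp add: fa subst_op_def const1_def kscal_def kd_moduleD[OF Q])
  qed
qed

text \<open>This makes \<open>\<phi>\<close> well defined and injective: the products of point functionals that detect a tensor in
  \<open>M\<^sup>*\<^sup>c \<otimes> Q\<close> are, up to sign, the values \<open>h(\<phi>\<^sub>\<alpha>(z))\<close>.\<close>

lemma phi_formal_eq_iff:
  assumes Q: "kd_module Q" "coordinates Q I x e"
    and M: "kd_module M" "coordinates M B y b" and B: "finite B"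
    and s: "s \<in> tensor2_free (conf_dual M) Q" and t: "t \<in> tensor2_free (conf_dual M) Q"
  shows "phi_formal Q s = phi_formal Q t \<longleftrightarrow> s - t \<in> tensor2_null (conf_dual M) Q"
proof
  assume eq: "phi_formal Q s = phi_formal Q t"
  show "s - t \<in> tensor2_null (conf_dual M) Q"
  proof (rule tensor2_null_of_eval[OF kd_module_conf_dual[OF M(1)] conf_dual_coordinates[OF M B] Q])
    show "s - t \<in> tensor2_free (conf_dual M) Q"
      by (rule formal.subspace_diff[OF subspace_free2 s t])
    fix v w g h assume g: "point_functional (conf_dual M) v g" and h: "point_functional Q w h"
    obtain z where z: "z \<in> carr M" "\<And>f. f \<in> carr (conf_dual M) \<Longrightarrow> g f = poly (f z) (- v)"
      by (rule conf_dual_functional[OF M B g]) auto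
    \<comment> \<open>the value of \<open>\<phi>\<close> at \<open>\<lambda> = -v-w\<close> involves \<open>f\<close> at \<open>-v\<close>, as \<open>h\<close> makes \<open>\<partial>\<close> the scalar \<open>w\<close>\<close>
    have "eval2 g h u = eval2 (\<lambda>f. poly (f z) ((- v - w) + w)) h u"
      if "u \<in> tensor2_free (conf_dual M) Q" for u
      unfolding eval2_def
      by (rule lin_ext_cong) (use that z in \<open>auto simp: tensor2_free_def\<close>)
    then show "eval2 g h (s - t) = 0"
      using phi_formal_eval(2)[OF Q(1) s h, of "- v - w" z] phi_formal_eval(2)[OF Q(1) t h, of "- v - w" z]
        s t eq by simp
  qed
next
  assume null: "s - t \<in> tensor2_null (conf_dual M) Q"
  show "phi_formal Q s = phi_formal Q t"
  proof
    fix v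
    show "phi_formal Q s v = phi_formal Q t v"
    proof (cases "v \<in> carr M")
      case True
      show ?thesis
      proof (rule poly_over_ext[OF Q phi_formal_eval(1)[OF Q(1) s] phi_formal_eval(1)[OF Q(1) t]])
        fix w h \<alpha> assume h: "point_functional Q w h"
        have "eval2 (\<lambda>f. poly (f v) (- (- \<alpha> - w))) h (s - t) = 0"
          by (rule eval2_null[OF eval_point_functional(1)[OF M(1) True] h null])
        then show "peval h \<alpha> (phi_formal Q s v) = peval h \<alpha> (phi_formal Q t v)"
          by (simp add: phi_formal_eval(2)[OF Q(1) s h] phi_formal_eval(2)[OF Q(1) t h] add.commute)
      qed
    next
      case False
      then show ?thesis
        using phi_formal_outside[OF Q(1) M(1) s] phi_formal_outside[OF Q(1) M(1) t] by simp
    qed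
  qed
qed

text \<open>Let \<open>v\<^sub>j\<close> be a basis of \<open>M\<close> with dual basis \<open>v\<^sup>j\<close>, and write \<open>T\<^sub>\<lambda> v\<^sub>j = \<Sum>\<^sub>n (-\<lambda>-\<partial>)\<^sup>n c\<^sub>j\<^sub>n\<close>.  Then
  \<open>\<eta>(T) = -\<Sum>\<^sub>j\<^sub>n \<partial>\<^sup>n v\<^sup>j \<otimes> c\<^sub>j\<^sub>n\<close>, because the value of \<open>\<partial>\<^sup>n v\<^sup>j\<close> on \<open>v\<^sub>j\<close> is \<open>(-\<lambda>)\<^sup>n\<close>.  The last
  property holds for each representative \<open>t\<close> of \<open>\<eta>(T)\<close> and is all that is used of it.\<close>

lemma eta_representative:
  fixes Q :: "('k::field_char_0, 'q::ab_group_add, 'z) kd_module_scheme"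
    and M :: "('k, 'm::ab_group_add, 'y) kd_module_scheme"
  assumes Q: "kd_module Q" "coordinates Q I x e"
    and M: "kd_module M" "coordinates M B y b" and B: "finite B"
    and T: "T \<in> carr (Chom M Q)"
  obtains t where "t \<in> tensor2_free (conf_dual M) Q" "eta M Q T = tensor2_rel (conf_dual M) Q `` {t}"
    "\<And>v w h \<alpha>. v \<in> carr M \<Longrightarrow> point_functional Q w h \<Longrightarrow>
       peval h \<alpha> (T v) = - eval2 (\<lambda>f. poly (f v) (\<alpha> + w)) h t"
proof -
  let ?N = "conf_dual M"
  note N = subspace_null2[of ?N Q] and cN = conf_dual_coordinates[OF M B]
    and DN = kd_moduleD[OF kd_module_conf_dual[OF M(1)]]
  let ?e = "\<lambda>i u. if u \<in> carr M then y i u else 0"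
  define c where "c i = subst_op (- lam1 - del1 Q) const1 (T (b i))" for i
  define t :: "(('m \<Rightarrow> 'k poly) \<times> 'q) \<Rightarrow>\<^sub>0 'k" where "t = - (\<Sum>i\<in>B. \<Sum>n\<le>Polynomial.degree (c i).
      pure (scal ?N (monom 1 n) (?e i), coeff (c i) n))"
  have bM: "b i \<in> carr M" if "i \<in> B" for i using M(2) that unfolding coordinates_def by blast
  have eN: "?e i \<in> carr ?N" if "i \<in> B" for i using cN that unfolding coordinates_def by blast
  have TQ: "T v \<in> poly_over (carr Q)" if "v \<in> carr M" for v using T that by (simp add: Chom_def)
  have cQ: "c i \<in> poly_over (carr Q)" if "i \<in> B" for i
  proof -
    have "point_functional Q 0 (\<lambda>_. 0)" by (simp add: point_functional_def)
    then show ?thesis unfolding c_def by (rule peval_subst_flip(1)[OF Q(1) _ TQ[OF bM[OF that]]])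
  qed
  have t: "t \<in> tensor2_free ?N Q"
    unfolding t_def
  proof (intro formal.subspace_neg[OF subspace_free2] formal.subspace_sum[OF subspace_free2])
    fix i n assume "i \<in> B"
    then show "pure (scal ?N (monom 1 n) (?e i), coeff (c i) n) \<in> tensor2_free ?N Q"
      using DN eN cQ unfolding tensor2_free_supported by (simp add: poly_over_def)
  qed
  have ev: "peval h \<alpha> (T v) = - eval2 (\<lambda>f. poly (f v) (\<alpha> + w)) h t"
    if v: "v \<in> carr M" and h: "point_functional Q w h" for v w h \<alpha>
  proof -
    have pf: "point_functional M (\<alpha> + w) (\<lambda>v. peval h \<alpha> (T v))"
      by (rule Chom_point_functional[OF M(1) Q(1) T h])
    have "- eval2 (\<lambda>f. poly (f v) (\<alpha> + w)) h t = (\<Sum>i\<in>B. \<Sum>n\<le>Polynomial.degree (c i).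
        poly (y i v) (\<alpha> + w) * ((- \<alpha> - w) ^ n * h (coeff (c i) n)))"
      unfolding t_def eval2_simps eval2_sum using v
      by (simp add: conf_dual_scal poly_pcompose poly_monom mult_ac)
    also have "\<dots> = (\<Sum>i\<in>B. poly (y i v) (\<alpha> + w) * peval h (- \<alpha> - w) (c i))"
      by (simp add: peval_def sum_distrib_left)
    also have "\<dots> = (\<Sum>i\<in>B. poly (y i v) (\<alpha> + w) * peval h \<alpha> (T (b i)))"
      by (intro sum.cong refl) (simp add: c_def peval_subst_flip(2)[OF Q(1) h TQ[OF bM]])
    also have "\<dots> = (\<Sum>i\<in>B. peval h \<alpha> (T (scal M (y i v) (b i))))"
      by (intro sum.cong refl) (simp add: point_functionalD(4)[OF pf bM])
    also have "\<dots> = peval h \<alpha> (T (\<Sum>i\<in>B. scal M (y i v) (b i)))"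
      using additive_on_sum[OF additive_on_point_functional[OF M(1) pf], of B
          "\<lambda>i. scal M (y i v) (b i)"] bM kd_moduleD[OF M(1)] by simp
    also have "(\<Sum>i\<in>B. scal M (y i v) (b i)) = v"
      using coordinates_superset[OF M v B] by auto
    finally show ?thesis by simp
  qed
  have phi_t: "phi_formal Q t = T"
  proof
    fix v
    show "phi_formal Q t v = T v"
    proof (cases "v \<in> carr M")
      case True
      show ?thesis
        by (rule poly_over_ext[OF Q phi_formal_eval(1)[OF Q(1) t] TQ[OF True]])
          (simp add: phi_formal_eval(2)[OF Q(1) t] ev[OF True])
    next
      case False
      then show ?thesis using phi_formal_outside[OF Q(1) M(1) t False] T by (simp add: Chom_def)
    qed
  qed
  let ?cl = "\<lambda>s. tensor2_rel ?N Q `` {s}"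
  note cl = tensor2_rel_quot_rel[of ?N Q]
  have phi_cl: "phi Q (?cl s) = phi_formal Q s" if s: "s \<in> tensor2_free ?N Q" for s
  proof -
    have "phi_formal Q u = phi_formal Q s" if "u \<in> ?cl s" for u
      using that phi_formal_eq_iff[OF Q M B s, of u] by (auto simp: tensor2_rel_def)
    then have "phi_formal Q ` ?cl s = {phi_formal Q s}"
      using class_mem[OF N s] unfolding cl by blast
    then show ?thesis by (simp add: phi_def)
  qed
  have inj: "inj_on (phi Q) (tensor2 ?N Q)"
  proof (rule inj_onI)
    fix X Y assume "X \<in> tensor2 ?N Q" "Y \<in> tensor2 ?N Q" and eq: "phi Q X = phi Q Y"
    then obtain s u where su: "s \<in> tensor2_free ?N Q" "X = ?cl s" "u \<in> tensor2_free ?N Q" "Y = ?cl u"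
      unfolding tensor2_def by (auto elim!: quotientE)
    then have "s - u \<in> tensor2_null ?N Q"
      using eq phi_cl phi_formal_eq_iff[OF Q M B, of s u] by simp
    then show "X = Y" using su class_eq_iff[OF N su(1,3)] by (simp add: cl)
  qed
  have "eta M Q T = ?cl t"
    unfolding eta_def
    by (rule the_inv_into_f_eq[OF inj]) (use phi_cl[OF t] phi_t t in \<open>auto simp: tensor2_def quotientI\<close>)
  with t ev show ?thesis using that by blast
qed


section \<open>Flips and inclusions of tensors\<close>

definition formal_flip :: "('a \<times> 'b \<Rightarrow>\<^sub>0 'k::field_char_0) \<Rightarrow> ('b \<times> 'a \<Rightarrow>\<^sub>0 'k)" where
  "formal_flip = lin_ext fscal (\<lambda>(a, b). pure (b, a))"

definition formal_incl :: "('n \<times> 'q \<Rightarrow>\<^sub>0 'k::field_char_0)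
    \<Rightarrow> ('q::zero \<times> 'n::zero) \<times> ('q \<times> 'n) \<Rightarrow>\<^sub>0 'k" where
  "formal_incl = lin_ext fscal (\<lambda>(x, a). pure ((0, x), (a, 0)))"

lemma eval2_flip: "eval2 f g (formal_flip t) = eval2 g f t"
  unfolding eval2_def formal_flip_def lin_ext_lin_ext
  by (rule lin_ext_cong) (auto simp: formal_eval_simps)

lemma eval2_incl: "eval2 f g (formal_incl t) = eval2 (\<lambda>x. f (0, x)) (\<lambda>a. g (a, 0)) t"
  unfolding eval2_def formal_incl_def lin_ext_lin_ext
  by (rule lin_ext_cong) (auto simp: formal_eval_simps)

lemma formal_flip_linear:
  "formal_flip (s + t) = formal_flip s + formal_flip t"
  "formal_flip (s - t) = formal_flip s - formal_flip t"
  "formal_flip (fscal c t) = fscal c (formal_flip t)"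
  "formal_flip (sum F A) = (\<Sum>i\<in>A. formal_flip (F i))"
  by (simp_all add: formal_flip_def lin_ext_add[OF formal.module_axioms]
      lin_ext_diff[OF formal.module_axioms]
      lin_ext_fscal[OF formal.module_axioms] lin_ext_sum[OF formal.module_axioms])

lemma formal_flip_flip: "formal_flip (formal_flip t) = t"
proof -
  have "formal_flip (lin_ext fscal F t) = lin_ext fscal (\<lambda>p. formal_flip (F p)) t"
    for F :: "'a \<times> 'b \<Rightarrow> ('b \<times> 'a \<Rightarrow>\<^sub>0 'c)" and t
    by (simp add: lin_ext_def[of fscal F] lin_ext_def[of fscal "\<lambda>p. formal_flip (F p)"]
        formal_flip_linear)
  note comp = this
  have "formal_flip (formal_flip t) = formal_flip (lin_ext fscal (\<lambda>(a, b). pure (b, a)) t)"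
    by (simp only: formal_flip_def)
  also have "\<dots> = lin_ext fscal (\<lambda>(a, b). formal_flip (pure (b, a))) t"
    unfolding comp by (simp add: case_prod_unfold)
  also have "\<dots> = lin_ext fscal pure t"
    by (rule lin_ext_cong) (auto simp: formal_flip_def lin_ext_pure[OF formal.module_axioms])
  finally show ?thesis by (simp add: lin_ext_pure_id)
qed

lemma tensor2_add_classes:
  assumes s: "s \<in> tensor2_free A B" and t: "t \<in> tensor2_free A B"
  shows "tensor2_add A B (tensor2_rel A B `` {s}) (tensor2_rel A B `` {t}) =
    tensor2_rel A B `` {s + t}"
proof -
  note N = subspace_null2[of A B] and F = subspace_free2[of A B]
  have "tensor2_rel A B `` {x + y} = tensor2_rel A B `` {s + t}"
    if "x \<in> tensor2_rel A B `` {s}" "y \<in> tensor2_rel A B `` {t}" for x y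
  proof -
    have xy: "x \<in> tensor2_free A B" "y \<in> tensor2_free A B" "s - x \<in> tensor2_null A B"
      "t - y \<in> tensor2_null A B" using that by (auto simp: tensor2_rel_def)
    have "s + t - (x + y) = (s - x) + (t - y)" by simp
    then have "s + t - (x + y) \<in> tensor2_null A B"
      using formal.subspace_add[OF N xy(3,4)] by (simp only:)
    then have "tensor2_rel A B `` {s + t} = tensor2_rel A B `` {x + y}"
      unfolding tensor2_rel_quot_rel
      by (subst class_eq_iff[OF N]) (use formal.subspace_add[OF F] s t xy in auto)
    then show ?thesis by simp
  qed
  moreover have "s \<in> tensor2_rel A B `` {s}" "t \<in> tensor2_rel A B `` {t}"
    unfolding tensor2_rel_quot_rel by (rule class_mem[OF N], fact)+
  ultimately show ?thesis unfolding tensor2_add_def on_classes_def by fast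
qed


section \<open>Point functionals on the semi-direct product\<close>

locale lca_representation_on_free =
  fixes Q :: "('k::field_char_0, 'q::ab_group_add) conf_alg"
    and M :: "('k, 'm::ab_group_add) kd_module"
    and l r :: "'q \<Rightarrow> 'm \<Rightarrow> 'm poly"
  assumes Q: "leibniz_conformal_algebra Q" and rep: "lca_representation Q M l r"
    and freeQ: "kd_free Q" and finM: "kd_finite M" and freeM: "kd_free M"
begin

abbreviation N :: "('k, 'm \<Rightarrow> 'k poly) kd_module" where "N \<equiv> conf_dual M"
abbreviation P :: "('k, 'q \<times> ('m \<Rightarrow> 'k poly)) conf_alg" where "P \<equiv> dual_semidirect Q M l r"

lemma kdQ: "kd_module Q" and kdM: "kd_module M" and kdN: "kd_module N"
  using Q rep kd_module_conf_dual
  by (auto simp: leibniz_conformal_algebra_def lca_representation_def)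

lemma kdP: "kd_module P"
  unfolding dual_semidirect_def by (rule kd_module_semidirect[OF kdQ kdN])

lemma l_hom: "kd_hom Q (Cend M) l" and r_hom: "kd_hom Q (Cend M) r"
  using rep by (auto simp: lca_representation_def)

lemma l_Cend: "a \<in> carr Q \<Longrightarrow> l a \<in> carr (Cend M)" and r_Cend: "a \<in> carr Q \<Longrightarrow> r a \<in> carr (Cend M)"
  using l_hom r_hom by (auto simp: kd_hom_def)

lemma l_poly: "a \<in> carr Q \<Longrightarrow> x \<in> carr M \<Longrightarrow> l a x \<in> poly_over (carr M)"
  and r_poly: "a \<in> carr Q \<Longrightarrow> x \<in> carr M \<Longrightarrow> r a x \<in> poly_over (carr M)"
  using l_Cend r_Cend by (auto simp: Chom_def)

lemma basisQ: "\<exists>BQ :: 'q set. \<exists>xQ. coordinates Q BQ xQ (\<lambda>b. b)"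
  using coordinates_of_free[OF kdQ freeQ] by metis

lemma basisM: "\<exists>BM :: 'm set. \<exists>xM. coordinates M BM xM (\<lambda>b. b) \<and> finite BM"
  using coordinates_of_free[OF kdM freeM] finite_basis[OF kdM finM] by metis

lemma P_coordinates:
  obtains I :: "('q + 'm) set" and x e where "coordinates P I x e"
proof -
  obtain BQ :: "'q set" and xQ where cQ: "coordinates Q BQ xQ (\<lambda>b. b)" using basisQ by blast
  obtain BM :: "'m set" and xM where cM: "coordinates M BM xM (\<lambda>b. b)" "finite BM"
    using basisM by blast
  show ?thesis
    using that semidirect_coordinates[OF kdQ cQ kdN conf_dual_coordinates[OF kdM cM]]
    unfolding dual_semidirect_def by blast
qed

lemma P_carr: "carr P = carr Q \<times> carr N"
  by (simp add: dual_semidirect_def semidirect_simps)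

text \<open>As \<open>\<partial>\<close> acts on \<open>M\<^sup>*\<^sup>c\<close> as \<open>-\<lambda>\<close>, a functional of weight \<open>w\<close> evaluates \<open>f\<close> at \<open>-w\<close>.\<close>

definition P_functional :: "'k \<Rightarrow> ('q \<Rightarrow> 'k) \<Rightarrow> 'm \<Rightarrow> 'q \<times> ('m \<Rightarrow> 'k poly) \<Rightarrow> 'k" where
  "P_functional w h x = (\<lambda>(a, f). h a + poly (f x) (- w))"

lemma P_functional_point_functional:
  assumes "point_functional Q w h" "x \<in> carr M"
  shows "point_functional P w (P_functional w h x)"
  unfolding P_functional_def dual_semidirect_def
  by (rule semidirect_point_functional(1)[OF kdQ kdN assms(1) eval_point_functional(1)[OF kdM assms(2)]])

lemma P_functional_cases:
  assumes \<theta>: "point_functional P w \<theta>"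
  obtains h x where "point_functional Q w h" "x \<in> carr M"
    "\<And>p. p \<in> carr P \<Longrightarrow> \<theta> p = P_functional w h x p"
proof -
  obtain BM :: "'m set" and xM where cM: "coordinates M BM xM (\<lambda>b. b)" "finite BM"
    using basisM by blast
  note s = semidirect_point_functional(2-4)[OF kdQ kdN \<theta>[unfolded dual_semidirect_def]]
  obtain x where x: "x \<in> carr M" "\<And>f. f \<in> carr N \<Longrightarrow> \<theta> (0, f) = poly (f x) (- w)"
    by (rule conf_dual_functional[OF kdM cM s(2)]) auto
  have "\<theta> p = P_functional w (\<lambda>a. \<theta> (a, 0)) x p" if "p \<in> carr P" for p
    using that s(3) x(2) by (auto simp: P_carr P_functional_def)
  with s(1) x(1) that show ?thesis by blast
qed

text \<open>The value of the bracket of \<open>P\<close> at \<open>\<mu>\<close> under \<open>P_functional w h x\<close>, in which the dual actions are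
  moved from \<open>M\<^sup>*\<^sup>c\<close> to \<open>x\<close>.\<close>

definition bracket_eval :: "'k \<Rightarrow> ('q \<Rightarrow> 'k) \<Rightarrow> 'm \<Rightarrow> 'k
    \<Rightarrow> 'q \<times> ('m \<Rightarrow> 'k poly) \<Rightarrow> 'q \<times> ('m \<Rightarrow> 'k poly) \<Rightarrow> 'k" where
  "bracket_eval w h x \<mu> = (\<lambda>(a, f) (b, g). peval h \<mu> (br Q a b)
     - peval (\<lambda>u. poly (g u) (- w - \<mu>)) \<mu> (l a x)
     + (peval (\<lambda>u. poly (f u) \<mu>) (- w - \<mu>) (l b x) + peval (\<lambda>u. poly (f u) \<mu>) (- w - \<mu>) (r b x)))"

lemma bracket_P:
  assumes p: "p \<in> carr P" and q: "q \<in> carr P"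
  shows "br P p q \<in> poly_over (carr P)"
    and "point_functional Q w h \<Longrightarrow> x \<in> carr M \<Longrightarrow>
      peval (P_functional w h x) \<mu> (br P p q) = bracket_eval w h x \<mu> p q"
proof -
  obtain a f b g where pq: "p = (a, f)" "q = (b, g)" "a \<in> carr Q" "f \<in> carr N" "b \<in> carr Q" "g \<in> carr N"
    using p q by (auto simp: P_carr)
  let ?D1 = "br Q a b" and ?D2 = "dual_act M l a g"
  let ?D3 = "- dual_act M l b f - dual_act M r b f"
  let ?F = "subst_op (- lam1 - del1 N) const1 ?D3"
  have br: "br P p q = map_poly (\<lambda>d. (d, 0)) ?D1 + map_poly (\<lambda>z. (0, z)) (?D2 + ?F)"
    by (simp add: dual_semidirect_def semidirect_def flip_act_def pq)
  have D1: "?D1 \<in> poly_over (carr Q)" using Q pq by (simp add: leibniz_conformal_algebra_def)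
  have da: "dual_act M l a g \<in> poly_over (carr N)" "dual_act M l b f \<in> poly_over (carr N)"
    "dual_act M r b f \<in> poly_over (carr N)"
    using dual_act_props(1)[where l = l and a = a, OF kdM finM l_Cend[OF pq(3)] pq(6)]
      dual_act_props(1)[where l = l and a = b, OF kdM finM l_Cend[OF pq(5)] pq(4)]
      dual_act_props(1)[where l = r and a = b, OF kdM finM r_Cend[OF pq(5)] pq(4)] by auto
  have D3: "?D3 \<in> poly_over (carr N)" using poly_over_diff[OF kdN] poly_over_minus[OF kdN] da by blast
  have zero: "point_functional N 0 (\<lambda>_. 0)" by (simp add: point_functional_def)
  have F: "?F \<in> poly_over (carr N)" by (rule peval_subst_flip(1)[OF kdN zero D3])
  have D2F: "?D2 + ?F \<in> poly_over (carr N)" by (rule poly_over_add[OF kdN da(1) F])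
  have m1: "map_poly (\<lambda>d. (d, 0)) ?D1 \<in> poly_over (carr P)"
    by (rule map_poly_poly_over[OF _ _ D1]) (auto simp: P_carr kd_moduleD[OF kdN] zero_prod_def)
  have m2: "map_poly (\<lambda>z. (0, z)) (?D2 + ?F) \<in> poly_over (carr P)"
    by (rule map_poly_poly_over[OF _ _ D2F]) (auto simp: P_carr kd_moduleD[OF kdQ] zero_prod_def)
  show "br P p q \<in> poly_over (carr P)" unfolding br by (rule poly_over_add[OF kdP m1 m2])
  assume h: "point_functional Q w h" and x: "x \<in> carr M"
  let ?\<theta> = "P_functional w h x" and ?g = "\<lambda>f :: 'm \<Rightarrow> 'k poly. poly (f x) (- w)"
  note \<theta> = P_functional_point_functional[OF h x] and g = eval_point_functional(1)[OF kdM x, of w]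
  have h0: "h 0 = 0" by (rule point_functional_0[OF kdQ h])
  have "peval ?\<theta> \<mu> (br P p q) = peval h \<mu> ?D1 + peval ?g \<mu> (?D2 + ?F)"
    unfolding br peval_add[OF kdP \<theta> m1 m2]
    by (subst (1 2) peval_map_poly) (auto simp: P_functional_def h0 zero_prod_def)
  also have "peval ?g \<mu> (?D2 + ?F) = peval ?g \<mu> ?D2 + peval ?g (- \<mu> - w) ?D3"
    by (simp add: peval_add[OF kdN g da(1) F] peval_subst_flip(2)[OF kdN g D3])
  also have "peval ?g (- \<mu> - w) ?D3 =
      - peval ?g (- \<mu> - w) (dual_act M l b f) - peval ?g (- \<mu> - w) (dual_act M r b f)"
    using peval_minus[OF kdN g da(2)] peval_add[OF kdN g poly_over_minus[OF kdN da(2)]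
        poly_over_minus[OF kdN da(3)]] peval_minus[OF kdN g da(3)] by simp
  finally have *: "peval ?\<theta> \<mu> (br P p q) = peval h \<mu> ?D1 + (peval ?g \<mu> ?D2 +
      (- peval ?g (- \<mu> - w) (dual_act M l b f) - peval ?g (- \<mu> - w) (dual_act M r b f)))" .
  have commute: "- w - \<mu> = - \<mu> - w" by simp
  show "peval ?\<theta> \<mu> (br P p q) = bracket_eval w h x \<mu> p q"
    unfolding *
    using dual_act_props(2)[where l = l and a = a, OF kdM finM l_Cend[OF pq(3)] pq(6) x]
      dual_act_props(2)[where l = l and a = b, OF kdM finM l_Cend[OF pq(5)] pq(4) x]
      dual_act_props(2)[where l = r and a = b, OF kdM finM r_Cend[OF pq(5)] pq(4) x]
    by (simp add: bracket_eval_def pq commute algebra_simps)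
qed

text \<open>The first slot of every term carries the weight \<open>-\<mu>\<close>: for \<open>f\<close> this is evaluation at \<open>\<mu>\<close>.  The second
  carries \<open>\<mu> + w\<close>: for \<open>g\<close> this is evaluation at \<open>-w-\<mu>\<close>, and \<open>l(b)\<close>, \<open>r(b)\<close> are taken at
  \<open>-w-\<mu>\<close>.\<close>

lemma bracket_eval_point_functional:
  assumes h: "point_functional Q w h" and x: "x \<in> carr M"
  shows "q \<in> carr P \<Longrightarrow> point_functional P (- \<mu>) (\<lambda>p. bracket_eval w h x \<mu> p q)"
    and "p \<in> carr P \<Longrightarrow> point_functional P (\<mu> + w) (\<lambda>q. bracket_eval w h x \<mu> p q)"
proof -
  have br1: "point_functional Q (- \<mu>) (\<lambda>a. peval h \<mu> (br Q a b))" if "b \<in> carr Q" for b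
    by (rule bracket_point_functional(1)[OF Q h that])
  have br2: "point_functional Q (\<mu> + w) (\<lambda>b. peval h \<mu> (br Q a b))" if "a \<in> carr Q" for a
    by (rule bracket_point_functional(2)[OF Q h that])
  have la: "point_functional Q (- \<alpha>) (\<lambda>a. peval (\<lambda>u. poly (f u) \<beta>) \<alpha> (l a x))"
    "point_functional Q (- \<alpha>) (\<lambda>a. peval (\<lambda>u. poly (f u) \<beta>) \<alpha> (r a x))"
    if "f \<in> carr N" for f \<alpha> \<beta>
    using kd_hom_Cend_point_functional(1)[OF kdQ kdM _ eval_point_functional(2)[OF kdM that] x]
      l_hom r_hom by auto
  note fu = peval_dual_point_functional[of M]
  show "point_functional P (- \<mu>) (\<lambda>p. bracket_eval w h x \<mu> p q)" if qP: "q \<in> carr P"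
  proof -
    obtain b g where q: "q = (b, g)" "b \<in> carr Q" "g \<in> carr N" using qP by (auto simp: P_carr)
    have 1: "point_functional Q (- \<mu>) (\<lambda>a. peval h \<mu> (br Q a b)
        - peval (\<lambda>u. poly (g u) (- w - \<mu>)) \<mu> (l a x))"
      using br1[OF q(2)] la(1)[OF q(3), of \<mu>] by (simp add: point_functional_def algebra_simps)
    have 2: "point_functional N (- \<mu>) (\<lambda>f. peval (\<lambda>u. poly (f u) \<mu>) (- w - \<mu>) (l b x)
        + peval (\<lambda>u. poly (f u) \<mu>) (- w - \<mu>) (r b x))"
      using fu[of \<mu> "- w - \<mu>" "l b x"] fu[of \<mu> "- w - \<mu>" "r b x"]
      by (simp add: point_functional_def algebra_simps)
    show ?thesis
      using semidirect_point_functional(1)[OF kdQ kdN 1 2]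
      by (simp add: bracket_eval_def q case_prod_unfold dual_semidirect_def)
  qed
  show "point_functional P (\<mu> + w) (\<lambda>q. bracket_eval w h x \<mu> p q)" if pP: "p \<in> carr P"
  proof -
    obtain a f where p: "p = (a, f)" "a \<in> carr Q" "f \<in> carr N" using pP by (auto simp: P_carr)
    have 1: "point_functional Q (\<mu> + w) (\<lambda>b. peval h \<mu> (br Q a b) +
        (peval (\<lambda>u. poly (f u) \<mu>) (- w - \<mu>) (l b x) + peval (\<lambda>u. poly (f u) \<mu>) (- w - \<mu>) (r b x)))"
      using br2[OF p(2)] la(1)[OF p(3), of "- w - \<mu>"] la(2)[OF p(3), of "- w - \<mu>"]
      by (simp add: point_functional_def algebra_simps)
    have 2: "point_functional N (\<mu> + w) (\<lambda>g. - peval (\<lambda>u. poly (g u) (- w - \<mu>)) \<mu> (l a x))"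
      using fu[of "- w - \<mu>" \<mu> "l a x"] by (simp add: point_functional_def algebra_simps)
    show ?thesis
      using semidirect_point_functional(1)[OF kdQ kdN 1 2]
      by (simp add: bracket_eval_def p case_prod_unfold dual_semidirect_def algebra_simps)
  qed
qed

lemma bracket_P_point_functional:
  assumes \<theta>: "point_functional P w \<theta>"
  shows "q \<in> carr P \<Longrightarrow> point_functional P (- \<mu>) (\<lambda>p. peval \<theta> \<mu> (br P p q))"
    and "p \<in> carr P \<Longrightarrow> point_functional P (\<mu> + w) (\<lambda>q. peval \<theta> \<mu> (br P p q))"
proof -
  obtain h x where hx: "point_functional Q w h" "x \<in> carr M"
    "\<And>p. p \<in> carr P \<Longrightarrow> \<theta> p = P_functional w h x p"
    using P_functional_cases[OF \<theta>] by metis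
  have eq: "peval \<theta> \<mu> (br P p q) = bracket_eval w h x \<mu> p q" if "p \<in> carr P" "q \<in> carr P" for p q
    using bracket_P[OF that] hx by (simp add: poly_over_def cong: peval_cong)
  show "q \<in> carr P \<Longrightarrow> point_functional P (- \<mu>) (\<lambda>p. peval \<theta> \<mu> (br P p q))"
    by (rule point_functional_cong[OF kdP bracket_eval_point_functional(1)[OF hx(1,2)]]) (use eq in auto)
  show "p \<in> carr P \<Longrightarrow> point_functional P (\<mu> + w) (\<lambda>q. peval \<theta> \<mu> (br P p q))"
    by (rule point_functional_cong[OF kdP bracket_eval_point_functional(2)[OF hx(1,2)]]) (use eq in auto)
qed


section \<open>The Yang-Baxter expression under point functionals\<close>

text \<open>The value of \<^const>\<open>yb_term\<close> under functionals with weights \<open>u\<close>, \<open>v\<close> in the first two factors, so that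
  \<open>\<partial>\<^sub>1\<close> and \<open>\<partial>\<^sub>2\<close> become \<open>u\<close> and \<open>v\<close>.\<close>

definition yb_eval :: "('q \<times> ('m \<Rightarrow> 'k poly) \<Rightarrow> 'k) \<Rightarrow> ('q \<times> ('m \<Rightarrow> 'k poly) \<Rightarrow> 'k)
    \<Rightarrow> ('q \<times> ('m \<Rightarrow> 'k poly) \<Rightarrow> 'k) \<Rightarrow> 'k \<Rightarrow> 'k
    \<Rightarrow> ('q \<times> ('m \<Rightarrow> 'k poly)) \<times> ('q \<times> ('m \<Rightarrow> 'k poly))
    \<Rightarrow> ('q \<times> ('m \<Rightarrow> 'k poly)) \<times> ('q \<times> ('m \<Rightarrow> 'k poly)) \<Rightarrow> 'k" where
  "yb_eval f g h u v = (\<lambda>(a, b) (a', b').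
       peval f v (br P a a') * g b * h b' + f a * g a' * peval h v (br P b' b)
     - f a * peval g u (br P b a') * h b' - f a * peval g (- u - v) (br P a' b) * h b')"

lemma yb_term_eval:
  assumes f: "point_functional P u f" and g: "point_functional P v g" and h: "point_functional P w h"
    and p: "p \<in> carr P \<times> carr P" and q: "q \<in> carr P \<times> carr P"
  shows "yb_term P p q \<in> tensor3_free P" "eval3 f g h (yb_term P p q) = yb_eval f g h u v p q"
proof -
  obtain a b a' b' where pq: "p = (a, b)" "q = (a', b')" "a \<in> carr P" "b \<in> carr P"
    "a' \<in> carr P" "b' \<in> carr P" using p q by auto
  note X = eigen_d[OF kdP f g h]
  have X4: "eigen_on (tensor3_free P) (- d1 P - d2 P) (- u - v) (eval3 f g h)"
    unfolding eigen_on_def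
  proof (intro conjI ballI eval3_additive)
    fix s assume s: "s \<in> tensor3_free P"
    show "(- d1 P - d2 P) s \<in> tensor3_free P"
      using formal.subspace_diff[OF subspace_free3
          formal.subspace_neg[OF subspace_free3 d_free(1)[OF kdP s]] d_free(2)[OF kdP s]] by simp
    show "eval3 f g h ((- d1 P - d2 P) s) = (- u - v) * eval3 f g h s"
      using X(1,2) s by (simp add: eigen_on_def algebra_simps)
  qed
  have b: "coeff (br P c d) n \<in> carr P" if "c \<in> carr P" "d \<in> carr P" for c d n
    using bracket_P(1)[OF that] by (simp add: poly_over_def)
  have E: "\<forall>n. pure (coeff (br P a a') n, b, b') \<in> tensor3_free P"
    "\<forall>n. pure (a, a', coeff (br P b' b) n) \<in> tensor3_free P"
    "\<forall>n. pure (a, coeff (br P b a') n, b') \<in> tensor3_free P"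
    "\<forall>n. pure (a, coeff (br P a' b) n, b') \<in> tensor3_free P"
    using pq b by (auto simp: tensor3_free_supported)
  note S1 = subst_op_eval[where E = "\<lambda>u. pure (u, b, b')", OF X(2) E(1)]
    and S2 = subst_op_eval[where E = "\<lambda>u. pure (a, a', u)", OF X(2) E(2)]
    and S3 = subst_op_eval[where E = "\<lambda>u. pure (a, u, b')", OF X(1) E(3)]
    and S4 = subst_op_eval[where E = "\<lambda>u. pure (a, u, b')", OF X4 E(4)]
  show "yb_term P p q \<in> tensor3_free P"
    unfolding yb_term_def pq prod.case
    by (intro formal.subspace_diff[OF subspace_free3] formal.subspace_add[OF subspace_free3]
        S1(1) S2(1) S3(1) S4(1))
  show "eval3 f g h (yb_term P p q) = yb_eval f g h u v p q"
    unfolding yb_term_def yb_eval_def pq prod.case eval3_simps S1(2) S2(2) S3(2) S4(2)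
      peval_mult_const_fun peval_cmult_fun by simp
qed

lemma yb_formal_eval:
  assumes f: "point_functional P u f" and g: "point_functional P v g" and h: "point_functional P w h"
    and t: "t \<in> tensor2_free P P"
  shows "yb_formal P t \<in> tensor3_free P"
    and "eval3 f g h (yb_formal P t) = lin_ext (*) (\<lambda>p. lin_ext (*) (yb_eval f g h u v p) t) t"
proof -
  have k: "p \<in> carr P \<times> carr P" if "p \<in> Poly_Mapping.keys t" for p
    using t that by (auto simp: tensor2_free_def)
  show "yb_formal P t \<in> tensor3_free P"
    unfolding yb_formal_def
    by (intro lin_ext_in_subspace[OF subspace_free3] yb_term_eval(1)[OF f g h] k)
  have "eval3 f g h (yb_formal P t) =
      lin_ext (*) (\<lambda>p. lin_ext (*) (\<lambda>q. eval3 f g h (yb_term P p q)) t) t"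
    unfolding yb_formal_def eval3_def lin_ext_lin_ext by simp
  also have "\<dots> = lin_ext (*) (\<lambda>p. lin_ext (*) (yb_eval f g h u v p) t) t"
    by (intro lin_ext_cong yb_term_eval(2)[OF f g h] k)
  finally show "eval3 f g h (yb_formal P t) =
      lin_ext (*) (\<lambda>p. lin_ext (*) (yb_eval f g h u v p) t) t" .
qed

lemma yb_eval_linear:
  assumes f: "point_functional P u f" and g: "point_functional P v g" and h: "point_functional P w h"
    and q: "q \<in> carr P \<times> carr P" and c: "a \<in> carr P" "a' \<in> carr P" "b \<in> carr P" "b' \<in> carr P"
  shows "yb_eval f g h u v (a + a', b) q = yb_eval f g h u v (a, b) q + yb_eval f g h u v (a', b) q"
    "yb_eval f g h u v (a, b + b') q = yb_eval f g h u v (a, b) q + yb_eval f g h u v (a, b') q"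
    "yb_eval f g h u v (kscal P c a, b) q = c * yb_eval f g h u v (a, b) q"
    "yb_eval f g h u v (a, kscal P c b) q = c * yb_eval f g h u v (a, b) q"
    "yb_eval f g h u v q (a + a', b) = yb_eval f g h u v q (a, b) + yb_eval f g h u v q (a', b)"
    "yb_eval f g h u v q (a, b + b') = yb_eval f g h u v q (a, b) + yb_eval f g h u v q (a, b')"
    "yb_eval f g h u v q (kscal P c a, b) = c * yb_eval f g h u v q (a, b)"
    "yb_eval f g h u v q (a, kscal P c b) = c * yb_eval f g h u v q (a, b)"
proof -
  obtain d e where q_eq: "q = (d, e)" "d \<in> carr P" "e \<in> carr P" using q by auto
  have lin: "peval \<theta> \<mu> (br P (x + y) z) = peval \<theta> \<mu> (br P x z) + peval \<theta> \<mu> (br P y z)"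
    "peval \<theta> \<mu> (br P z (x + y)) = peval \<theta> \<mu> (br P z x) + peval \<theta> \<mu> (br P z y)"
    "peval \<theta> \<mu> (br P (kscal P c x) z) = c * peval \<theta> \<mu> (br P x z)"
    "peval \<theta> \<mu> (br P z (kscal P c x)) = c * peval \<theta> \<mu> (br P z x)"
    if "point_functional P w' \<theta>" "x \<in> carr P" "y \<in> carr P" "z \<in> carr P" for \<theta> w' \<mu> x y z c
    using point_functionalD[OF bracket_P_point_functional(1)[OF that(1,4)]]
      point_functionalD[OF bracket_P_point_functional(2)[OF that(1,4)]] that by auto
  note L = lin[OF f] lin[OF g] lin[OF h] point_functionalD(1,2)[OF f] point_functionalD(1,2)[OF g]
    point_functionalD(1,2)[OF h]
  show "yb_eval f g h u v (a + a', b) q = yb_eval f g h u v (a, b) q + yb_eval f g h u v (a', b) q"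
    "yb_eval f g h u v (a, b + b') q = yb_eval f g h u v (a, b) q + yb_eval f g h u v (a, b') q"
    "yb_eval f g h u v (kscal P c a, b) q = c * yb_eval f g h u v (a, b) q"
    "yb_eval f g h u v (a, kscal P c b) q = c * yb_eval f g h u v (a, b) q"
    "yb_eval f g h u v q (a + a', b) = yb_eval f g h u v q (a, b) + yb_eval f g h u v q (a', b)"
    "yb_eval f g h u v q (a, b + b') = yb_eval f g h u v q (a, b) + yb_eval f g h u v q (a, b')"
    "yb_eval f g h u v q (kscal P c a, b) = c * yb_eval f g h u v q (a, b)"
    "yb_eval f g h u v q (a, kscal P c b) = c * yb_eval f g h u v q (a, b)"
    unfolding yb_eval_def q_eq prod.case using c q_eq(2,3)
    by (simp_all add: L algebra_simps)
qed

text \<open>The value of \<open>[[r,r]]\<close> under a product of three point functionals is quadratic in \<open>r\<close>, and the associated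
  bilinear form vanishes if one of its arguments represents zero.\<close>

lemma yb_formal_respects:
  assumes s: "s \<in> tensor2_free P P" and t: "t \<in> tensor2_free P P" and n: "s - t \<in> tensor2_null P P"
  shows "yb_formal P s - yb_formal P t \<in> tensor3_null P"
proof -
  obtain I :: "('q + 'm) set" and x e where C: "coordinates P I x e" by (rule P_coordinates)
  have zero: "point_functional P 0 (\<lambda>_. 0)" by (simp add: point_functional_def)
  note fr = yb_formal_eval(1)[OF zero zero zero]
  show ?thesis
  proof (rule tensor3_null_of_eval[OF kdP C formal.subspace_diff[OF subspace_free3 fr[OF s] fr[OF t]]])
    fix i j k u v w assume "i \<in> I" "j \<in> I" "k \<in> I"
    then have f: "point_functional P u (\<lambda>a. poly (x i a) u)" and
      g: "point_functional P v (\<lambda>a. poly (x j a) v)" and h: "point_functional P w (\<lambda>a. poly (x k a) w)"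
      by (auto intro: coordinates_point_functional[OF kdP C])
    let ?G = "yb_eval (\<lambda>a. poly (x i a) u) (\<lambda>a. poly (x j a) v) (\<lambda>a. poly (x k a) w) u v"
    note lin = yb_eval_linear[OF f g h]
    have k: "p \<in> carr P \<times> carr P" if "p \<in> Poly_Mapping.keys t'" "t' \<in> tensor2_free P P" for p t'
      using that by (auto simp: tensor2_free_def)
    have 1: "lin_ext (*) (\<lambda>p. lin_ext (*) (?G p) s) (s - t) = 0"
    proof (rule lin_ext_null2[OF n])
      fix a a' b assume c: "a \<in> carr P" "a' \<in> carr P" "b \<in> carr P"
      show "lin_ext (*) (?G (a + a', b)) s = lin_ext (*) (?G (a, b)) s + lin_ext (*) (?G (a', b)) s"
        unfolding lin_ext_add_fun[symmetric]
        by (rule lin_ext_cong) (rule lin(1)[OF k[OF _ s]], use c in auto)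
    next
      fix a b b' assume c: "a \<in> carr P" "b \<in> carr P" "b' \<in> carr P"
      show "lin_ext (*) (?G (a, b + b')) s = lin_ext (*) (?G (a, b)) s + lin_ext (*) (?G (a, b')) s"
        unfolding lin_ext_add_fun[symmetric]
        by (rule lin_ext_cong) (rule lin(2)[OF k[OF _ s]], use c in auto)
    next
      fix c a b assume ab: "a \<in> carr P" "b \<in> carr P"
      show "lin_ext (*) (?G (kscal P c a, b)) s = c * lin_ext (*) (?G (a, b)) s"
        unfolding lin_ext_cmult_fun[symmetric]
        by (rule lin_ext_cong) (rule lin(3)[OF k[OF _ s]], use ab in auto)
      show "lin_ext (*) (?G (a, kscal P c b)) s = c * lin_ext (*) (?G (a, b)) s"
        unfolding lin_ext_cmult_fun[symmetric]
        by (rule lin_ext_cong) (rule lin(4)[OF k[OF _ s]], use ab in auto)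
    qed
    have 2: "lin_ext (*) (?G p) (s - t) = 0" if "p \<in> Poly_Mapping.keys t" for p
    proof (rule lin_ext_null2[OF n])
      note l' = lin(5-8)[OF k[OF that t]]
      show "?G p (a + a', b) = ?G p (a, b) + ?G p (a', b)"
        if "a \<in> carr P" "a' \<in> carr P" "b \<in> carr P" for a a' b
        using l'(1)[of a a' b b] that by simp
      show "?G p (a, b + b') = ?G p (a, b) + ?G p (a, b')"
        if "a \<in> carr P" "b \<in> carr P" "b' \<in> carr P" for a b b'
        using l'(2)[of a a b b'] that by simp
      show "?G p (kscal P c a, b) = c * ?G p (a, b)" if "a \<in> carr P" "b \<in> carr P" for c a b
        using l'(3)[of a a b b] that by simp
      show "?G p (a, kscal P c b) = c * ?G p (a, b)" if "a \<in> carr P" "b \<in> carr P" for c a b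
        using l'(4)[of a a b b] that by simp
    qed
    have "lin_ext (*) (\<lambda>p. lin_ext (*) (?G p) (s - t)) t = 0"
      unfolding lin_ext_def[of _ _ t] using 2 by (intro sum.neutral) simp
    then have "lin_ext (*) (\<lambda>p. lin_ext (*) (?G p) s) t = lin_ext (*) (\<lambda>p. lin_ext (*) (?G p) t) t"
      by (simp add: lin_ext_diff[OF module_times] lin_ext_diff_fun)
    then show "eval3 (\<lambda>a. poly (x i a) u) (\<lambda>a. poly (x j a) v) (\<lambda>a. poly (x k a) w)
        (yb_formal P s - yb_formal P t) = 0"
      using 1 yb_formal_eval(2)[OF f g h s] yb_formal_eval(2)[OF f g h t]
      by (simp add: lin_ext_diff[OF module_times])
  qed
qed

end


section \<open>Solutions of the Yang-Baxter equation\<close>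

text \<open>The total derivative is well defined on classes, because products of point functionals scale by the
  sum of their weights under it.\<close>

lemma CLCYBE_solution_class:
  fixes P :: "('k::field_char_0, 'p::ab_group_add, 'z) conf_alg_scheme"
  assumes P: "kd_module P" "coordinates P I x e" and u: "u \<in> tensor2_free P P"
    and free: "\<And>s. s \<in> tensor2_free P P \<Longrightarrow> yb_formal P s \<in> tensor3_free P"
    and resp: "\<And>s t. s \<in> tensor2_free P P \<Longrightarrow> t \<in> tensor2_free P P \<Longrightarrow>
       s - t \<in> tensor2_null P P \<Longrightarrow> yb_formal P s - yb_formal P t \<in> tensor3_null P"
  shows "CLCYBE_solution P (tensor2_rel P P `` {u}) \<longleftrightarrow> yb_formal P u \<in> exact3 P"
proof -
  let ?D = "d1 P + d2 P + d3 P"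
  note N2 = subspace_null2[of P P] and N3 = subspace_null3[of P] and F3 = subspace_free3[of P]
  let ?cl = "\<lambda>s. tensor3_rel P `` {s}"
  have D_free: "?D s \<in> tensor3_free P" if "s \<in> tensor3_free P" for s
    using formal.subspace_add[OF F3 formal.subspace_add[OF F3 d_free(1)[OF P(1) that] d_free(2)[OF P(1) that]]
        d_free(3)[OF P(1) that]] by simp
  have D_null: "?D s - ?D t \<in> tensor3_null P"
    if st: "s \<in> tensor3_free P" "t \<in> tensor3_free P" "s - t \<in> tensor3_null P" for s t
  proof (rule tensor3_null_of_eval[OF P formal.subspace_diff[OF F3 D_free[OF st(1)] D_free[OF st(2)]]])
    fix i j k a b c assume "i \<in> I" "j \<in> I" "k \<in> I"
    then have f: "point_functional P a (\<lambda>v. poly (x i v) a)" and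
      g: "point_functional P b (\<lambda>v. poly (x j v) b)" and h: "point_functional P c (\<lambda>v. poly (x k v) c)"
      by (auto intro: coordinates_point_functional[OF P])
    let ?e = "eval3 (\<lambda>v. poly (x i v) a) (\<lambda>v. poly (x j v) b) (\<lambda>v. poly (x k v) c)"
    have "?e (?D s) = (a + b + c) * ?e s" if "s \<in> tensor3_free P" for s
      using eigen_d[OF P(1) f g h] that by (simp add: eigen_on_def algebra_simps)
    moreover have "?e s = ?e t" using eval3_null[OF f g h st(3)] by simp
    ultimately show "?e (?D s - ?D t) = 0" using st by simp
  qed
  have yb: "yb_bracket P (tensor2_rel P P `` {u}) = ?cl (yb_formal P u)"
    unfolding yb_bracket_def tensor2_rel_quot_rel tensor3_rel_quot_rel
    by (rule on_classes_class[OF N2 N3 u]) (use free resp u in auto)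
  have cl_D: "on_classes (tensor3_rel P) ?D (?cl s) = ?cl (?D s)" if "s \<in> tensor3_free P" for s
    unfolding tensor3_rel_quot_rel
    by (rule on_classes_class[OF N3 N3 that]) (use D_free D_null that in auto)
  have "CLCYBE_solution P (tensor2_rel P P `` {u}) \<longleftrightarrow>
      (\<exists>s\<in>tensor3_free P. ?cl (yb_formal P u) = ?cl (?D s))"
  proof
    assume "CLCYBE_solution P (tensor2_rel P P `` {u})"
    then obtain X where X: "X \<in> tensor3 P" "?cl (yb_formal P u) = on_classes (tensor3_rel P) ?D X"
      unfolding CLCYBE_solution_def yb by blast
    then obtain s where "s \<in> tensor3_free P" "X = ?cl s"
      unfolding tensor3_def by (auto elim!: quotientE)
    then show "\<exists>s\<in>tensor3_free P. ?cl (yb_formal P u) = ?cl (?D s)" using X(2) cl_D by auto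
  next
    assume "\<exists>s\<in>tensor3_free P. ?cl (yb_formal P u) = ?cl (?D s)"
    then obtain s where s: "s \<in> tensor3_free P" "?cl (yb_formal P u) = on_classes (tensor3_rel P) ?D (?cl s)"
      using cl_D by auto
    moreover have "?cl s \<in> tensor3 P" unfolding tensor3_def using s(1) by (rule quotientI)
    moreover have "tensor2_rel P P `` {u} \<in> tensor2 P P" unfolding tensor2_def using u by (rule quotientI)
    ultimately show "CLCYBE_solution P (tensor2_rel P P `` {u})"
      unfolding CLCYBE_solution_def yb by blast
  qed
  also have "\<dots> \<longleftrightarrow> (\<exists>s\<in>tensor3_free P. yb_formal P u - ?D s \<in> tensor3_null P)"
    unfolding tensor3_rel_quot_rel
    by (rule bex_cong[OF refl]) (rule class_eq_iff[OF N3 free[OF u] D_free])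
  finally show ?thesis by (simp add: exact3_def)
qed

section \<open>Contracting the symmetrised tensor\<close>

text \<open>The assumption on values says that \<open>\<phi>\<close> maps the class of \<open>t\<close> to \<open>T\<close>, so that \<open>t\<close> represents
  \<open>\<eta>(T)\<close>.\<close>

locale lca_tensor = lca_representation_on_free Q M l r
  for Q :: "('k::field_char_0, 'q::ab_group_add) conf_alg"
    and M :: "('k, 'm::ab_group_add) kd_module"
    and l r :: "'q \<Rightarrow> 'm \<Rightarrow> 'm poly" +
  fixes T :: "'m \<Rightarrow> 'q poly" and t :: "('m \<Rightarrow> 'k poly) \<times> 'q \<Rightarrow>\<^sub>0 'k"
  assumes T: "T \<in> carr (Chom M Q)"
    and t: "t \<in> tensor2_free (conf_dual M) Q"
    and T_eval: "\<And>v w h \<alpha>. v \<in> carr M \<Longrightarrow> point_functional Q w h \<Longrightarrow>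
       peval h \<alpha> (T v) = - eval2 (\<lambda>f. poly (f v) (\<alpha> + w)) h t"
begin

abbreviation T0 :: "'m \<Rightarrow> 'q" where "T0 v \<equiv> coeff (T v) 0"

definition symmetrised :: "('q \<times> ('m \<Rightarrow> 'k poly)) \<times> ('q \<times> ('m \<Rightarrow> 'k poly)) \<Rightarrow>\<^sub>0 'k" where
  "symmetrised = formal_incl t + formal_flip (formal_incl t)"

lemma T0_carr: "v \<in> carr M \<Longrightarrow> T0 v \<in> carr Q"
  using T by (simp add: Chom_def poly_over_def)

lemma T0_eval:
  "v \<in> carr M \<Longrightarrow> point_functional Q w h \<Longrightarrow> h (T0 v) = - eval2 (\<lambda>f. poly (f v) w) h t"
  using T_eval[of v w h 0] coeff_0_const_eval[of h "T v"] point_functional_0[OF kdQ] by simp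

lemma T0_hom: "kd_hom M Q T0"
proof -
  obtain BQ :: "'q set" and xQ where cQ: "coordinates Q BQ xQ (\<lambda>b. b)" using basisQ by blast
  have pf: "point_functional M w (\<lambda>v. h (T0 v))" if h: "point_functional Q w h" for w h
    using Chom_point_functional[OF kdM kdQ T h, of 0]
    by (simp add: coeff_0_const_eval[of h, OF point_functional_0[OF kdQ h]])
  note eq = point_functionals_separate[OF kdQ cQ]
  note DM = kd_moduleD[OF kdM] and DQ = kd_moduleD[OF kdQ]
  have "T0 (u + v) = T0 u + T0 v" if "u \<in> carr M" "v \<in> carr M" for u v
  proof (rule eq)
    show "h (T0 (u + v)) = h (T0 u + T0 v)" if h: "point_functional Q w h" for w h
      using point_functionalD(1)[OF pf[OF h]] point_functionalD(1)[OF h] T0_carr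
        \<open>u \<in> carr M\<close> \<open>v \<in> carr M\<close> by simp
  qed (use that T0_carr DM DQ in auto)
  moreover have "T0 (scal M p u) = scal Q p (T0 u)" if "u \<in> carr M" for p u
  proof (rule eq)
    show "h (T0 (scal M p u)) = h (scal Q p (T0 u))" if h: "point_functional Q w h" for w h
      using point_functionalD(4)[OF pf[OF h]] point_functionalD(4)[OF h] T0_carr
        \<open>u \<in> carr M\<close> by simp
  qed (use that T0_carr DM DQ in auto)
  ultimately show ?thesis using T0_carr by (simp add: kd_hom_def)
qed

lemma T0_point_functional:
  assumes "point_functional Q w h"
  shows "point_functional M w (\<lambda>v. h (T0 v))"
  using assms T0_hom by (simp add: point_functional_def kd_hom_def)

lemma incl_free:
  assumes "s \<in> tensor2_free N Q"
  shows "formal_incl s \<in> tensor2_free P P"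
  unfolding formal_incl_def tensor2_free_supported
  by (rule lin_ext_supported[OF assms[unfolded tensor2_free_supported]])
    (auto simp: P_carr kd_moduleD[OF kdQ] kd_moduleD[OF kdN])

lemma flip_free: "s \<in> tensor2_free P P \<Longrightarrow> formal_flip s \<in> tensor2_free P P"
  unfolding formal_flip_def tensor2_free_supported
  by (rule lin_ext_supported) auto

lemma symmetrised_free: "symmetrised \<in> tensor2_free P P"
  unfolding symmetrised_def by (intro formal.subspace_add[OF subspace_free2] incl_free[OF t] flip_free)

lemma symmetrised_class:
  assumes eta: "eta M Q T = tensor2_rel (conf_dual M) Q `` {t}"
  shows "tensor2_add P P (tensor_incl P (eta M Q T)) (tensor_flip P (tensor_incl P (eta M Q T))) =
      tensor2_rel P P `` {symmetrised}"
    and "tensor_symmetric P (tensor2_rel P P `` {symmetrised})"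
proof -
  obtain I :: "('q + 'm) set" and x e where C: "coordinates P I x e" by (rule P_coordinates)
  note N2 = subspace_null2[of P P]
  have incl_null: "formal_incl s - formal_incl s' \<in> tensor2_null P P"
    if s: "s \<in> tensor2_free N Q" "s' \<in> tensor2_free N Q" "s - s' \<in> tensor2_null N Q" for s s'
  proof (rule tensor2_null_of_eval[OF kdP C kdP C])
    show "formal_incl s - formal_incl s' \<in> tensor2_free P P"
      by (intro formal.subspace_diff[OF subspace_free2] incl_free s)
    fix v w g h assume g: "point_functional P v g" and h: "point_functional P w h"
    note parts = semidirect_point_functional(2,3)[OF kdQ kdN]
    have "eval2 (\<lambda>f. g (0, f)) (\<lambda>a. h (a, 0)) (s - s') = 0"
      by (rule eval2_null[OF _ _ s(3)])
        (use parts(2)[OF g[unfolded dual_semidirect_def]] parts(1)[OF h[unfolded dual_semidirect_def]] in auto)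
    then show "eval2 g h (formal_incl s - formal_incl s') = 0" by (simp add: eval2_incl)
  qed
  have flip_null: "formal_flip s - formal_flip s' \<in> tensor2_null P P"
    if s: "s \<in> tensor2_free P P" "s' \<in> tensor2_free P P" "s - s' \<in> tensor2_null P P" for s s'
  proof (rule tensor2_null_of_eval[OF kdP C kdP C])
    show "formal_flip s - formal_flip s' \<in> tensor2_free P P"
      by (intro formal.subspace_diff[OF subspace_free2] flip_free s)
    fix v w g h assume g: "point_functional P v g" and h: "point_functional P w h"
    show "eval2 g h (formal_flip s - formal_flip s') = 0"
      using eval2_null[OF h g s(3)] by (simp add: eval2_flip)
  qed
  have flip_class: "tensor_flip P (tensor2_rel P P `` {s}) = tensor2_rel P P `` {formal_flip s}"
    if "s \<in> tensor2_free P P" for s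
    unfolding tensor_flip_def tensor2_rel_quot_rel formal_flip_def[symmetric]
    by (rule on_classes_class[OF N2 N2 that]) (use flip_free flip_null that in auto)
  have incl_class: "tensor_incl P (tensor2_rel N Q `` {t}) = tensor2_rel P P `` {formal_incl t}"
    unfolding tensor_incl_def tensor2_rel_quot_rel formal_incl_def[symmetric]
    by (rule on_classes_class[OF subspace_null2 N2 t]) (use incl_free incl_null t in auto)
  show "tensor2_add P P (tensor_incl P (eta M Q T)) (tensor_flip P (tensor_incl P (eta M Q T))) =
      tensor2_rel P P `` {symmetrised}"
    unfolding eta incl_class flip_class[OF incl_free[OF t]] symmetrised_def
    by (rule tensor2_add_classes[OF incl_free[OF t] flip_free[OF incl_free[OF t]]])
  show "tensor_symmetric P (tensor2_rel P P `` {symmetrised})"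
    unfolding tensor_symmetric_def flip_class[OF symmetrised_free]
    by (simp add: symmetrised_def formal_flip_linear formal_flip_flip add.commute)
qed

text \<open>The contraction of \<open>r\<close> with \<open>(h, x)\<close> has the \<open>Q\<close>-component \<open>\<Sum> f\<^sub>-\<^sub>w(x) a\<close> over the terms \<open>f \<otimes> a\<close> of
  \<open>\<eta>(T)\<close>.  It is replaced by \<open>-T\<^sub>0 x = \<Sum> f\<^sub>\<partial>(x) a\<close>, to which it is congruent modulo \<open>\<partial> + w\<close>.\<close>

definition contraction :: "('q \<Rightarrow> 'k) \<Rightarrow> 'm \<Rightarrow> 'q \<times> ('m \<Rightarrow> 'k poly)" where
  "contraction h x = (- T0 x, lin_ext (kscal N) (\<lambda>(f, a). kscal N (h a) f) t)"

lemma contraction_N: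
  shows "snd (contraction h x) \<in> carr N"
    and "point_functional N w \<gamma> \<Longrightarrow> \<gamma> (snd (contraction h x)) = eval2 \<gamma> h t"
proof -
  note D = kd_moduleD[OF kdN]
  have mem: "(case p of (f, a) \<Rightarrow> kscal N (h a) f) \<in> carr N" if "p \<in> Poly_Mapping.keys t" for p
    using t that D by (auto simp: tensor2_free_def)
  note lh = lin_ext_hom[where S = "carr N" and sc = "kscal N" and t = t
      and F = "\<lambda>(f, a). kscal N (h a) f"]
  have zero: "point_functional N 0 (\<lambda>_. 0)" by (simp add: point_functional_def)
  show "snd (contraction h x) \<in> carr N"
    unfolding contraction_def snd_conv
    by (rule lh(1)[OF additive_on_point_functional[OF kdN zero]]) (use D mem in auto)
  assume \<gamma>: "point_functional N w \<gamma>"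
  have "\<gamma> (snd (contraction h x)) = lin_ext (*) (\<lambda>p. \<gamma> (case p of (f, a) \<Rightarrow> kscal N (h a) f)) t"
    unfolding contraction_def snd_conv
    by (rule lh(2)[OF additive_on_point_functional[OF kdN \<gamma>]])
      (use D mem point_functionalD(2)[OF \<gamma>] in auto)
  also have "\<dots> = eval2 \<gamma> h t"
    unfolding eval2_def
    by (rule lin_ext_cong)
      (use t point_functionalD(2)[OF \<gamma>] in \<open>auto simp: tensor2_free_def mult.commute\<close>)
  finally show "\<gamma> (snd (contraction h x)) = eval2 \<gamma> h t" .
qed

lemma contraction_carr: "x \<in> carr M \<Longrightarrow> contraction h x \<in> carr P"
  using contraction_N(1)[of h x] T0_carr kd_moduleD[OF kdQ]
  by (auto simp: P_carr contraction_def)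

lemma contraction_eval:
  assumes h: "point_functional Q w h" and u: "u \<in> carr M"
  shows "poly (snd (contraction h x) u) w = - h (T0 u)"
  using contraction_N(2)[OF eval_point_functional(1)[OF kdM u, of "- w"]] T0_eval[OF u h] by simp

text \<open>The weight \<open>-w\<close> of \<open>\<gamma>\<close> identifies \<open>\<Sum> f\<^sub>-\<^sub>w(x) a\<close> with \<open>-T\<^sub>0 x\<close>.\<close>

lemma contract:
  assumes h: "point_functional Q w h" and x: "x \<in> carr M" and \<gamma>: "point_functional P (- w) \<gamma>"
  shows "lin_ext (*) (\<lambda>(a, b). \<gamma> a * P_functional w h x b) symmetrised = \<gamma> (contraction h x)"
    and "lin_ext (*) (\<lambda>(a, b). P_functional w h x a * \<gamma> b) symmetrised = \<gamma> (contraction h x)"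
proof -
  note parts = semidirect_point_functional(2-4)[OF kdQ kdN \<gamma>[unfolded dual_semidirect_def]]
  have h0: "h 0 = 0" by (rule point_functional_0[OF kdQ h])
  have 1: "eval2 (\<lambda>f. \<gamma> (0, f)) h t = \<gamma> (0, snd (contraction h x))"
    by (rule contraction_N(2)[OF parts(2), symmetric])
  have 2: "eval2 (\<lambda>f. poly (f x) (- w)) (\<lambda>a. \<gamma> (a, 0)) t = \<gamma> (fst (contraction h x), 0)"
    using T0_eval[OF x parts(1)] additive_on_diff[OF additive_on_point_functional[OF kdQ parts(1)], of 0 "T0 x"]
      T0_carr[OF x] kd_moduleD[OF kdQ] point_functional_0[OF kdQ parts(1)]
    by (simp add: contraction_def)
  have 3: "\<gamma> (contraction h x) = \<gamma> (fst (contraction h x), 0) + \<gamma> (0, snd (contraction h x))"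
    using parts(3)[of "fst (contraction h x)" "snd (contraction h x)"] contraction_carr[OF x, of h]
    by (simp add: P_carr mem_Times_iff)
  have fn: "(\<lambda>f. P_functional w h x (0, f)) = (\<lambda>f. poly (f x) (- w))"
    "(\<lambda>a. P_functional w h x (a, 0)) = h"
    by (auto simp: P_functional_def h0)
  have "eval2 \<gamma> (P_functional w h x) symmetrised = \<gamma> (contraction h x)"
    "eval2 (P_functional w h x) \<gamma> symmetrised = \<gamma> (contraction h x)"
    by (simp_all add: symmetrised_def eval2_incl eval2_flip fn 1 2 3)
  then show "lin_ext (*) (\<lambda>(a, b). \<gamma> a * P_functional w h x b) symmetrised = \<gamma> (contraction h x)"
    "lin_ext (*) (\<lambda>(a, b). P_functional w h x a * \<gamma> b) symmetrised = \<gamma> (contraction h x)"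
    by (simp_all add: eval2_def)
qed

text \<open>The value at \<open>\<mu>\<close> of the difference of the two sides of the identity of an \<open>O\<close>-operator for \<open>T\<^sub>0\<close>, under a
  functional \<open>h\<close> of weight \<open>w\<close>.\<close>

definition O_defect :: "'k \<Rightarrow> ('q \<Rightarrow> 'k) \<Rightarrow> 'k \<Rightarrow> 'm \<Rightarrow> 'm \<Rightarrow> 'k" where
  "O_defect w h \<mu> x y = peval h \<mu> (br Q (T0 x) (T0 y)) - peval (\<lambda>v. h (T0 v)) \<mu> (l (T0 x) y)
     - peval (\<lambda>v. h (T0 v)) (- \<mu> - w) (r (T0 y) x)"

text \<open>Since the weights have sum zero, the components of the contractions in \<open>M\<^sup>*\<^sup>c\<close> are evaluated at exactly
  those points where they equal \<open>-h\<^sub>i \<circ> T\<^sub>0\<close>.\<close>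

lemma bracket_eval_contractions:
  assumes h: "point_functional Q w h" "point_functional Q w1 h1" "point_functional Q w2 h2"
    and x: "x \<in> carr M" "x1 \<in> carr M" "x2 \<in> carr M" and sum: "w + w1 + w2 = 0"
  shows "bracket_eval w h x w1 (contraction h1 x1) (contraction h2 x2) =
    peval h w1 (br Q (T0 x1) (T0 x2)) - peval (\<lambda>v. h2 (T0 v)) w1 (l (T0 x1) x)
    + peval (\<lambda>v. h1 (T0 v)) w2 (l (T0 x2) x) + peval (\<lambda>v. h1 (T0 v)) w2 (r (T0 x2) x)"
proof -
  note DQ = kd_moduleD[OF kdQ]
  have "w2 = - (w + w1)" unfolding eq_neg_iff_add_eq_0 using sum by (simp add: add.commute)
  then have w2: "- w - w1 = w2" by simp
  have neg: "g (- a) = - g a" if "point_functional Q v g" "a \<in> carr Q" for v g a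
    using additive_on_diff[OF additive_on_point_functional[OF kdQ that(1)], of 0 a] that(2) DQ
      point_functional_0[OF kdQ that(1)] by simp
  have T: "T0 x1 \<in> carr Q" "T0 x2 \<in> carr Q" "- T0 x1 \<in> carr Q" "- T0 x2 \<in> carr Q"
    using T0_carr x DQ by auto
  have b: "peval h w1 (br Q (- T0 x1) (- T0 x2)) = peval h w1 (br Q (T0 x1) (T0 x2))"
    using neg[OF bracket_point_functional(1)[OF Q h(1) T(4)] T(1)]
      neg[OF bracket_point_functional(2)[OF Q h(1) T(1)] T(2)] by simp
  have act: "peval (\<lambda>u. poly (snd (contraction hi xi) u) wi) \<alpha> (k (- T0 xj) x) =
      peval (\<lambda>v. hi (T0 v)) \<alpha> (k (T0 xj) x)"
    if k: "kd_hom Q (Cend M) k" and hi: "point_functional Q wi hi" and xj: "xj \<in> carr M"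
    for k hi wi xi xj \<alpha>
  proof -
    have "peval (\<lambda>u. poly (snd (contraction hi xi) u) wi) \<alpha> (k (- T0 xj) x) =
        - peval (\<lambda>u. poly (snd (contraction hi xi) u) wi) \<alpha> (k (T0 xj) x)"
      using neg[OF kd_hom_Cend_point_functional(1)[OF kdQ kdM k
            eval_point_functional(2)[OF kdM contraction_N(1)] x(1)] T0_carr[OF xj]] by simp
    also have "peval (\<lambda>u. poly (snd (contraction hi xi) u) wi) \<alpha> (k (T0 xj) x) =
        peval (\<lambda>u. (- 1) * hi (T0 u)) \<alpha> (k (T0 xj) x)"
    proof (rule peval_cong)
      fix n
      have "coeff (k (T0 xj) x) n \<in> carr M"
        using kd_hom_Cend_point_functional(3)[OF kdQ kdM k _ T0_carr[OF xj] x(1), of 0 "\<lambda>_. 0"]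
        by (simp add: point_functional_def poly_over_def)
      then show "poly (snd (contraction hi xi) (coeff (k (T0 xj) x) n)) wi =
          (- 1) * hi (T0 (coeff (k (T0 xj) x) n))"
        using contraction_eval[OF hi] by simp
    qed
    finally show ?thesis unfolding peval_cmult_fun by simp
  qed
  have c: "contraction hi xi = (- T0 xi, snd (contraction hi xi))" for hi xi
    by (simp add: contraction_def)
  show ?thesis
    unfolding bracket_eval_def
    apply (subst (1) c[of h1 x1], subst (1) c[of h2 x2])
    unfolding prod.case w2 b act[OF l_hom h(3) x(2)] act[OF l_hom h(2) x(3)] act[OF r_hom h(2) x(3)]
    by simp
qed

text \<open>The four terms of \<open>[[r,r]]\<close> are contracted with the functionals in the two factors that do not
  contain the bracket.  In the resulting twelve terms with \<open>l\<close> and \<open>r\<close>, those with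
  \<open>h\<^sub>1 \<circ> T\<^sub>0\<close> and those with \<open>h\<^sub>3 \<circ> T\<^sub>0\<close> partly cancel.\<close>

lemma yb_symmetrised_eval:
  assumes h: "point_functional Q w1 h1" "point_functional Q w2 h2" "point_functional Q w3 h3"
    and x: "x1 \<in> carr M" "x2 \<in> carr M" "x3 \<in> carr M" and sum: "w1 + w2 + w3 = 0"
  shows "eval3 (P_functional w1 h1 x1) (P_functional w2 h2 x2) (P_functional w3 h3 x3)
      (yb_formal P symmetrised) =
    O_defect w1 h1 w2 x2 x3 + O_defect w3 h3 w2 x2 x1
    - O_defect w2 h2 w1 x1 x3 - O_defect w2 h2 w3 x3 x1"
proof -
  let ?f = "P_functional w1 h1 x1" and ?g = "P_functional w2 h2 x2" and ?h = "P_functional w3 h3 x3"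
  let ?c1 = "contraction h1 x1" and ?c2 = "contraction h2 x2" and ?c3 = "contraction h3 x3"
  note f = P_functional_point_functional[OF h(1) x(1)]
    and g = P_functional_point_functional[OF h(2) x(2)]
    and h' = P_functional_point_functional[OF h(3) x(3)]
  have w: "w2 + w1 = - w3" "w3 + w2 = - w1" "w2 + w3 = - w1" "w1 + w2 = - w3" "- w1 - w2 = w3"
    "- w2 - w1 = w3" "- w2 - w3 = w1" "- w1 - w3 = w2" "- w3 - w2 = w1"
  proof -
    have "w3 = - (w1 + w2)" unfolding eq_neg_iff_add_eq_0 using sum by (simp add: add.commute)
    then show "w2 + w1 = - w3" "w3 + w2 = - w1" "w2 + w3 = - w1" "w1 + w2 = - w3" "- w1 - w2 = w3"
      "- w2 - w1 = w3" "- w2 - w3 = w1" "- w1 - w3 = w2" "- w3 - w2 = w1"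
      by simp_all
  qed
  have k: "p \<in> carr P \<times> carr P" if "p \<in> Poly_Mapping.keys symmetrised" for p
    using symmetrised_free that by (auto simp: tensor2_free_def)
  note c1 = contraction_carr[OF x(1), of h1] and c2 = contraction_carr[OF x(2), of h2]
    and c3 = contraction_carr[OF x(3), of h3]
  note B1 = bracket_P_point_functional(1) and B2 = bracket_P_point_functional(2)
  note C1 = contract[OF h(1) x(1)] and C2 = contract[OF h(2) x(2)] and C3 = contract[OF h(3) x(3)]
  have inner: "lin_ext (*) (yb_eval ?f ?g ?h w1 w2 (a, b)) symmetrised =
      peval ?f w2 (br P a ?c3) * ?g b + ?f a * peval ?h w2 (br P ?c2 b)
      - ?f a * peval ?g w1 (br P b ?c3) - ?f a * peval ?g w3 (br P ?c3 b)"
    if a: "a \<in> carr P" and b: "b \<in> carr P" for a b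
  proof -
    have "lin_ext (*) (yb_eval ?f ?g ?h w1 w2 (a, b)) symmetrised =
        lin_ext (*) (\<lambda>q. (?g b * (case q of (a', b') \<Rightarrow> peval ?f w2 (br P a a') * ?h b')
          + ?f a * (case q of (a', b') \<Rightarrow> ?g a' * peval ?h w2 (br P b' b))
          - ?f a * (case q of (a', b') \<Rightarrow> peval ?g w1 (br P b a') * ?h b'))
          - ?f a * (case q of (a', b') \<Rightarrow> peval ?g w3 (br P a' b) * ?h b')) symmetrised"
      by (rule lin_ext_cong) (auto simp: yb_eval_def w algebra_simps)
    also have "\<dots> = ?g b * peval ?f w2 (br P a ?c3) + ?f a * peval ?h w2 (br P ?c2 b)
      - ?f a * peval ?g w1 (br P b ?c3) - ?f a * peval ?g w3 (br P ?c3 b)"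
      unfolding lin_ext_diff_fun lin_ext_add_fun lin_ext_cmult_fun
        C3(1)[OF B2[OF f a, of w2, unfolded w]] C2(2)[OF B1[OF h' b, of w2]]
        C3(1)[OF B2[OF g b, of w1, unfolded w]] C3(1)[OF B1[OF g b, of w3]] ..
    finally show ?thesis by (simp add: mult.commute)
  qed
  have "eval3 ?f ?g ?h (yb_formal P symmetrised) =
      lin_ext (*) (\<lambda>p. lin_ext (*) (yb_eval ?f ?g ?h w1 w2 p) symmetrised) symmetrised"
    by (rule yb_formal_eval(2)[OF f g h' symmetrised_free])
  also have "\<dots> = lin_ext (*) (\<lambda>p. (case p of (a, b) \<Rightarrow> peval ?f w2 (br P a ?c3) * ?g b)
      + (case p of (a, b) \<Rightarrow> ?f a * peval ?h w2 (br P ?c2 b))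
      - (case p of (a, b) \<Rightarrow> ?f a * peval ?g w1 (br P b ?c3))
      - (case p of (a, b) \<Rightarrow> ?f a * peval ?g w3 (br P ?c3 b))) symmetrised"
    by (rule lin_ext_cong) (use k inner in fastforce)
  also have "\<dots> = peval ?f w2 (br P ?c2 ?c3) + peval ?h w2 (br P ?c2 ?c1)
      - peval ?g w1 (br P ?c1 ?c3) - peval ?g w3 (br P ?c3 ?c1)"
    unfolding lin_ext_diff_fun lin_ext_add_fun
      C2(1)[OF B1[OF f c3, of w2]] C1(2)[OF B2[OF h' c2, of w2, unfolded w]]
      C1(2)[OF B1[OF g c3, of w1]] C1(2)[OF B2[OF g c3, of w3, unfolded w]] ..
  also have "\<dots> = bracket_eval w1 h1 x1 w2 ?c2 ?c3 + bracket_eval w3 h3 x3 w2 ?c2 ?c1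
      - bracket_eval w2 h2 x2 w1 ?c1 ?c3 - bracket_eval w2 h2 x2 w3 ?c3 ?c1"
    by (simp only: bracket_P(2)[OF c2 c3 h(1) x(1)] bracket_P(2)[OF c2 c1 h(3) x(3)]
        bracket_P(2)[OF c1 c3 h(2) x(2)] bracket_P(2)[OF c3 c1 h(2) x(2)])
  also have "\<dots> = O_defect w1 h1 w2 x2 x3 + O_defect w3 h3 w2 x2 x1
    - O_defect w2 h2 w1 x1 x3 - O_defect w2 h2 w3 x3 x1"
  proof -
    have s: "w1 + w2 + w3 = 0" "w3 + w2 + w1 = 0" "w2 + w1 + w3 = 0" "w2 + w3 + w1 = 0"
      using sum by (simp_all add: algebra_simps)
    show ?thesis
      unfolding O_defect_def w
        bracket_eval_contractions[OF h(1) h(2) h(3) x(1) x(2) x(3) s(1)]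
        bracket_eval_contractions[OF h(3) h(2) h(1) x(3) x(2) x(1) s(2)]
        bracket_eval_contractions[OF h(2) h(1) h(3) x(2) x(1) x(3) s(3)]
        bracket_eval_contractions[OF h(2) h(3) h(1) x(2) x(3) x(1) s(4)]
      by (simp add: algebra_simps)
  qed
  finally show ?thesis .
qed

lemma O_operator_iff:
  "O_operator Q M l r T0 \<longleftrightarrow> (\<forall>w h \<mu>. \<forall>x\<in>carr M. \<forall>y\<in>carr M.
     point_functional Q w h \<longrightarrow> O_defect w h \<mu> x y = 0)"
proof -
  obtain BQ :: "'q set" and xQ where cQ: "coordinates Q BQ xQ (\<lambda>b. b)" using basisQ by blast
  let ?R = "\<lambda>x y. map_poly T0 (l (T0 x) y + flip_act M r (T0 y) x)"
  have T00: "T0 0 = 0"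
    using T0_hom kd_moduleD[OF kdM] kd_moduleD[OF kdQ] unfolding kd_hom_def by metis
  have "br Q (T0 x) (T0 y) = ?R x y \<longleftrightarrow>
      (\<forall>w h \<mu>. point_functional Q w h \<longrightarrow> O_defect w h \<mu> x y = 0)"
    if x: "x \<in> carr M" and y: "y \<in> carr M" for x y
  proof -
    have ly: "l (T0 x) y \<in> poly_over (carr M)" and rx: "r (T0 y) x \<in> poly_over (carr M)"
      using l_poly r_poly T0_carr x y by auto
    have zero: "point_functional M 0 (\<lambda>_. 0)" by (simp add: point_functional_def)
    have fl: "flip_act M r (T0 y) x \<in> poly_over (carr M)"
      unfolding flip_act_def by (rule peval_subst_flip(1)[OF kdM zero rx])
    have R: "?R x y \<in> poly_over (carr Q)"
      using map_poly_poly_over[where f = T0 and S = "carr M" and S' = "carr Q", OF T00 T0_carr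
          poly_over_add[OF kdM ly fl]] by simp
    have br: "br Q (T0 x) (T0 y) \<in> poly_over (carr Q)"
      using Q T0_carr x y by (simp add: leibniz_conformal_algebra_def)
    have ev: "O_defect w h \<mu> x y = peval h \<mu> (br Q (T0 x) (T0 y)) - peval h \<mu> (?R x y)"
      if h: "point_functional Q w h" for w h \<mu>
    proof -
      note hT = T0_point_functional[OF h]
      have "peval h \<mu> (?R x y) = peval (\<lambda>v. h (T0 v)) \<mu> (l (T0 x) y + flip_act M r (T0 y) x)"
        by (rule peval_map_poly[where E = T0 and h = h, OF T00 point_functional_0[OF kdQ h]])
      also have "\<dots> = peval (\<lambda>v. h (T0 v)) \<mu> (l (T0 x) y)
          + peval (\<lambda>v. h (T0 v)) (- \<mu> - w) (r (T0 y) x)"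
        using peval_add[OF kdM hT ly fl] peval_subst_flip(2)[OF kdM hT rx] by (simp add: flip_act_def)
      finally show ?thesis by (simp add: O_defect_def)
    qed
    show ?thesis
    proof
      assume "br Q (T0 x) (T0 y) = ?R x y"
      then show "\<forall>w h \<mu>. point_functional Q w h \<longrightarrow> O_defect w h \<mu> x y = 0" using ev by simp
    next
      assume 0: "\<forall>w h \<mu>. point_functional Q w h \<longrightarrow> O_defect w h \<mu> x y = 0"
      show "br Q (T0 x) (T0 y) = ?R x y"
        by (rule poly_over_ext[OF kdQ cQ br R]) (use 0 ev in force)
    qed
  qed
  then show ?thesis using T0_hom unfolding O_operator_def by blast
qed

lemma exact3_iff_O_operator:
  "yb_formal P symmetrised \<in> exact3 P \<longleftrightarrow> O_operator Q M l r T0"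
proof
  assume ex: "yb_formal P symmetrised \<in> exact3 P"
  have "O_defect w h \<mu> x y = 0"
    if h: "point_functional Q w h" and x: "x \<in> carr M" and y: "y \<in> carr M" for w h \<mu> x y
  proof -
    have zero: "point_functional Q v (\<lambda>_. 0)" for v by (simp add: point_functional_def)
    have 0: "(0 :: 'm) \<in> carr M" by (rule kd_moduleD(1)[OF kdM])
    have d0: "O_defect v (\<lambda>_. 0) \<nu> a b = 0" for v \<nu> a b
      by (simp add: O_defect_def peval_def)
    have sum: "w + \<mu> + (- w - \<mu>) = 0" by simp
    \<comment> \<open>with these choices the other three defects in the identity vanish\<close>
    have "O_defect w h \<mu> x y = eval3 (P_functional w h 0) (P_functional \<mu> (\<lambda>_. 0) x)
        (P_functional (- w - \<mu>) (\<lambda>_. 0) y) (yb_formal P symmetrised)"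
      using yb_symmetrised_eval[OF h zero zero 0 x y sum] by (simp add: d0)
    also have "\<dots> = 0"
      by (rule eval3_exact3[OF kdP P_functional_point_functional[OF h 0]
          P_functional_point_functional[OF zero x] P_functional_point_functional[OF zero y] sum ex])
    finally show ?thesis .
  qed
  then show "O_operator Q M l r T0" by (simp add: O_operator_iff)
next
  assume O: "O_operator Q M l r T0"
  obtain I :: "('q + 'm) set" and x e where C: "coordinates P I x e" by (rule P_coordinates)
  have zero: "point_functional P 0 (\<lambda>_. 0)" by (simp add: point_functional_def)
  have free: "yb_formal P symmetrised \<in> tensor3_free P"
    by (rule yb_formal_eval(1)[OF zero zero zero symmetrised_free])
  show "yb_formal P symmetrised \<in> exact3 P"
  proof (rule exact3_of_eval[OF kdP C free])
    fix w1 w2 w3 f g h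
    assume f: "point_functional P w1 f" and g: "point_functional P w2 g"
      and h: "point_functional P w3 h" and sum: "w1 + w2 + w3 = 0"
    obtain h1 x1 where 1: "point_functional Q w1 h1" "x1 \<in> carr M"
      "\<And>p. p \<in> carr P \<Longrightarrow> f p = P_functional w1 h1 x1 p" using P_functional_cases[OF f] by metis
    obtain h2 x2 where 2: "point_functional Q w2 h2" "x2 \<in> carr M"
      "\<And>p. p \<in> carr P \<Longrightarrow> g p = P_functional w2 h2 x2 p" using P_functional_cases[OF g] by metis
    obtain h3 x3 where 3: "point_functional Q w3 h3" "x3 \<in> carr M"
      "\<And>p. p \<in> carr P \<Longrightarrow> h p = P_functional w3 h3 x3 p" using P_functional_cases[OF h] by metis
    have "eval3 f g h (yb_formal P symmetrised) =
        eval3 (P_functional w1 h1 x1) (P_functional w2 h2 x2) (P_functional w3 h3 x3) (yb_formal P symmetrised)"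
      unfolding eval3_def
      by (rule lin_ext_cong) (use free 1(3) 2(3) 3(3) in \<open>auto simp: tensor3_free_def\<close>)
    also have "\<dots> = 0"
      using O unfolding yb_symmetrised_eval[OF 1(1) 2(1) 3(1) 1(2) 2(2) 3(2) sum] O_operator_iff
      using 1 2 3 by simp
    finally show "eval3 f g h (yb_formal P symmetrised) = 0" .
  qed
qed

end

theorem theorem4p11:
  fixes Q :: "('k::field_char_0, 'q::ab_group_add) conf_alg"
    and M :: "('k, 'm::ab_group_add) kd_module"
    and l r :: "'q \<Rightarrow> 'm \<Rightarrow> 'm poly"
    and T :: "'m \<Rightarrow> 'q poly"
    and P :: "('k, 'q \<times> ('m \<Rightarrow> 'k poly)) conf_alg"
    and R :: "(('q \<times> ('m \<Rightarrow> 'k poly)) \<times> ('q \<times> ('m \<Rightarrow> 'k poly)) \<Rightarrow>\<^sub>0 'k) set"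
  assumes "leibniz_conformal_algebra Q"
    and "lca_representation Q M l r"
    and "kd_finite Q" and "kd_free Q"
    and "kd_finite M" and "kd_free M"
    and "T \<in> carr (Chom M Q)"
  defines "P \<equiv> dual_semidirect Q M l r"
  defines "R \<equiv> tensor2_add P P (tensor_incl P (eta M Q T))
                 (tensor_flip P (tensor_incl P (eta M Q T)))"
  shows "tensor_symmetric P R \<and> CLCYBE_solution P R \<longleftrightarrow>
         O_operator Q M l r (\<lambda>v. coeff (T v) 0)"
proof -
  interpret lca_representation_on_free Q M l r
    by unfold_locales (fact assms)+
  obtain BQ :: "'q set" and xQ where cQ: "coordinates Q BQ xQ (\<lambda>b. b)" using basisQ by blast
  obtain BM :: "'m set" and xM where cM: "coordinates M BM xM (\<lambda>b. b)" "finite BM"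
    using basisM by blast
  obtain t where t_eta: "t \<in> tensor2_free (conf_dual M) Q"
    "eta M Q T = tensor2_rel (conf_dual M) Q `` {t}"
    "\<And>v w h \<alpha>. v \<in> carr M \<Longrightarrow> point_functional Q w h \<Longrightarrow>
       peval h \<alpha> (T v) = - eval2 (\<lambda>f. poly (f v) (\<alpha> + w)) h t"
    by (rule eta_representative[OF kdQ cQ kdM cM assms(7)]) blast
  interpret lca_tensor Q M l r T t
    by unfold_locales (use assms(7) t_eta in auto)
  obtain I :: "('q + 'm) set" and x e where C: "coordinates P I x e"
    using P_coordinates unfolding P_def by blast
  have zero: "point_functional P 0 (\<lambda>_. 0)" by (simp add: point_functional_def)
  have R: "R = tensor2_rel P P `` {symmetrised}"
    unfolding R_def P_def by (rule symmetrised_class(1)[OF t_eta(2)])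
  have "CLCYBE_solution P R \<longleftrightarrow> yb_formal P symmetrised \<in> exact3 P"
    unfolding R
  proof (rule CLCYBE_solution_class[OF _ C])
    show "kd_module P" "symmetrised \<in> tensor2_free P P" unfolding P_def by (rule kdP symmetrised_free)+
    show "yb_formal P s \<in> tensor3_free P" if "s \<in> tensor2_free P P" for s
      using yb_formal_eval(1) zero that unfolding P_def by blast
    show "yb_formal P s - yb_formal P u \<in> tensor3_null P"
      if "s \<in> tensor2_free P P" "u \<in> tensor2_free P P" "s - u \<in> tensor2_null P P" for s u
      using yb_formal_respects that unfolding P_def by blast
  qed
  moreover have "tensor_symmetric P R"
    unfolding R P_def by (rule symmetrised_class(2)[OF t_eta(2)])
  ultimately show ?thesis
    using exact3_iff_O_operator unfolding P_def by blast
qed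

end
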